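(* Let $p$ be a prime and let $\mathcal{U}\subseteq\mathcal{G}$ be the full subcategory of elementary abelian $p$-groups or the full subcategory of cyclic $p$-groups. Then $\mathrm{Spc}(\mathrm{A}(\mathcal{U})^{c})$ is homeomorphic to $\mathbb{N}^{*}$, the one-point compactification of (discrete) $\mathbb{N}$.
   Context: Fix a field $k$ of characteristic $0$. $\mathcal{G}$ is the category of finite groups and conjugacy classes of surjective group homomorphisms. Both families of groups include the trivial group. $\mathrm{A}(\mathcal{U})$ is the abelian category of functors $\mathcal{U}^{op}\to \mathrm{Mod}\,k$, with pointwise tensor product and unit $\mathbf{1}$ the constant functor with value $k$. For $G\in\mathcal{U}$, $e_G:=k[\mathrm{Hom}_{\mathcal{U}}(-,G)]$. An object $X$ is finitely generated if there is an epimorphism $\bigoplus_{i=1}^n e_{G_i}\twoheadrightarrow X$ with $n$ finite and $G_i\in\mathcal{U}$. $\mathrm{A}(\mathcal{U})^c$ is the full subcategory of finitely generated objects; for these families it is a tensor abelian category (abelian, with symmetric monoidal structure whose tensor product is exact in each variable), because every subobject of each $e_G$ is finitely generated (a known theorem of Pol and Strickland). A Serre subcategory of an abelian category is a nonempty full subcategory $\mathcal{D}$ such that for every short exact sequence $0\to A\to B\to C\to 0$, $B\in\mathcal{D}$ iff $A,C\in\mathcal{D}$. A Serre ideal of a tensor abelian category $\mathcal{A}$ is a Serre subcategory $\mathcal{D}$ with $X\otimes Y\in\mathcal{D}$ for all $X\in\mathcal{D}$, $Y\in\mathcal{A}$. A proper Serre ideal $P$ is prime if $X\otimes Y\in P$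 implies $X\in P$ or $Y\in P$. $\mathrm{Spc}(\mathcal{A})$ is the set of prime Serre ideals, with the Zariski topology: the closed subsets are those of the form $Z(S)=\{P\mid P\cap S=\varnothing\}$ for a family $S$ of objects of $\mathcal{A}$. *)

theory Defs
  imports
    "HOL-Analysis.Analysis"
    "HOL-Algebra.Elementary_Groups"
    "Jordan_Normal_Form.Missing_VectorSpace"
begin

section \<open>Finite groups and conjugacy classes of surjections\<close>

text \<open>Every finite group is isomorphic to one whose underlying set consists of natural numbers,
  so these groups represent the category of finite groups up to equivalence.\<close>

definition finite_groups :: "nat monoid set" where
  "finite_groups = {G. group G \<and> finite (carrier G)}"

text \<open>Homomorphisms are made extensional (\<open>undefined\<close> off the carrier), so that equality of
  functions is equality of homomorphisms.\<close>

definition surjections :: "nat monoid \<Rightarrow> nat monoid \<Rightarrow> (nat \<Rightarrow> nat) set" where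
  "surjections G H = epi G H \<inter> extensional (carrier G)"

definition conj_class :: "nat monoid \<Rightarrow> nat monoid \<Rightarrow> (nat \<Rightarrow> nat) \<Rightarrow> (nat \<Rightarrow> nat) set" where
  "conj_class G H f =
     {\<lambda>x\<in>carrier G. h \<otimes>\<^bsub>H\<^esub> f x \<otimes>\<^bsub>H\<^esub> inv\<^bsub>H\<^esub> h | h. h \<in> carrier H}"

definition Hom :: "nat monoid \<Rightarrow> nat monoid \<Rightarrow> (nat \<Rightarrow> nat) set set" where
  "Hom G H = conj_class G H ` surjections G H"

definition id_class :: "nat monoid \<Rightarrow> (nat \<Rightarrow> nat) set" where
  "id_class G = conj_class G G (\<lambda>x\<in>carrier G. x)"

text \<open>For \<open>\<alpha> : G \<rightarrow> H\<close> and \<open>\<beta> : H \<rightarrow> L\<close>. The set of all composites of representatives is again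
  exactly one conjugacy class, because \<open>g (h \<cdot> f x \<cdot> h\<inverse>) = g h \<cdot> g (f x) \<cdot> (g h)\<inverse>\<close>.\<close>

definition comp_class ::
    "nat monoid \<Rightarrow> (nat \<Rightarrow> nat) set \<Rightarrow> (nat \<Rightarrow> nat) set \<Rightarrow> (nat \<Rightarrow> nat) set" where
  "comp_class G \<beta> \<alpha> = {compose (carrier G) g f | g f. g \<in> \<beta> \<and> f \<in> \<alpha>}"

definition elementary_abelian_groups :: "nat \<Rightarrow> nat monoid set" where
  "elementary_abelian_groups p =
     {G \<in> finite_groups. comm_group G \<and> (\<forall>x\<in>carrier G. x [^]\<^bsub>G\<^esub> p = \<one>\<^bsub>G\<^esub>)}"

definition cyclic_p_groups :: "nat \<Rightarrow> nat monoid set" where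
  "cyclic_p_groups p = {G \<in> finite_groups. cyclic_group G \<and> (\<exists>n. order G = p ^ n)}"


section \<open>The functor category\<close>

text \<open>Data of a contravariant functor from a full subcategory \<open>U\<close> of the category of finite groups
  to modules: \<open>arr X G H \<alpha>\<close>, for \<open>\<alpha> : G \<rightarrow> H\<close>, is the map \<open>obj X H \<rightarrow> obj X G\<close>. Values outside
  \<open>U\<close>, outside \<open>Hom G H\<close> and outside the module carriers are irrelevant.\<close>

record ('k, 'v) functor_data =
  obj :: "nat monoid \<Rightarrow> ('k, 'v) module"
  arr :: "nat monoid \<Rightarrow> nat monoid \<Rightarrow> (nat \<Rightarrow> nat) set \<Rightarrow> 'v \<Rightarrow> 'v"

definition is_functor :: "'k ring \<Rightarrow> nat monoid set \<Rightarrow> ('k, 'v) functor_data \<Rightarrow> bool" where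
  "is_functor K U X \<longleftrightarrow>
     (\<forall>G\<in>U. Module.module K (obj X G)) \<and>
     (\<forall>G\<in>U. \<forall>H\<in>U. \<forall>\<alpha>\<in>Hom G H.
        arr X G H \<alpha> \<in> LinearCombinations.module_hom K (obj X H) (obj X G)) \<and>
     (\<forall>G\<in>U. \<forall>v\<in>carrier (obj X G). arr X G G (id_class G) v = v) \<and>
     (\<forall>G\<in>U. \<forall>H\<in>U. \<forall>L\<in>U. \<forall>\<alpha>\<in>Hom G H. \<forall>\<beta>\<in>Hom H L. \<forall>v\<in>carrier (obj X L).
        arr X G L (comp_class G \<beta> \<alpha>) v = arr X G H \<alpha> (arr X H L \<beta> v))"

definition nat_trans ::
    "'k ring \<Rightarrow> nat monoid set \<Rightarrow> ('k, 'v) functor_data \<Rightarrow> ('k, 'w) functor_data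
      \<Rightarrow> (nat monoid \<Rightarrow> 'v \<Rightarrow> 'w) \<Rightarrow> bool" where
  "nat_trans K U X Y \<phi> \<longleftrightarrow>
     (\<forall>G\<in>U. \<phi> G \<in> LinearCombinations.module_hom K (obj X G) (obj Y G)) \<and>
     (\<forall>G\<in>U. \<forall>H\<in>U. \<forall>\<alpha>\<in>Hom G H. \<forall>v\<in>carrier (obj X H).
        \<phi> G (arr X G H \<alpha> v) = arr Y G H \<alpha> (\<phi> H v))"

text \<open>Kernels and cokernels, hence monomorphisms, epimorphisms and exactness, are computed
  objectwise in a functor category.\<close>

definition epimorphism ::
    "'k ring \<Rightarrow> nat monoid set \<Rightarrow> ('k, 'v) functor_data \<Rightarrow> ('k, 'w) functor_data
      \<Rightarrow> (nat monoid \<Rightarrow> 'v \<Rightarrow> 'w) \<Rightarrow> bool" where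
  "epimorphism K U X Y \<phi> \<longleftrightarrow>
     nat_trans K U X Y \<phi> \<and> (\<forall>G\<in>U. \<phi> G ` carrier (obj X G) = carrier (obj Y G))"

definition short_exact ::
    "'k ring \<Rightarrow> nat monoid set \<Rightarrow> ('k, 'v) functor_data \<Rightarrow> (nat monoid \<Rightarrow> 'v \<Rightarrow> 'v)
      \<Rightarrow> ('k, 'v) functor_data \<Rightarrow> (nat monoid \<Rightarrow> 'v \<Rightarrow> 'v) \<Rightarrow> ('k, 'v) functor_data \<Rightarrow> bool" where
  "short_exact K U A \<phi> B \<psi> C \<longleftrightarrow>
     nat_trans K U A B \<phi> \<and> nat_trans K U B C \<psi> \<and>
     (\<forall>G\<in>U. inj_on (\<phi> G) (carrier (obj A G)) \<and>
        \<phi> G ` carrier (obj A G) = {b \<in> carrier (obj B G). \<psi> G b = \<zero>\<^bsub>obj C G\<^esub>} \<and>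
        \<psi> G ` carrier (obj B G) = carrier (obj C G))"


subsection \<open>Tensor products\<close>

definition bilinear_map ::
    "'k ring \<Rightarrow> ('k, 'u) module \<Rightarrow> ('k, 'v) module \<Rightarrow> ('k, 'w) module
      \<Rightarrow> ('u \<Rightarrow> 'v \<Rightarrow> 'w) \<Rightarrow> bool" where
  "bilinear_map K M N T b \<longleftrightarrow>
     (\<forall>x\<in>carrier M. b x \<in> LinearCombinations.module_hom K N T) \<and>
     (\<forall>y\<in>carrier N. (\<lambda>x. b x y) \<in> LinearCombinations.module_hom K M T)"

definition tensor_product ::
    "'k ring \<Rightarrow> ('k, 'v) module \<Rightarrow> ('k, 'v) module \<Rightarrow> ('k, 'v) module
      \<Rightarrow> ('v \<Rightarrow> 'v \<Rightarrow> 'v) \<Rightarrow> bool" where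
  "tensor_product K M N T b \<longleftrightarrow>
     Module.module K T \<and> bilinear_map K M N T b \<and>
     (\<forall>(W :: ('k, 'v) module) c. Module.module K W \<and> bilinear_map K M N W c \<longrightarrow>
        (\<exists>!h. h \<in> LinearCombinations.module_hom K T W \<inter> extensional (carrier T) \<and>
              (\<forall>x\<in>carrier M. \<forall>y\<in>carrier N. h (b x y) = c x y)))"

text \<open>\<open>Z\<close> is (a model of) the pointwise tensor product of \<open>X\<close> and \<open>Y\<close>; it is determined up to
  isomorphism.\<close>

definition is_tensor ::
    "'k ring \<Rightarrow> nat monoid set \<Rightarrow> ('k, 'v) functor_data \<Rightarrow> ('k, 'v) functor_data
      \<Rightarrow> ('k, 'v) functor_data \<Rightarrow> bool" where
  "is_tensor K U X Y Z \<longleftrightarrow>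
     (\<exists>b. (\<forall>G\<in>U. tensor_product K (obj X G) (obj Y G) (obj Z G) (b G)) \<and>
          (\<forall>G\<in>U. \<forall>H\<in>U. \<forall>\<alpha>\<in>Hom G H. \<forall>x\<in>carrier (obj X H). \<forall>y\<in>carrier (obj Y H).
             arr Z G H \<alpha> (b H x y) = b G (arr X G H \<alpha> x) (arr Y G H \<alpha> y)))"


subsection \<open>Finitely generated functors\<close>

text \<open>\<open>e_G = k[Hom(-,G)]\<close>. As \<open>Hom H G\<close> is finite, the free module on it is the module of all
  functions on it; \<open>\<alpha> : H \<rightarrow> H'\<close> acts as the linear extension of \<open>\<beta> \<mapsto> \<beta> \<circ> \<alpha>\<close> on
  \<open>Hom H' G\<close>.\<close>

definition e_functor ::
    "'k ring \<Rightarrow> nat monoid \<Rightarrow> ('k, (nat \<Rightarrow> nat) set \<Rightarrow> 'k) functor_data" where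
  "e_functor K G = \<lparr>
     obj = (\<lambda>H. ring.func_space K (Hom H G)),
     arr = (\<lambda>H H' \<alpha> c. \<lambda>\<gamma>\<in>Hom H G. \<Oplus>\<^bsub>K\<^esub>\<beta>\<in>{\<beta> \<in> Hom H' G. comp_class H \<beta> \<alpha> = \<gamma>}. c \<beta>)\<rparr>"

definition module_sum :: "nat \<Rightarrow> (nat \<Rightarrow> ('k, 'v) module) \<Rightarrow> ('k, nat \<Rightarrow> 'v) module" where
  "module_sum n M = \<lparr>
     carrier = (\<Pi>\<^sub>E i\<in>{..<n}. carrier (M i)),
     mult = (\<lambda>_ _. \<lambda>i\<in>{..<n}. \<zero>\<^bsub>M i\<^esub>), one = (\<lambda>i\<in>{..<n}. \<zero>\<^bsub>M i\<^esub>), \<comment> \<open>irrelevant\<close>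
     zero = (\<lambda>i\<in>{..<n}. \<zero>\<^bsub>M i\<^esub>),
     add = (\<lambda>v w. \<lambda>i\<in>{..<n}. v i \<oplus>\<^bsub>M i\<^esub> w i),
     smult = (\<lambda>a v. \<lambda>i\<in>{..<n}. a \<odot>\<^bsub>M i\<^esub> v i)\<rparr>"

definition functor_sum ::
    "nat \<Rightarrow> (nat \<Rightarrow> ('k, 'v) functor_data) \<Rightarrow> ('k, nat \<Rightarrow> 'v) functor_data" where
  "functor_sum n X = \<lparr>
     obj = (\<lambda>G. module_sum n (\<lambda>i. obj (X i) G)),
     arr = (\<lambda>G H \<alpha> v. \<lambda>i\<in>{..<n}. arr (X i) G H \<alpha> (v i))\<rparr>"

definition finitely_generated ::
    "'k ring \<Rightarrow> nat monoid set \<Rightarrow> ('k, 'v) functor_data \<Rightarrow> bool" where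
  "finitely_generated K U X \<longleftrightarrow>
     (\<exists>n Gs \<phi>. (\<forall>i<n. Gs i \<in> U) \<and>
        epimorphism K U (functor_sum n (\<lambda>i. e_functor K (Gs i))) X \<phi>)"

text \<open>The objects of \<open>A(U)\<^sup>c\<close>. The values of a finitely generated functor are finite-dimensional, so
  up to isomorphism no functor is lost by taking the underlying sets of the modules to be sets of
  sequences of scalars. Any module structure on such a set is allowed.\<close>

definition fg_functors :: "'k ring \<Rightarrow> nat monoid set \<Rightarrow> ('k, nat \<Rightarrow> 'k) functor_data set" where
  "fg_functors K U = {X. is_functor K U X \<and> finitely_generated K U X}"


section \<open>The spectrum\<close>

text \<open>A full subcategory is given by its set of objects.\<close>

definition serre_subcategory ::
    "'k ring \<Rightarrow> nat monoid set \<Rightarrow> ('k, nat \<Rightarrow> 'k) functor_data set \<Rightarrow> bool" where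
  "serre_subcategory K U D \<longleftrightarrow>
     D \<subseteq> fg_functors K U \<and> D \<noteq> {} \<and>
     (\<forall>A\<in>fg_functors K U. \<forall>B\<in>fg_functors K U. \<forall>C\<in>fg_functors K U. \<forall>\<phi> \<psi>.
        short_exact K U A \<phi> B \<psi> C \<longrightarrow> (B \<in> D \<longleftrightarrow> A \<in> D \<and> C \<in> D))"

definition serre_ideal ::
    "'k ring \<Rightarrow> nat monoid set \<Rightarrow> ('k, nat \<Rightarrow> 'k) functor_data set \<Rightarrow> bool" where
  "serre_ideal K U D \<longleftrightarrow>
     serre_subcategory K U D \<and>
     (\<forall>X\<in>D. \<forall>Y\<in>fg_functors K U. \<forall>Z\<in>fg_functors K U. is_tensor K U X Y Z \<longrightarrow> Z \<in> D)"

definition prime_serre_ideal ::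
    "'k ring \<Rightarrow> nat monoid set \<Rightarrow> ('k, nat \<Rightarrow> 'k) functor_data set \<Rightarrow> bool" where
  "prime_serre_ideal K U P \<longleftrightarrow>
     serre_ideal K U P \<and> P \<noteq> fg_functors K U \<and>
     (\<forall>X\<in>fg_functors K U. \<forall>Y\<in>fg_functors K U. \<forall>Z\<in>P. is_tensor K U X Y Z \<longrightarrow> X \<in> P \<or> Y \<in> P)"

definition Spc_points ::
    "'k ring \<Rightarrow> nat monoid set \<Rightarrow> ('k, nat \<Rightarrow> 'k) functor_data set set" where
  "Spc_points K U = {P. prime_serre_ideal K U P}"

definition Spc_closed ::
    "'k ring \<Rightarrow> nat monoid set \<Rightarrow> ('k, nat \<Rightarrow> 'k) functor_data set
      \<Rightarrow> ('k, nat \<Rightarrow> 'k) functor_data set set" where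
  "Spc_closed K U S = {P \<in> Spc_points K U. P \<inter> S = {}}"

definition Spc ::
    "'k ring \<Rightarrow> nat monoid set \<Rightarrow> ('k, nat \<Rightarrow> 'k) functor_data set topology" where
  "Spc K U = topology (\<lambda>V. \<exists>S\<subseteq>fg_functors K U. V = Spc_points K U - Spc_closed K U S)"

end

theory Submission
  imports Defs "HOL-Algebra.Sylow" "HOL-Algebra.Multiplicative_Group" "HOL-Number_Theory.Cong"
begin

text \<open>
  Say that a group of order \<open>p\<^sup>n\<close> has level \<open>n\<close>. In both families each level is inhabited, a
  surjection \<open>G \<rightarrow> H\<close> factors through any surjection \<open>G' \<rightarrow> H\<close> from a group \<open>G'\<close> of no larger
  level, and any two surjections out of the same group factor through one whose target has level at
  most the sum of the two given levels. The last fact makes \<open>X \<otimes> e_T\<close> and the kernels used below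
  finitely generated.

  Let \<open>x \<noteq> 0\<close> in \<open>X(T)\<close>. By lifting, whether \<open>\<gamma>\<^sup>* x = 0\<close> depends only on the level of the source
  of \<open>\<gamma>\<close>, and the levels with \<open>\<gamma>\<^sup>* x \<noteq> 0\<close>, on which \<open>x\<close> is alive, form an initial segment
  above that of \<open>T\<close>. On it the elements \<open>\<gamma>\<^sup>* x \<otimes> \<gamma>\<close> of \<open>X \<otimes> e_T\<close> are independent, so a Serre
  ideal that contains \<open>X\<close> contains a truncation of \<open>e_T\<close> and, through the augmentation, the functor
  with value \<open>k\<close> on an interval of levels that starts at the level of \<open>T\<close> and is infinite if \<open>x\<close>
  never dies.

  Hence the primes are \<open>P\<^sub>n = {X. X vanishes at level n}\<close> and \<open>P\<^sub>\<infinity> = {X. X has finite support}\<close>: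
  a prime omitting the functor \<open>k\<close> concentrated at level \<open>n\<close> is \<open>P\<^sub>n\<close>, and a prime containing all
  of these is \<open>P\<^sub>\<infinity>\<close>. Supports of finitely generated functors are finite or cofinite, which
  makes \<open>P\<^sub>\<infinity>\<close> the point at infinity.
\<close>

section \<open>Modules\<close>

text \<open>Objects are functors whose values live on the one type
  \<open>nat \<Rightarrow> 'k\<close>, and the ideal conditions test only such objects. So every
  auxiliary construction has to return to that type: quotients are carried by coset representatives,
  Hom sets are numbered, and families of sequences are packed into one sequence. No tensor product
  of two arbitrary functors is built. Each one that is constructed is zero or has a factor with
  explicit bases, and is then objectwise a sum of copies of the other factor. What is said about an
  arbitrary model of X \<otimes> Y rests on the universal property alone. Finite generation is the
  second constraint, since an exact sequence counts only if all three terms are finitely generated.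
  Quotients inherit it, so an ideal passes to subobjects at no cost, while passing to a quotient
  needs generators of the kernel. These are found for the augmentation, whose kernel is spanned by
  differences of two morphisms. Structure maps raise the level. Hence upper segments of levels give
  subobjects and lower segments quotients; this is how a single level is split off an interval and
  how the tensor unit is assembled at infinity.\<close>

abbreviation lin :: "'k ring \<Rightarrow> ('k, 'v) module \<Rightarrow> ('k, 'w) module \<Rightarrow> ('v \<Rightarrow> 'w) set" where
  "lin \<equiv> LinearCombinations.module_hom"

lemma linI:
  assumes "\<And>x. x \<in> carrier M \<Longrightarrow> f x \<in> carrier N"
    and "\<And>x y. x \<in> carrier M \<Longrightarrow> y \<in> carrier M \<Longrightarrow> f (x \<oplus>\<^bsub>M\<^esub> y) = f x \<oplus>\<^bsub>N\<^esub> f y"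
    and "\<And>a x. a \<in> carrier K \<Longrightarrow> x \<in> carrier M \<Longrightarrow> f (a \<odot>\<^bsub>M\<^esub> x) = a \<odot>\<^bsub>N\<^esub> f x"
  shows "f \<in> lin K M N"
  using assms by (auto simp: LinearCombinations.module_hom_def)

lemma lin_closed: "f \<in> lin K M N \<Longrightarrow> x \<in> carrier M \<Longrightarrow> f x \<in> carrier N"
  by (auto simp: LinearCombinations.module_hom_def)

lemma lin_add:
  "f \<in> lin K M N \<Longrightarrow> x \<in> carrier M \<Longrightarrow> y \<in> carrier M \<Longrightarrow> f (x \<oplus>\<^bsub>M\<^esub> y) = f x \<oplus>\<^bsub>N\<^esub> f y"
  by (auto simp: LinearCombinations.module_hom_def)

lemma lin_smult:
  "f \<in> lin K M N \<Longrightarrow> a \<in> carrier K \<Longrightarrow> x \<in> carrier M \<Longrightarrow> f (a \<odot>\<^bsub>M\<^esub> x) = a \<odot>\<^bsub>N\<^esub> f x"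
  by (auto simp: LinearCombinations.module_hom_def)

lemma lin_zero:
  assumes "Module.module K M" "Module.module K N" "f \<in> lin K M N"
  shows "f \<zero>\<^bsub>M\<^esub> = \<zero>\<^bsub>N\<^esub>"
proof -
  interpret mod_hom K M N f
    using assms by (simp add: mod_hom_def mod_hom_axioms_def)
  show ?thesis by (rule f0_is_0)
qed

lemma lin_diff:
  assumes "Module.module K M" "Module.module K N" "f \<in> lin K M N"
    and "x \<in> carrier M" "y \<in> carrier M"
  shows "f (x \<ominus>\<^bsub>M\<^esub> y) = f x \<ominus>\<^bsub>N\<^esub> f y"
proof -
  interpret mod_hom K M N f
    using assms by (simp add: mod_hom_def mod_hom_axioms_def)
  show ?thesis using assms by (intro f_minus)
qed

lemma lin_comp: "f \<in> lin K M N \<Longrightarrow> g \<in> lin K N L \<Longrightarrow> (\<lambda>x. g (f x)) \<in> lin K M L"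
  by (rule linI) (simp_all add: lin_closed lin_add lin_smult)

lemma lin_finsum:
  assumes "Module.module K M" "Module.module K N" "f \<in> lin K M N"
    and "finite A" "\<And>i. i \<in> A \<Longrightarrow> g i \<in> carrier M"
  shows "f (finsum M g A) = finsum N (\<lambda>i. f (g i)) A"
proof -
  interpret M: Module.module K M by fact
  interpret N: Module.module K N by fact
  show ?thesis
    using assms(4,5)
    by (induction A rule: finite_induct)
      (auto simp: lin_zero[OF assms(1-3)] lin_add[OF assms(3)] lin_closed[OF assms(3)] Pi_iff
        M.finsum_closed)
qed

text \<open>The structure of a module descends along a map compatible with all operations.\<close>

lemma module_image:
  assumes M: "Module.module K M"
    and car: "carrier Q = f ` carrier M"
    and add: "\<And>x y. x \<in> carrier M \<Longrightarrow> y \<in> carrier M \<Longrightarrow> f (x \<oplus>\<^bsub>M\<^esub> y) = f x \<oplus>\<^bsub>Q\<^esub> f y"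
    and smult: "\<And>a x. a \<in> carrier K \<Longrightarrow> x \<in> carrier M \<Longrightarrow> f (a \<odot>\<^bsub>M\<^esub> x) = a \<odot>\<^bsub>Q\<^esub> f x"
    and zero: "f \<zero>\<^bsub>M\<^esub> = \<zero>\<^bsub>Q\<^esub>"
  shows "Module.module K Q"
proof -
  interpret M: Module.module K M by fact
  note s = add[symmetric] smult[symmetric] zero[symmetric]
  show ?thesis
  proof (rule moduleI)
    show "cring K" by (rule M.is_cring)
    show "abelian_group Q"
    proof (rule abelian_groupI)
      fix x assume "x \<in> carrier Q"
      then obtain u where u: "u \<in> carrier M" "x = f u" by (auto simp: car)
      then show "\<exists>y\<in>carrier Q. y \<oplus>\<^bsub>Q\<^esub> x = \<zero>\<^bsub>Q\<^esub>"
        by (intro bexI[of _ "f (\<ominus>\<^bsub>M\<^esub> u)"]) (auto simp: car s M.l_neg)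
    qed (auto simp: car s M.a_ac)
  qed (auto simp: car s M.smult_l_distr M.smult_r_distr M.smult_assoc1)
qed

definition scalar_module :: "'k ring \<Rightarrow> ('k, 'k) module" where
  "scalar_module K = \<lparr>carrier = carrier K, mult = (\<otimes>\<^bsub>K\<^esub>), one = \<one>\<^bsub>K\<^esub>, zero = \<zero>\<^bsub>K\<^esub>,
     add = (\<oplus>\<^bsub>K\<^esub>), smult = (\<otimes>\<^bsub>K\<^esub>)\<rparr>"

lemma scalar_module_simps [simp]:
  "carrier (scalar_module K) = carrier K" "\<zero>\<^bsub>scalar_module K\<^esub> = \<zero>\<^bsub>K\<^esub>"
  "x \<oplus>\<^bsub>scalar_module K\<^esub> y = x \<oplus>\<^bsub>K\<^esub> y" "a \<odot>\<^bsub>scalar_module K\<^esub> x = a \<otimes>\<^bsub>K\<^esub> x"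
  by (auto simp: scalar_module_def)

lemma module_scalar_module:
  assumes "cring K"
  shows "Module.module K (scalar_module K)"
proof -
  interpret cring K by fact
  show ?thesis
  proof (rule moduleI)
    show "abelian_group (scalar_module K)"
      by (rule abelian_groupI) (auto simp: a_ac intro!: bexI[of _ "\<ominus>\<^bsub>K\<^esub> x" for x] l_neg)
  qed (auto simp: assms l_distr r_distr m_assoc)
qed

text \<open>A common form for \<open>module_sum\<close> and for function spaces. The fillers
  \<open>mult\<close> and \<open>one\<close> copy theirs, so that both agree with it as records and
  not merely up to isomorphism.\<close>

definition prod_module :: "'i set \<Rightarrow> ('i \<Rightarrow> ('k, 'v) module) \<Rightarrow> ('k, 'i \<Rightarrow> 'v) module" where
  "prod_module I M = \<lparr>
     carrier = (\<Pi>\<^sub>E i\<in>I. carrier (M i)),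
     mult = (\<lambda>_ _. \<lambda>i\<in>I. \<zero>\<^bsub>M i\<^esub>), one = (\<lambda>i\<in>I. \<zero>\<^bsub>M i\<^esub>), zero = (\<lambda>i\<in>I. \<zero>\<^bsub>M i\<^esub>),
     add = (\<lambda>v w. \<lambda>i\<in>I. v i \<oplus>\<^bsub>M i\<^esub> w i),
     smult = (\<lambda>a v. \<lambda>i\<in>I. a \<odot>\<^bsub>M i\<^esub> v i)\<rparr>"

lemma prod_module_simps [simp]:
  "carrier (prod_module I M) = (\<Pi>\<^sub>E i\<in>I. carrier (M i))"
  "\<zero>\<^bsub>prod_module I M\<^esub> = (\<lambda>i\<in>I. \<zero>\<^bsub>M i\<^esub>)"
  "v \<oplus>\<^bsub>prod_module I M\<^esub> w = (\<lambda>i\<in>I. v i \<oplus>\<^bsub>M i\<^esub> w i)"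
  "a \<odot>\<^bsub>prod_module I M\<^esub> v = (\<lambda>i\<in>I. a \<odot>\<^bsub>M i\<^esub> v i)"
  by (auto simp: prod_module_def)

lemma module_sum_eq: "module_sum n M = prod_module {..<n} M"
  by (simp add: module_sum_def prod_module_def)

lemma func_space_eq:
  assumes "ring K"
  shows "ring.func_space K I = prod_module I (\<lambda>_. scalar_module K)"
  by (simp add: ring.func_space_def[OF assms] prod_module_def scalar_module_def)

lemma module_prod_module:
  assumes K: "cring K" and M: "\<And>i. i \<in> I \<Longrightarrow> Module.module K (M i)"
  shows "Module.module K (prod_module I M)"
proof -
  have ag: "abelian_group (M i)" if "i \<in> I" for i
    using M[OF that] by (simp add: Module.module_def)
  have am: "abelian_monoid (M i)" if "i \<in> I" for i
    using ag[OF that] by (simp add: abelian_group_def)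
  show ?thesis
  proof (rule moduleI)
    show "abelian_group (prod_module I M)"
    proof (rule abelian_groupI)
      fix x assume x: "x \<in> carrier (prod_module I M)"
      have "(\<lambda>i\<in>I. \<ominus>\<^bsub>M i\<^esub> x i) \<oplus>\<^bsub>prod_module I M\<^esub> x = \<zero>\<^bsub>prod_module I M\<^esub>"
        using x by (auto intro!: restrict_ext simp: PiE_iff abelian_group.l_neg[OF ag])
      then show "\<exists>y\<in>carrier (prod_module I M). y \<oplus>\<^bsub>prod_module I M\<^esub> x = \<zero>\<^bsub>prod_module I M\<^esub>"
        using x by (intro bexI[of _ "\<lambda>i\<in>I. \<ominus>\<^bsub>M i\<^esub> x i"]) (auto simp: PiE_iff abelian_group.a_inv_closed[OF ag])
    next
      fix x y z assume "x \<in> carrier (prod_module I M)" "y \<in> carrier (prod_module I M)"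
        "z \<in> carrier (prod_module I M)"
      then show "x \<oplus>\<^bsub>prod_module I M\<^esub> y \<oplus>\<^bsub>prod_module I M\<^esub> z
        = x \<oplus>\<^bsub>prod_module I M\<^esub> (y \<oplus>\<^bsub>prod_module I M\<^esub> z)"
        by (auto intro!: restrict_ext simp: PiE_iff abelian_monoid.a_assoc[OF am])
    next
      fix x y assume "x \<in> carrier (prod_module I M)" "y \<in> carrier (prod_module I M)"
      then show "x \<oplus>\<^bsub>prod_module I M\<^esub> y = y \<oplus>\<^bsub>prod_module I M\<^esub> x"
        by (auto intro!: restrict_ext simp: PiE_iff abelian_monoid.a_comm[OF am])
    qed (auto intro!: restrict_ext ext simp: PiE_iff abelian_monoid.a_closed[OF am]
        abelian_monoid.zero_closed[OF am] abelian_monoid.l_zero[OF am] extensional_def)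
  qed (auto intro!: restrict_ext ext simp: K PiE_iff module.smult_closed[OF M]
      module.smult_l_distr[OF M] module.smult_r_distr[OF M] module.smult_assoc1[OF M]
      module.smult_one[OF M] abelian_monoid.a_closed[OF am] extensional_def)
qed

definition single :: "'i set \<Rightarrow> ('i \<Rightarrow> ('k, 'v) module) \<Rightarrow> 'i \<Rightarrow> 'v \<Rightarrow> 'i \<Rightarrow> 'v" where
  "single I M i m = (\<lambda>j\<in>I. if j = i then m else \<zero>\<^bsub>M j\<^esub>)"

text \<open>An index outside I gives the zero family, so closure holds for every index.\<close>

lemma single_closed:
  assumes "\<And>i. i \<in> I \<Longrightarrow> Module.module K (M i)" "m \<in> carrier (M i)"
  shows "single I M i m \<in> carrier (prod_module I M)"
proof -
  have "\<zero>\<^bsub>M j\<^esub> \<in> carrier (M j)" if "j \<in> I" for j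
    using assms(1)[OF that] by (simp add: Module.module_def abelian_group_def abelian_monoid.zero_closed)
  then show ?thesis using assms(2) by (auto simp: single_def PiE_iff)
qed

text \<open>A finite product is also a direct sum: adding one coordinate at a time reduces an
  additive property to families with a single nonzero entry. The spanning arguments below go through
  this rule.\<close>

lemma prod_module_induct:
  assumes "finite I" and M: "\<And>i. i \<in> I \<Longrightarrow> Module.module K (M i)"
    and z: "z \<in> carrier (prod_module I M)"
    and zero: "P (\<zero>\<^bsub>prod_module I M\<^esub>)"
    and add: "\<And>x y. x \<in> carrier (prod_module I M) \<Longrightarrow> y \<in> carrier (prod_module I M) \<Longrightarrow> P x \<Longrightarrow> P y
                \<Longrightarrow> P (x \<oplus>\<^bsub>prod_module I M\<^esub> y)"
    and single: "\<And>i m. i \<in> I \<Longrightarrow> m \<in> carrier (M i) \<Longrightarrow> P (single I M i m)"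
  shows "P z"
proof -
  have am: "abelian_monoid (M i)" if "i \<in> I" for i
    using M[OF that] by (simp add: Module.module_def abelian_group_def)
  \<comment> \<open>\<open>cut J\<close> keeps only the coordinates in J; the induction is on
    J.\<close>
  define cut where "cut J = (\<lambda>j\<in>I. if j \<in> J then z j else \<zero>\<^bsub>M j\<^esub>)" for J
  have cut_closed: "cut J \<in> carrier (prod_module I M)" for J
    using z by (auto simp: cut_def PiE_iff abelian_monoid.zero_closed[OF am])
  have "P (cut J)" if "finite J" "J \<subseteq> I" for J
    using that
  proof (induction J rule: finite_induct)
    case empty
    then show ?case using zero by (simp add: cut_def restrict_def)
  next
    case (insert i J)
    have zi: "z i \<in> carrier (M i)" using z insert by auto
    have "cut (insert i J) = single I M i (z i) \<oplus>\<^bsub>prod_module I M\<^esub> cut J"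
      using insert z by (auto intro!: restrict_ext simp: cut_def single_def PiE_iff
          abelian_monoid.zero_closed[OF am] abelian_monoid.l_zero[OF am] abelian_monoid.r_zero[OF am])
    moreover have "P (single I M i (z i) \<oplus>\<^bsub>prod_module I M\<^esub> cut J)"
      using insert zi by (intro add single_closed[OF M] cut_closed single) auto
    ultimately show ?case by (simp only:)
  qed
  moreover have "cut I = z"
    using z by (auto simp: cut_def PiE_iff extensional_def)
  ultimately show ?thesis using \<open>finite I\<close> by auto
qed

lemma (in abelian_group) neg_zero: "\<ominus> \<zero> = \<zero>"
  by (metis a_inv_closed l_neg r_zero zero_closed)

lemma (in abelian_group) diff_add_self:
  "w \<in> carrier G \<Longrightarrow> y \<in> carrier G \<Longrightarrow> y \<ominus> (w \<oplus> y) = \<ominus> w"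
  by (simp add: a_minus_def minus_add a_comm[of "\<ominus> w"] r_neg2)

lemma (in abelian_group) diff_diff:
  assumes "y \<in> carrier G" "u \<in> carrier G" "v \<in> carrier G"
  shows "(y \<ominus> u) \<ominus> (y \<ominus> v) = v \<ominus> u"
proof -
  have "(y \<ominus> u) \<ominus> (y \<ominus> v) = (y \<oplus> \<ominus> u) \<oplus> (\<ominus> y \<oplus> v)"
    using assms by (simp add: a_minus_def minus_add)
  also have "\<dots> = v \<oplus> (\<ominus> u \<oplus> (y \<oplus> \<ominus> y))"
    using assms by (simp only: a_ac a_inv_closed add.m_closed)
  finally show ?thesis using assms by (simp add: a_minus_def r_neg)
qed

lemma (in abelian_group) add_diff_add:
  assumes "y \<in> carrier G" "u \<in> carrier G" "v \<in> carrier G" "z \<in> carrier G"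
  shows "(y \<oplus> z) \<ominus> (u \<oplus> v) = (y \<ominus> u) \<oplus> (z \<ominus> v)"
  using assms by (simp add: a_minus_def minus_add a_ac)

section \<open>Subspaces and linear functionals\<close>

abbreviation subspace :: "'k ring \<Rightarrow> 'v set \<Rightarrow> ('k, 'v) module \<Rightarrow> bool" where
  "subspace \<equiv> LinearCombinations.submodule"

lemma subspace_minus:
  assumes "subspace K N M" "x \<in> N" "y \<in> N"
  shows "\<ominus>\<^bsub>M\<^esub> x \<in> N" and "x \<ominus>\<^bsub>M\<^esub> y \<in> N"
proof -
  interpret N: LinearCombinations.submodule K N M by fact
  interpret M: Module.module K M by (rule N.module)
  have neg: "\<ominus>\<^bsub>M\<^esub> v \<in> N" if "v \<in> N" for v
  proof -
    have "(\<ominus>\<^bsub>K\<^esub> \<one>\<^bsub>K\<^esub>) \<odot>\<^bsub>M\<^esub> v \<in> N" using that by (intro N.smult_closed) auto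
    then show ?thesis using that N.subset by (metis M.smult_minus_1 subsetD)
  qed
  then show "\<ominus>\<^bsub>M\<^esub> x \<in> N" "x \<ominus>\<^bsub>M\<^esub> y \<in> N"
    using assms by (auto simp: a_minus_def)
qed

text \<open>By Zorn's lemma there is a subspace H maximal among those that avoid x. It is a
  complement of the line through x, and the functional reads off the coefficient of x modulo H. This
  is what shows that a tensor product of nonzero spaces is nonzero.\<close>

lemma subspace_functional:
  assumes K: "Ring.field K" and M: "Module.module K M"
    and x: "x \<in> carrier M" "x \<noteq> \<zero>\<^bsub>M\<^esub>"
  obtains f where "f \<in> lin K M (scalar_module K)" "f x = \<one>\<^bsub>K\<^esub>"
proof -
  interpret K: Ring.field K by fact
  interpret M: Module.module K M by fact
  define A where "A = {H. subspace K H M \<and> x \<notin> H}"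
  have "\<exists>H\<in>A. \<forall>H'\<in>A. H \<subseteq> H' \<longrightarrow> H' = H"
  proof (rule subset_Zorn_nonempty)
    have "subspace K {\<zero>\<^bsub>M\<^esub>} M"
      by (rule submodule.intro[OF M]) auto
    then have "{\<zero>\<^bsub>M\<^esub>} \<in> A" using x(2) by (simp add: A_def)
    then show "A \<noteq> {}" by blast
  next
    fix C assume C: "C \<noteq> {}" "subset.chain A C"
    then have CA: "C \<subseteq> A" by (simp add: subset.chain_def)
    have sub: "subspace K H M" if "H \<in> C" for H
      using CA that by (auto simp: A_def)
    have "subspace K (\<Union>C) M"
    proof (rule submodule.intro[OF M])
      show "\<Union>C \<subseteq> carrier M" by (rule Union_least) (rule submodule.subset[OF sub])
      obtain H where "H \<in> C" using C by auto
      then show "\<zero>\<^bsub>M\<^esub> \<in> \<Union>C" by (intro UnionI[of H] submodule.zero_closed[OF sub])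
      show "c \<odot>\<^bsub>M\<^esub> v \<in> \<Union>C" if c: "c \<in> carrier K" and v: "v \<in> \<Union>C" for c v
      proof -
        obtain H where "H \<in> C" "v \<in> H" using v by auto
        then show ?thesis using c by (intro UnionI[of H] submodule.smult_closed[OF sub])
      qed
      fix v w assume "v \<in> \<Union>C" "w \<in> \<Union>C"
      then obtain H1 H2 where H: "H1 \<in> C" "H2 \<in> C" "v \<in> H1" "w \<in> H2" by auto
      then have "H1 \<subseteq> H2 \<or> H2 \<subseteq> H1" using C(2) unfolding subset.chain_def by blast
      then obtain H where "H \<in> C" "v \<in> H" "w \<in> H" using H by auto
      then show "v \<oplus>\<^bsub>M\<^esub> w \<in> \<Union>C"
        by (intro UnionI[of H] submodule.m_closed[OF sub])
    qed
    moreover have "x \<notin> \<Union>C" using CA by (auto simp: A_def)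
    ultimately show "\<Union>C \<in> A" by (simp add: A_def)
  qed
  then obtain H where "H \<in> A" and max: "\<And>H'. H' \<in> A \<Longrightarrow> H \<subseteq> H' \<Longrightarrow> H' = H" by blast
  then have H: "subspace K H M" and xH: "x \<notin> H" by (auto simp: A_def)
  interpret H: LinearCombinations.submodule K H M by (rule H)
  have Hc: "h \<in> carrier M" if "h \<in> H" for h using H.subset that by auto
  have ex: "\<exists>a\<in>carrier K. y \<ominus>\<^bsub>M\<^esub> a \<odot>\<^bsub>M\<^esub> x \<in> H" if y: "y \<in> carrier M" for y
  proof (cases "y \<in> H")
    case True
    then show ?thesis using x y by (intro bexI[of _ "\<zero>\<^bsub>K\<^esub>"]) (auto simp: a_minus_def M.neg_zero)
  next
    case False
    \<comment> \<open>Maximality of H puts x into H + Ky. The coefficient of y there is nonzero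
      because x is not in H, so y can be solved for modulo H.\<close>
    define H' where "H' = {h \<oplus>\<^bsub>M\<^esub> b \<odot>\<^bsub>M\<^esub> y | h b. h \<in> H \<and> b \<in> carrier K}"
    have "subspace K H' M"
    proof (rule submodule.intro[OF M])
      show "H' \<subseteq> carrier M" using Hc y by (auto simp: H'_def)
      show "\<zero>\<^bsub>M\<^esub> \<in> H'" unfolding H'_def
        using y by (intro CollectI exI[of _ "\<zero>\<^bsub>M\<^esub>"] exI[of _ "\<zero>\<^bsub>K\<^esub>"]) auto
      show "c \<odot>\<^bsub>M\<^esub> v \<in> H'" if c: "c \<in> carrier K" and v: "v \<in> H'" for c v
      proof -
        obtain h b where hb: "h \<in> H" "b \<in> carrier K" "v = h \<oplus>\<^bsub>M\<^esub> b \<odot>\<^bsub>M\<^esub> y"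
          using v by (auto simp: H'_def)
        then have "c \<odot>\<^bsub>M\<^esub> v = c \<odot>\<^bsub>M\<^esub> h \<oplus>\<^bsub>M\<^esub> (c \<otimes>\<^bsub>K\<^esub> b) \<odot>\<^bsub>M\<^esub> y"
          using c y Hc by (simp add: M.smult_r_distr M.smult_assoc1)
        then show ?thesis unfolding H'_def using hb c by blast
      qed
      fix v w assume "v \<in> H'" "w \<in> H'"
      then obtain h b h' b' where hb: "h \<in> H" "b \<in> carrier K" "v = h \<oplus>\<^bsub>M\<^esub> b \<odot>\<^bsub>M\<^esub> y"
        "h' \<in> H" "b' \<in> carrier K" "w = h' \<oplus>\<^bsub>M\<^esub> b' \<odot>\<^bsub>M\<^esub> y"
        by (auto simp: H'_def)
      then have "v \<oplus>\<^bsub>M\<^esub> w = (h \<oplus>\<^bsub>M\<^esub> h') \<oplus>\<^bsub>M\<^esub> (b \<oplus>\<^bsub>K\<^esub> b') \<odot>\<^bsub>M\<^esub> y"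
        using y Hc by (simp add: M.smult_l_distr M.a_ac)
      then show "v \<oplus>\<^bsub>M\<^esub> w \<in> H'" unfolding H'_def using hb by blast
    qed
    moreover have "y \<in> H'" unfolding H'_def
      using y by (intro CollectI exI[of _ "\<zero>\<^bsub>M\<^esub>"] exI[of _ "\<one>\<^bsub>K\<^esub>"]) auto
    moreover have "H \<subseteq> H'"
    proof
      fix h assume "h \<in> H"
      then show "h \<in> H'" unfolding H'_def
        using y Hc by (intro CollectI exI[of _ h] exI[of _ "\<zero>\<^bsub>K\<^esub>"]) auto
    qed
    ultimately have "x \<in> H'" using max[of H'] False by (auto simp: A_def)
    then obtain h b where hb: "h \<in> H" "b \<in> carrier K" "x = h \<oplus>\<^bsub>M\<^esub> b \<odot>\<^bsub>M\<^esub> y"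
      by (auto simp: H'_def)
    have b0: "b \<noteq> \<zero>\<^bsub>K\<^esub>" using hb xH y Hc by auto
    then have bu: "inv\<^bsub>K\<^esub> b \<in> carrier K" "inv\<^bsub>K\<^esub> b \<otimes>\<^bsub>K\<^esub> b = \<one>\<^bsub>K\<^esub>"
      using hb by (auto simp: K.field_Units)
    have "inv\<^bsub>K\<^esub> b \<odot>\<^bsub>M\<^esub> x = inv\<^bsub>K\<^esub> b \<odot>\<^bsub>M\<^esub> h \<oplus>\<^bsub>M\<^esub> (inv\<^bsub>K\<^esub> b \<otimes>\<^bsub>K\<^esub> b) \<odot>\<^bsub>M\<^esub> y"
      unfolding hb(3) using hb(1,2) bu(1) y Hc by (simp add: M.smult_r_distr M.smult_assoc1)
    then have "y \<ominus>\<^bsub>M\<^esub> inv\<^bsub>K\<^esub> b \<odot>\<^bsub>M\<^esub> x = \<ominus>\<^bsub>M\<^esub> (inv\<^bsub>K\<^esub> b \<odot>\<^bsub>M\<^esub> h)"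
      using hb(1) bu y Hc by (simp add: M.diff_add_self)
    then show ?thesis using bu hb subspace_minus[OF H] by (intro bexI[of _ "inv\<^bsub>K\<^esub> b"]) auto
  qed
  \<comment> \<open>Two coefficients would put (a' - a) x into H, and a nonzero scalar is
    invertible.\<close>
  have uniq: "a = a'" if "a \<in> carrier K" "a' \<in> carrier K" "y \<in> carrier M"
    "y \<ominus>\<^bsub>M\<^esub> a \<odot>\<^bsub>M\<^esub> x \<in> H" "y \<ominus>\<^bsub>M\<^esub> a' \<odot>\<^bsub>M\<^esub> x \<in> H" for a a' y
  proof (rule ccontr)
    assume ne: "a \<noteq> a'"
    define d where "d = a' \<ominus>\<^bsub>K\<^esub> a"
    have d: "d \<in> carrier K" "d \<noteq> \<zero>\<^bsub>K\<^esub>" using ne that by (auto simp: d_def)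
    have "(y \<ominus>\<^bsub>M\<^esub> a \<odot>\<^bsub>M\<^esub> x) \<ominus>\<^bsub>M\<^esub> (y \<ominus>\<^bsub>M\<^esub> a' \<odot>\<^bsub>M\<^esub> x) = d \<odot>\<^bsub>M\<^esub> x"
      using that(1-3) x(1) by (subst M.diff_diff)
        (simp_all add: d_def a_minus_def M.smult_l_distr M.smult_l_minus)
    then have "d \<odot>\<^bsub>M\<^esub> x \<in> H" using subspace_minus(2)[OF H that(4,5)] by simp
    then have "inv\<^bsub>K\<^esub> d \<odot>\<^bsub>M\<^esub> (d \<odot>\<^bsub>M\<^esub> x) \<in> H" using d by (auto simp: K.field_Units)
    moreover have "inv\<^bsub>K\<^esub> d \<odot>\<^bsub>M\<^esub> (d \<odot>\<^bsub>M\<^esub> x) = x"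
      using d x by (simp add: K.field_Units flip: M.smult_assoc1)
    ultimately show False using xH by simp
  qed
  define f where "f y = (THE a. a \<in> carrier K \<and> y \<ominus>\<^bsub>M\<^esub> a \<odot>\<^bsub>M\<^esub> x \<in> H)" for y
  have f: "f y \<in> carrier K" "y \<ominus>\<^bsub>M\<^esub> f y \<odot>\<^bsub>M\<^esub> x \<in> H" if "y \<in> carrier M" for y
  proof -
    have "\<exists>!a. a \<in> carrier K \<and> y \<ominus>\<^bsub>M\<^esub> a \<odot>\<^bsub>M\<^esub> x \<in> H"
      using ex[OF that] uniq[OF _ _ that] by blast
    from theI'[OF this] show "f y \<in> carrier K" "y \<ominus>\<^bsub>M\<^esub> f y \<odot>\<^bsub>M\<^esub> x \<in> H" by (auto simp: f_def)
  qed
  have feq: "f y = a" if "a \<in> carrier K" "y \<in> carrier M" "y \<ominus>\<^bsub>M\<^esub> a \<odot>\<^bsub>M\<^esub> x \<in> H" for y a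
    using uniq[OF _ that(1,2) _ that(3)] f[OF that(2)] by blast
  show thesis
  proof
    show "f \<in> lin K M (scalar_module K)"
    proof (rule linI)
      fix y z assume yz: "y \<in> carrier M" "z \<in> carrier M"
      have "(y \<oplus>\<^bsub>M\<^esub> z) \<ominus>\<^bsub>M\<^esub> (f y \<oplus>\<^bsub>K\<^esub> f z) \<odot>\<^bsub>M\<^esub> x
            = (y \<ominus>\<^bsub>M\<^esub> f y \<odot>\<^bsub>M\<^esub> x) \<oplus>\<^bsub>M\<^esub> (z \<ominus>\<^bsub>M\<^esub> f z \<odot>\<^bsub>M\<^esub> x)"
        using yz f(1) x(1) by (simp add: M.add_diff_add M.smult_l_distr)
      then show "f (y \<oplus>\<^bsub>M\<^esub> z) = f y \<oplus>\<^bsub>scalar_module K\<^esub> f z"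
        using yz f by (intro feq) auto
    next
      fix a y assume ay: "a \<in> carrier K" "y \<in> carrier M"
      have "a \<odot>\<^bsub>M\<^esub> y \<ominus>\<^bsub>M\<^esub> (a \<otimes>\<^bsub>K\<^esub> f y) \<odot>\<^bsub>M\<^esub> x = a \<odot>\<^bsub>M\<^esub> (y \<ominus>\<^bsub>M\<^esub> f y \<odot>\<^bsub>M\<^esub> x)"
        using ay f x by (simp add: a_minus_def M.smult_r_distr M.smult_assoc1 M.smult_r_minus)
      then show "f (a \<odot>\<^bsub>M\<^esub> y) = a \<odot>\<^bsub>scalar_module K\<^esub> f y"
        using ay f by (intro feq) auto
    qed (use f in auto)
    show "f x = \<one>\<^bsub>K\<^esub>"
      using x by (intro feq) (auto simp: a_minus_def M.r_neg)
  qed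
qed

section \<open>Functors\<close>

lemma is_functorI:
  assumes "\<And>G. G \<in> U \<Longrightarrow> Module.module K (obj X G)"
    and "\<And>G H \<alpha>. G \<in> U \<Longrightarrow> H \<in> U \<Longrightarrow> \<alpha> \<in> Hom G H \<Longrightarrow> arr X G H \<alpha> \<in> lin K (obj X H) (obj X G)"
    and "\<And>G v. G \<in> U \<Longrightarrow> v \<in> carrier (obj X G) \<Longrightarrow> arr X G G (id_class G) v = v"
    and "\<And>G H L \<alpha> \<beta> v. G \<in> U \<Longrightarrow> H \<in> U \<Longrightarrow> L \<in> U \<Longrightarrow> \<alpha> \<in> Hom G H \<Longrightarrow> \<beta> \<in> Hom H L \<Longrightarrow>
      v \<in> carrier (obj X L) \<Longrightarrow> arr X G L (comp_class G \<beta> \<alpha>) v = arr X G H \<alpha> (arr X H L \<beta> v)"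
  shows "is_functor K U X"
  using assms by (simp add: is_functor_def)

lemma functor_module: "is_functor K U X \<Longrightarrow> G \<in> U \<Longrightarrow> Module.module K (obj X G)"
  by (simp add: is_functor_def)

lemma functor_arr:
  "is_functor K U X \<Longrightarrow> G \<in> U \<Longrightarrow> H \<in> U \<Longrightarrow> \<alpha> \<in> Hom G H \<Longrightarrow> arr X G H \<alpha> \<in> lin K (obj X H) (obj X G)"
  by (simp add: is_functor_def)

lemma functor_arr_closed:
  "is_functor K U X \<Longrightarrow> G \<in> U \<Longrightarrow> H \<in> U \<Longrightarrow> \<alpha> \<in> Hom G H \<Longrightarrow> v \<in> carrier (obj X H) \<Longrightarrow>
     arr X G H \<alpha> v \<in> carrier (obj X G)"
  by (rule lin_closed[OF functor_arr])

lemma functor_id: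
  "is_functor K U X \<Longrightarrow> G \<in> U \<Longrightarrow> v \<in> carrier (obj X G) \<Longrightarrow> arr X G G (id_class G) v = v"
  by (simp add: is_functor_def)

lemma functor_comp:
  "is_functor K U X \<Longrightarrow> G \<in> U \<Longrightarrow> H \<in> U \<Longrightarrow> L \<in> U \<Longrightarrow> \<alpha> \<in> Hom G H \<Longrightarrow> \<beta> \<in> Hom H L \<Longrightarrow>
     v \<in> carrier (obj X L) \<Longrightarrow> arr X G L (comp_class G \<beta> \<alpha>) v = arr X G H \<alpha> (arr X H L \<beta> v)"
  by (simp add: is_functor_def)

lemma functor_arr_zero:
  "is_functor K U X \<Longrightarrow> G \<in> U \<Longrightarrow> H \<in> U \<Longrightarrow> \<alpha> \<in> Hom G H \<Longrightarrow> arr X G H \<alpha> \<zero>\<^bsub>obj X H\<^esub> = \<zero>\<^bsub>obj X G\<^esub>"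
  by (rule lin_zero[OF _ _ functor_arr]) (auto intro: functor_module)

lemma functor_zero_closed: "is_functor K U X \<Longrightarrow> G \<in> U \<Longrightarrow> \<zero>\<^bsub>obj X G\<^esub> \<in> carrier (obj X G)"
  using functor_module[of K U X G]
  by (simp add: Module.module_def abelian_group_def abelian_monoid.zero_closed)

lemma nat_trans_lin: "nat_trans K U X Y \<phi> \<Longrightarrow> G \<in> U \<Longrightarrow> \<phi> G \<in> lin K (obj X G) (obj Y G)"
  by (simp add: nat_trans_def)

lemma nat_trans_natural:
  "nat_trans K U X Y \<phi> \<Longrightarrow> G \<in> U \<Longrightarrow> H \<in> U \<Longrightarrow> \<alpha> \<in> Hom G H \<Longrightarrow> v \<in> carrier (obj X H) \<Longrightarrow>
     \<phi> G (arr X G H \<alpha> v) = arr Y G H \<alpha> (\<phi> H v)"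
  by (simp add: nat_trans_def)

lemma nat_trans_comp:
  assumes "nat_trans K U X Y \<phi>" "nat_trans K U Y Z \<psi>"
  shows "nat_trans K U X Z (\<lambda>G v. \<psi> G (\<phi> G v))"
  unfolding nat_trans_def
proof (intro conjI ballI)
  show "(\<lambda>v. \<psi> G (\<phi> G v)) \<in> lin K (obj X G) (obj Z G)" if "G \<in> U" for G
    by (rule lin_comp[OF nat_trans_lin[OF assms(1) that] nat_trans_lin[OF assms(2) that]])
  show "\<psi> G (\<phi> G (arr X G H \<alpha> v)) = arr Z G H \<alpha> (\<psi> H (\<phi> H v))"
    if "G \<in> U" "H \<in> U" "\<alpha> \<in> Hom G H" "v \<in> carrier (obj X H)" for G H \<alpha> v
    unfolding nat_trans_natural[OF assms(1) that]
    by (rule nat_trans_natural[OF assms(2) that(1-3) lin_closed[OF nat_trans_lin[OF assms(1) that(2)] that(4)]])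
qed

lemma epimorphism_comp:
  assumes "epimorphism K U X Y \<phi>" "epimorphism K U Y Z \<psi>"
  shows "epimorphism K U X Z (\<lambda>G v. \<psi> G (\<phi> G v))"
  unfolding epimorphism_def
proof (intro conjI ballI)
  show "nat_trans K U X Z (\<lambda>G v. \<psi> G (\<phi> G v))"
    using assms by (auto simp: epimorphism_def intro: nat_trans_comp)
  show "(\<lambda>v. \<psi> G (\<phi> G v)) ` carrier (obj X G) = carrier (obj Z G)" if "G \<in> U" for G
  proof -
    have "(\<lambda>v. \<psi> G (\<phi> G v)) ` carrier (obj X G) = \<psi> G ` \<phi> G ` carrier (obj X G)"
      by (simp only: image_image)
    then show ?thesis using assms that by (simp add: epimorphism_def)
  qed
qed

lemma finitely_generated_epimorphism:
  assumes "finitely_generated K U X" "epimorphism K U X Y \<psi>"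
  shows "finitely_generated K U Y"
proof -
  obtain n Gs \<phi> where "\<forall>i<n. Gs i \<in> U"
    "epimorphism K U (functor_sum n (\<lambda>i. e_functor K (Gs i))) X \<phi>"
    using assms(1) by (auto simp: finitely_generated_def)
  then show ?thesis
    unfolding finitely_generated_def
    by (intro exI[of _ n] exI[of _ Gs] exI[of _ "\<lambda>G v. \<psi> G (\<phi> G v)"] conjI epimorphism_comp[OF _ assms(2)])
qed

section \<open>Subfunctors, quotients and changes of the underlying sets\<close>

definition sub_functor ::
    "('k, 'v) functor_data \<Rightarrow> (nat monoid \<Rightarrow> 'v set) \<Rightarrow> ('k, 'v) functor_data" where
  "sub_functor X A = \<lparr>obj = (\<lambda>G. (obj X G)\<lparr>carrier := A G\<rparr>), arr = arr X\<rparr>"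

lemma sub_functor_simps [simp]:
  "carrier (obj (sub_functor X A) G) = A G"
  "\<zero>\<^bsub>obj (sub_functor X A) G\<^esub> = \<zero>\<^bsub>obj X G\<^esub>"
  "x \<oplus>\<^bsub>obj (sub_functor X A) G\<^esub> y = x \<oplus>\<^bsub>obj X G\<^esub> y"
  "a \<odot>\<^bsub>obj (sub_functor X A) G\<^esub> x = a \<odot>\<^bsub>obj X G\<^esub> x"
  "arr (sub_functor X A) = arr X"
  by (simp_all add: sub_functor_def)

definition is_subfunctor ::
    "'k ring \<Rightarrow> nat monoid set \<Rightarrow> ('k, 'v) functor_data \<Rightarrow> (nat monoid \<Rightarrow> 'v set) \<Rightarrow> bool" where
  "is_subfunctor K U X A \<longleftrightarrow>
     (\<forall>G\<in>U. subspace K (A G) (obj X G)) \<and>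
     (\<forall>G\<in>U. \<forall>H\<in>U. \<forall>\<alpha>\<in>Hom G H. \<forall>v\<in>A H. arr X G H \<alpha> v \<in> A G)"

lemma subfunctor_subset: "is_subfunctor K U X A \<Longrightarrow> G \<in> U \<Longrightarrow> v \<in> A G \<Longrightarrow> v \<in> carrier (obj X G)"
  using submodule.subset by (fastforce simp: is_subfunctor_def)

lemma is_functor_sub_functor:
  assumes X: "is_functor K U X" and A: "is_subfunctor K U X A"
  shows "is_functor K U (sub_functor X A)"
proof -
  note sub = subfunctor_subset[OF A]
  show ?thesis
  proof (rule is_functorI)
    fix G assume G: "G \<in> U"
    show "Module.module K (obj (sub_functor X A) G)"
      using module.submodule_is_module[OF functor_module[OF X G]] A G
      by (simp add: sub_functor_def is_subfunctor_def)
    fix H \<alpha> assume H: "H \<in> U" "\<alpha> \<in> Hom G H"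
    show "arr (sub_functor X A) G H \<alpha> \<in> lin K (obj (sub_functor X A) H) (obj (sub_functor X A) G)"
      using functor_arr[OF X G H] sub[OF H(1)] A G H
      by (intro linI) (auto simp: lin_add lin_smult is_subfunctor_def)
  qed (use X sub in \<open>auto simp: functor_id[OF X] functor_comp[OF X]\<close>)
qed

lemma nat_trans_sub_functor:
  assumes X: "is_functor K U X" and A: "is_subfunctor K U X A"
  shows "nat_trans K U (sub_functor X A) X (\<lambda>G v. v)"
  unfolding nat_trans_def using subfunctor_subset[OF A] by (intro conjI ballI linI) simp_all

definition image_functor ::
    "(nat monoid \<Rightarrow> 'v \<Rightarrow> 'w) \<Rightarrow> (nat monoid \<Rightarrow> 'w \<Rightarrow> 'v) \<Rightarrow> ('k, 'v) functor_data
      \<Rightarrow> ('k, 'w) functor_data" where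
  "image_functor \<phi> \<psi> X = \<lparr>
     obj = (\<lambda>G. \<lparr>carrier = \<phi> G ` carrier (obj X G),
       mult = (\<lambda>x y. \<phi> G (\<psi> G x \<otimes>\<^bsub>obj X G\<^esub> \<psi> G y)), one = \<phi> G \<one>\<^bsub>obj X G\<^esub>,
       zero = \<phi> G \<zero>\<^bsub>obj X G\<^esub>, add = (\<lambda>x y. \<phi> G (\<psi> G x \<oplus>\<^bsub>obj X G\<^esub> \<psi> G y)),
       smult = (\<lambda>a x. \<phi> G (a \<odot>\<^bsub>obj X G\<^esub> \<psi> G x))\<rparr>),
     arr = (\<lambda>G H \<alpha> v. \<phi> G (arr X G H \<alpha> (\<psi> H v)))\<rparr>"

lemma image_functor_simps [simp]:
  "carrier (obj (image_functor \<phi> \<psi> X) G) = \<phi> G ` carrier (obj X G)"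
  "\<zero>\<^bsub>obj (image_functor \<phi> \<psi> X) G\<^esub> = \<phi> G \<zero>\<^bsub>obj X G\<^esub>"
  "x \<oplus>\<^bsub>obj (image_functor \<phi> \<psi> X) G\<^esub> y = \<phi> G (\<psi> G x \<oplus>\<^bsub>obj X G\<^esub> \<psi> G y)"
  "a \<odot>\<^bsub>obj (image_functor \<phi> \<psi> X) G\<^esub> x = \<phi> G (a \<odot>\<^bsub>obj X G\<^esub> \<psi> G x)"
  "arr (image_functor \<phi> \<psi> X) G H \<alpha> v = \<phi> G (arr X G H \<alpha> (\<psi> H v))"
  by (simp_all add: image_functor_def)

text \<open>\<open>\<phi>\<close> identifies exactly the elements that differ by an element of \<open>A\<close>, and \<open>\<psi>\<close> is a section of
  it: with \<open>\<phi>\<close> a choice of coset representatives this is the quotient by \<open>A\<close>, realised on the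
  same type; with \<open>A = 0\<close> it is a change of the underlying sets.\<close>

locale image_data =
  fixes K :: "'k ring" and U X A and \<phi> :: "nat monoid \<Rightarrow> 'v \<Rightarrow> 'w" and \<psi>
  assumes X: "is_functor K U X" and A: "is_subfunctor K U X A"
    and \<phi>_eq_iff: "\<And>G x y. G \<in> U \<Longrightarrow> x \<in> carrier (obj X G) \<Longrightarrow> y \<in> carrier (obj X G) \<Longrightarrow>
      \<phi> G x = \<phi> G y \<longleftrightarrow> x \<ominus>\<^bsub>obj X G\<^esub> y \<in> A G"
    and \<psi>_closed: "\<And>G x. G \<in> U \<Longrightarrow> x \<in> carrier (obj X G) \<Longrightarrow> \<psi> G (\<phi> G x) \<in> carrier (obj X G)"
    and \<phi>_\<psi>: "\<And>G x. G \<in> U \<Longrightarrow> x \<in> carrier (obj X G) \<Longrightarrow> \<phi> G (\<psi> G (\<phi> G x)) = \<phi> G x"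
begin

abbreviation Y where "Y \<equiv> image_functor \<phi> \<psi> X"

lemma \<psi>_diff: "G \<in> U \<Longrightarrow> x \<in> carrier (obj X G) \<Longrightarrow> \<psi> G (\<phi> G x) \<ominus>\<^bsub>obj X G\<^esub> x \<in> A G"
  using \<phi>_eq_iff[of G "\<psi> G (\<phi> G x)" x] \<phi>_\<psi> \<psi>_closed by simp

text \<open>With the two lemmas that follow, this is independence of representatives: replacing the
  arguments by the representatives that \<psi> chooses moves the result by an element of A, which
  \<phi> does not see.\<close>

lemma \<phi>_add:
  assumes "G \<in> U" "x \<in> carrier (obj X G)" "y \<in> carrier (obj X G)"
  shows "\<phi> G (x \<oplus>\<^bsub>obj X G\<^esub> y) = \<phi> G (\<psi> G (\<phi> G x) \<oplus>\<^bsub>obj X G\<^esub> \<psi> G (\<phi> G y))"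
proof -
  interpret M: Module.module K "obj X G" by (rule functor_module[OF X assms(1)])
  interpret S: LinearCombinations.submodule K "A G" "obj X G"
    using A assms by (simp add: is_subfunctor_def)
  have "(\<psi> G (\<phi> G x) \<oplus>\<^bsub>obj X G\<^esub> \<psi> G (\<phi> G y)) \<ominus>\<^bsub>obj X G\<^esub> (x \<oplus>\<^bsub>obj X G\<^esub> y) \<in> A G"
    using assms \<psi>_diff \<psi>_closed by (subst M.add_diff_add) auto
  then show ?thesis using assms \<psi>_closed \<phi>_eq_iff by (metis M.add.m_closed)
qed

lemma \<phi>_smult:
  assumes "G \<in> U" "a \<in> carrier K" "x \<in> carrier (obj X G)"
  shows "\<phi> G (a \<odot>\<^bsub>obj X G\<^esub> x) = \<phi> G (a \<odot>\<^bsub>obj X G\<^esub> \<psi> G (\<phi> G x))"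
proof -
  interpret M: Module.module K "obj X G" by (rule functor_module[OF X assms(1)])
  interpret S: LinearCombinations.submodule K "A G" "obj X G"
    using A assms by (simp add: is_subfunctor_def)
  have "a \<odot>\<^bsub>obj X G\<^esub> (\<psi> G (\<phi> G x) \<ominus>\<^bsub>obj X G\<^esub> x) \<in> A G"
    using assms \<psi>_diff by auto
  then have "a \<odot>\<^bsub>obj X G\<^esub> \<psi> G (\<phi> G x) \<ominus>\<^bsub>obj X G\<^esub> a \<odot>\<^bsub>obj X G\<^esub> x \<in> A G"
    using assms \<psi>_closed by (simp add: a_minus_def M.smult_r_distr M.smult_r_minus)
  then show ?thesis using assms \<psi>_closed \<phi>_eq_iff by (metis M.smult_closed)
qed

lemma \<phi>_arr:
  assumes "G \<in> U" "H \<in> U" "\<alpha> \<in> Hom G H" "x \<in> carrier (obj X H)"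
  shows "\<phi> G (arr X G H \<alpha> x) = \<phi> G (arr X G H \<alpha> (\<psi> H (\<phi> H x)))"
proof -
  note f = functor_arr[OF X assms(1-3)]
  have "arr X G H \<alpha> (\<psi> H (\<phi> H x) \<ominus>\<^bsub>obj X H\<^esub> x) \<in> A G"
    using assms A \<psi>_diff by (simp add: is_subfunctor_def)
  then have "arr X G H \<alpha> (\<psi> H (\<phi> H x)) \<ominus>\<^bsub>obj X G\<^esub> arr X G H \<alpha> x \<in> A G"
    using assms X f \<psi>_closed by (simp add: lin_diff[OF _ _ f] functor_module)
  then show ?thesis
    using \<phi>_eq_iff[OF assms(1) functor_arr_closed[OF X assms(1-3) \<psi>_closed[OF assms(2,4)]]
        functor_arr_closed[OF X assms]] by simp
qed

lemma is_functor: "is_functor K U Y"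
proof -
  have mod: "Module.module K (obj Y G)" if G: "G \<in> U" for G
    using \<phi>_add[OF G] \<phi>_smult[OF G] by (intro module_image[OF functor_module[OF X G], of _ "\<phi> G"]) auto
  show ?thesis
  proof (rule is_functorI)
    fix G assume G: "G \<in> U"
    show "arr Y G G (id_class G) v = v" if "v \<in> carrier (obj Y G)" for v
      using that G by (auto simp: functor_id[OF X G] \<psi>_closed \<phi>_\<psi>)
    fix H \<alpha> assume H: "H \<in> U" "\<alpha> \<in> Hom G H"
    note f = functor_arr[OF X G H]
    interpret M: Module.module K "obj X H" by (rule functor_module[OF X H(1)])
    show "arr Y G H \<alpha> \<in> lin K (obj Y H) (obj Y G)"
    proof (rule linI)
      fix x y assume "x \<in> carrier (obj Y H)" "y \<in> carrier (obj Y H)"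
      then obtain u v where uv: "u \<in> carrier (obj X H)" "v \<in> carrier (obj X H)"
        "x = \<phi> H u" "y = \<phi> H v" by auto
      have "arr Y G H \<alpha> (x \<oplus>\<^bsub>obj Y H\<^esub> y) = \<phi> G (arr X G H \<alpha> (u \<oplus>\<^bsub>obj X H\<^esub> v))"
        using uv G H by (simp add: \<phi>_add[symmetric] \<phi>_arr[symmetric])
      also have "\<dots> = \<phi> G (arr X G H \<alpha> u \<oplus>\<^bsub>obj X G\<^esub> arr X G H \<alpha> v)"
        using uv by (simp add: lin_add[OF f])
      finally show "arr Y G H \<alpha> (x \<oplus>\<^bsub>obj Y H\<^esub> y) = arr Y G H \<alpha> x \<oplus>\<^bsub>obj Y G\<^esub> arr Y G H \<alpha> y"
        using uv G H f by (simp add: \<phi>_arr[symmetric] \<phi>_add[symmetric] lin_closed)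
    next
      fix a y assume "a \<in> carrier K" "y \<in> carrier (obj Y H)"
      then obtain v where uv: "a \<in> carrier K" "v \<in> carrier (obj X H)" "y = \<phi> H v" by auto
      have "arr Y G H \<alpha> (a \<odot>\<^bsub>obj Y H\<^esub> y) = \<phi> G (arr X G H \<alpha> (a \<odot>\<^bsub>obj X H\<^esub> v))"
        using uv G H by (simp add: \<phi>_smult[symmetric] \<phi>_arr[symmetric])
      also have "\<dots> = \<phi> G (a \<odot>\<^bsub>obj X G\<^esub> arr X G H \<alpha> v)"
        using uv by (simp add: lin_smult[OF f])
      finally show "arr Y G H \<alpha> (a \<odot>\<^bsub>obj Y H\<^esub> y) = a \<odot>\<^bsub>obj Y G\<^esub> arr Y G H \<alpha> y"
        using uv G H f by (simp add: \<phi>_arr[symmetric] \<phi>_smult[symmetric] lin_closed)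
    qed (use G H f \<psi>_closed in \<open>auto intro!: imageI lin_closed[OF f]\<close>)
    fix L \<beta> v assume L: "L \<in> U" "\<beta> \<in> Hom H L" "v \<in> carrier (obj Y L)"
    then obtain x where x: "x \<in> carrier (obj X L)" "v = \<phi> L x" by auto
    note c = functor_arr_closed[OF X H(1) L(1) L(2)]
    have "\<phi> G (arr X G H \<alpha> (arr X H L \<beta> (\<psi> L v)))
        = \<phi> G (arr X G H \<alpha> (\<psi> H (\<phi> H (arr X H L \<beta> (\<psi> L v)))))"
      using x c \<psi>_closed L by (intro \<phi>_arr[OF G H]) auto
    then show "arr Y G L (comp_class G \<beta> \<alpha>) v = arr Y G H \<alpha> (arr Y H L \<beta> v)"
      using x L \<psi>_closed by (simp add: functor_comp[OF X G H(1) L(1) H(2) L(2)])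
  qed (rule mod)
qed

lemma nat_trans: "nat_trans K U X Y \<phi>"
  unfolding nat_trans_def
  by (auto intro!: linI simp: \<phi>_add \<phi>_smult \<phi>_arr)

lemma epimorphism: "epimorphism K U X Y \<phi>"
  using nat_trans by (simp add: epimorphism_def)

lemma \<phi>_zero_iff:
  assumes "G \<in> U" "x \<in> carrier (obj X G)"
  shows "\<phi> G x = \<zero>\<^bsub>obj Y G\<^esub> \<longleftrightarrow> x \<in> A G"
proof -
  interpret M: Module.module K "obj X G" by (rule functor_module[OF X assms(1)])
  show ?thesis using assms by (simp add: \<phi>_eq_iff a_minus_def M.neg_zero)
qed

end

text \<open>Elements of one coset satisfy the same predicate, so \<open>SOME\<close> picks the same
  representative for all of them. This gives a normal form inside the given type.\<close>

definition coset_rep :: "('k, 'v) functor_data \<Rightarrow> (nat monoid \<Rightarrow> 'v set) \<Rightarrow> nat monoid \<Rightarrow> 'v \<Rightarrow> 'v" where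
  "coset_rep X A G x = (SOME y. y \<in> carrier (obj X G) \<and> x \<ominus>\<^bsub>obj X G\<^esub> y \<in> A G)"

lemma quotient_image_data:
  assumes X: "is_functor K U X" and A: "is_subfunctor K U X A"
  shows "image_data K U X A (coset_rep X A) (\<lambda>G y. y)"
proof (unfold_locales, rule X, rule A)
  fix G assume G: "G \<in> U"
  interpret M: Module.module K "obj X G" by (rule functor_module[OF X G])
  have S: "subspace K (A G) (obj X G)" using A G by (simp add: is_subfunctor_def)
  interpret S: LinearCombinations.submodule K "A G" "obj X G" by (rule S)
  have sym: "y \<ominus>\<^bsub>obj X G\<^esub> x \<in> A G" if "x \<ominus>\<^bsub>obj X G\<^esub> y \<in> A G" "x \<in> carrier (obj X G)" "y \<in> carrier (obj X G)" for x y
    using subspace_minus(1)[OF S that(1)] that by (simp add: a_minus_def M.minus_add M.a_comm)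
  have trans: "x \<ominus>\<^bsub>obj X G\<^esub> z \<in> A G" if "x \<ominus>\<^bsub>obj X G\<^esub> y \<in> A G" "y \<ominus>\<^bsub>obj X G\<^esub> z \<in> A G"
    "x \<in> carrier (obj X G)" "y \<in> carrier (obj X G)" "z \<in> carrier (obj X G)" for x y z
  proof -
    have "(y \<ominus>\<^bsub>obj X G\<^esub> z) \<ominus>\<^bsub>obj X G\<^esub> (y \<ominus>\<^bsub>obj X G\<^esub> x) \<in> A G"
      by (rule subspace_minus(2)[OF S that(2) sym[OF that(1,3,4)]])
    then show ?thesis by (simp only: M.diff_diff[OF that(4,5,3)])
  qed
  have rep: "coset_rep X A G x \<in> carrier (obj X G)" "x \<ominus>\<^bsub>obj X G\<^esub> coset_rep X A G x \<in> A G"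
    if "x \<in> carrier (obj X G)" for x
  proof -
    have "x \<in> carrier (obj X G) \<and> x \<ominus>\<^bsub>obj X G\<^esub> x \<in> A G" using that by (simp add: a_minus_def M.r_neg)
    from someI[where P = "\<lambda>y. y \<in> carrier (obj X G) \<and> x \<ominus>\<^bsub>obj X G\<^esub> y \<in> A G", OF this]
    show "coset_rep X A G x \<in> carrier (obj X G)" "x \<ominus>\<^bsub>obj X G\<^esub> coset_rep X A G x \<in> A G"
      by (auto simp: coset_rep_def)
  qed
  show eq: "(coset_rep X A G x = coset_rep X A G y) = (x \<ominus>\<^bsub>obj X G\<^esub> y \<in> A G)"
    if xy: "x \<in> carrier (obj X G)" "y \<in> carrier (obj X G)" for x y
  proof
    assume "coset_rep X A G x = coset_rep X A G y"
    then have "coset_rep X A G x \<ominus>\<^bsub>obj X G\<^esub> y \<in> A G"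
      using sym[OF rep(2)[OF xy(2)] xy(2) rep(1)[OF xy(2)]] by simp
    then show "x \<ominus>\<^bsub>obj X G\<^esub> y \<in> A G"
      by (rule trans[OF rep(2)[OF xy(1)] _ xy(1) rep(1)[OF xy(1)] xy(2)])
  next
    assume "x \<ominus>\<^bsub>obj X G\<^esub> y \<in> A G"
    then have "x \<ominus>\<^bsub>obj X G\<^esub> z \<in> A G \<longleftrightarrow> y \<ominus>\<^bsub>obj X G\<^esub> z \<in> A G" if "z \<in> carrier (obj X G)" for z
      using trans[OF _ _ xy(1) xy(2) that] trans[OF sym[OF _ xy] _ xy(2) xy(1) that] by blast
    then show "coset_rep X A G x = coset_rep X A G y"
      unfolding coset_rep_def by (intro arg_cong[of _ _ Eps]) auto
  qed
  show "coset_rep X A G x \<in> carrier (obj X G)" if "x \<in> carrier (obj X G)" for x using that by (rule rep)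
  show "coset_rep X A G (coset_rep X A G x) = coset_rep X A G x" if x: "x \<in> carrier (obj X G)" for x
    unfolding eq[OF rep(1)[OF x] x] by (rule sym[OF rep(2)[OF x] x rep(1)[OF x]])
qed

text \<open>A covariant functor from U to finite sets and partial maps, composed as in the
  \<open>option\<close> monad. Families indexed by it form a contravariant functor. Maps are partial
  because a morphism to T need not factor through a given \<alpha>; the corresponding coordinate of
  a pullback is then 0.\<close>

definition index_system ::
    "nat monoid set \<Rightarrow> (nat monoid \<Rightarrow> 'i set)
      \<Rightarrow> (nat monoid \<Rightarrow> nat monoid \<Rightarrow> (nat \<Rightarrow> nat) set \<Rightarrow> 'i \<Rightarrow> 'i option) \<Rightarrow> bool" where
  "index_system U I s \<longleftrightarrow>
     (\<forall>G\<in>U. finite (I G)) \<and>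
     (\<forall>G\<in>U. \<forall>H\<in>U. \<forall>\<alpha>\<in>Hom G H. \<forall>j\<in>I G. \<forall>i. s G H \<alpha> j = Some i \<longrightarrow> i \<in> I H) \<and>
     (\<forall>G\<in>U. \<forall>j\<in>I G. s G G (id_class G) j = Some j) \<and>
     (\<forall>G\<in>U. \<forall>H\<in>U. \<forall>L\<in>U. \<forall>\<alpha>\<in>Hom G H. \<forall>\<beta>\<in>Hom H L. \<forall>j\<in>I G.
        s G L (comp_class G \<beta> \<alpha>) j = Option.bind (s G H \<alpha> j) (s H L \<beta>))"

text \<open>The sum of copies of \<open>X\<close> indexed by the finite sets \<open>I G\<close>: along \<open>\<alpha>\<close>, the \<open>j\<close>-th
  component is the image of the component \<open>s \<alpha> j\<close>, if that is defined, and \<open>0\<close> otherwise.\<close>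

definition copower ::
    "('k, 'v) functor_data \<Rightarrow> (nat monoid \<Rightarrow> 'i set)
      \<Rightarrow> (nat monoid \<Rightarrow> nat monoid \<Rightarrow> (nat \<Rightarrow> nat) set \<Rightarrow> 'i \<Rightarrow> 'i option)
      \<Rightarrow> ('k, 'i \<Rightarrow> 'v) functor_data" where
  "copower X I s = \<lparr>
     obj = (\<lambda>G. prod_module (I G) (\<lambda>_. obj X G)),
     arr = (\<lambda>G H \<alpha> v. \<lambda>j\<in>I G. case s G H \<alpha> j of None \<Rightarrow> \<zero>\<^bsub>obj X G\<^esub> | Some i \<Rightarrow> arr X G H \<alpha> (v i))\<rparr>"

lemma copower_simps [simp]:
  "obj (copower X I s) G = prod_module (I G) (\<lambda>_. obj X G)"
  "arr (copower X I s) G H \<alpha> v =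
     (\<lambda>j\<in>I G. case s G H \<alpha> j of None \<Rightarrow> \<zero>\<^bsub>obj X G\<^esub> | Some i \<Rightarrow> arr X G H \<alpha> (v i))"
  by (simp_all add: copower_def)

lemma is_functor_copower:
  assumes X: "is_functor K U X" and I: "index_system U I s"
  shows "is_functor K U (copower X I s)"
proof (rule is_functorI)
  fix G assume G: "G \<in> U"
  interpret M: Module.module K "obj X G" by (rule functor_module[OF X G])
  show "Module.module K (obj (copower X I s) G)"
    by (simp add: module_prod_module[OF M.is_cring M.module_axioms])
  show "arr (copower X I s) G G (id_class G) v = v" if "v \<in> carrier (obj (copower X I s) G)" for v
    using that I G X by (auto simp: index_system_def fun_eq_iff PiE_iff extensional_def functor_id)
  fix H \<alpha> assume H: "H \<in> U" "\<alpha> \<in> Hom G H"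
  note f = functor_arr[OF X G H]
  interpret N: Module.module K "obj X H" by (rule functor_module[OF X H(1)])
  have s: "i \<in> I H" if "j \<in> I G" "s G H \<alpha> j = Some i" for i j
    using that I G H by (auto simp: index_system_def)
  show "arr (copower X I s) G H \<alpha> \<in> lin K (obj (copower X I s) H) (obj (copower X I s) G)"
  proof (rule linI)
    fix x assume x: "x \<in> carrier (obj (copower X I s) H)"
    then show "arr (copower X I s) G H \<alpha> x \<in> carrier (obj (copower X I s) G)"
      by (auto simp: PiE_iff lin_closed[OF f] dest!: s split: option.split)
    show "arr (copower X I s) G H \<alpha> (x \<oplus>\<^bsub>obj (copower X I s) H\<^esub> y)
      = arr (copower X I s) G H \<alpha> x \<oplus>\<^bsub>obj (copower X I s) G\<^esub> arr (copower X I s) G H \<alpha> y"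
      if "y \<in> carrier (obj (copower X I s) H)" for y
    proof (rule ext)
      fix j
      show "arr (copower X I s) G H \<alpha> (x \<oplus>\<^bsub>obj (copower X I s) H\<^esub> y) j
        = (arr (copower X I s) G H \<alpha> x \<oplus>\<^bsub>obj (copower X I s) G\<^esub> arr (copower X I s) G H \<alpha> y) j"
        using x that s[of j] by (cases "s G H \<alpha> j") (auto simp: PiE_iff lin_add[OF f])
    qed
    show "arr (copower X I s) G H \<alpha> (a \<odot>\<^bsub>obj (copower X I s) H\<^esub> x)
      = a \<odot>\<^bsub>obj (copower X I s) G\<^esub> arr (copower X I s) G H \<alpha> x" if "a \<in> carrier K" for a
    proof (rule ext)
      fix j
      show "arr (copower X I s) G H \<alpha> (a \<odot>\<^bsub>obj (copower X I s) H\<^esub> x) j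
        = (a \<odot>\<^bsub>obj (copower X I s) G\<^esub> arr (copower X I s) G H \<alpha> x) j"
        using x that s[of j] by (cases "s G H \<alpha> j") (auto simp: PiE_iff lin_smult[OF f])
    qed
  qed
  fix L \<beta> v assume L: "L \<in> U" "\<beta> \<in> Hom H L" "v \<in> carrier (obj (copower X I s) L)"
  have s': "i \<in> I L" if "j \<in> I H" "s H L \<beta> j = Some i" for i j
    using that I L H by (auto simp: index_system_def)
  have c: "s G L (comp_class G \<beta> \<alpha>) j = Option.bind (s G H \<alpha> j) (s H L \<beta>)" if "j \<in> I G" for j
    using that I G H L by (auto simp: index_system_def)
  show "arr (copower X I s) G L (comp_class G \<beta> \<alpha>) v
    = arr (copower X I s) G H \<alpha> (arr (copower X I s) H L \<beta> v)"
  proof (rule ext)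
    fix j
    show "arr (copower X I s) G L (comp_class G \<beta> \<alpha>) v j
      = arr (copower X I s) G H \<alpha> (arr (copower X I s) H L \<beta> v) j"
    proof (cases "j \<in> I G \<and> s G H \<alpha> j \<noteq> None")
      case True
      then obtain i where i: "j \<in> I G" "s G H \<alpha> j = Some i" by blast
      then show ?thesis
        using L(3) s[OF i] s'[of i] by (cases "s H L \<beta> i")
          (auto simp: PiE_iff c functor_comp[OF X G H(1) L(1) H(2) L(2)] functor_arr_zero[OF X G H])
    qed (auto simp: c)
  qed
qed

text \<open>The tensor unit. Its copowers are the free functors used later, among them copies of the
  representable ones.\<close>

definition const_functor :: "'k ring \<Rightarrow> ('k, 'k) functor_data" where
  "const_functor K = \<lparr>obj = (\<lambda>_. scalar_module K), arr = (\<lambda>_ _ _ v. v)\<rparr>"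

lemma const_functor_simps [simp]:
  "obj (const_functor K) G = scalar_module K" "arr (const_functor K) G H \<alpha> v = v"
  by (simp_all add: const_functor_def)

lemma is_functor_const_functor: "cring K \<Longrightarrow> is_functor K U (const_functor K)"
  by (intro is_functorI linI) (simp_all add: module_scalar_module)

section \<open>Categories with levels\<close>

text \<open>For naturality of maps given by sums: pulling back injects one basis into another, and
  the coordinates outside the image are 0.\<close>

lemma (in abelian_monoid) finsum_reindex_neutral:
  assumes "finite B" "inj_on h A" "h ` A \<subseteq> B" "\<And>i. i \<in> B \<Longrightarrow> g i \<in> carrier G"
    and "\<And>i. i \<in> B \<Longrightarrow> i \<notin> h ` A \<Longrightarrow> g i = \<zero>"
  shows "finsum G g B = finsum G (\<lambda>x. g (h x)) A"
proof -
  have "finsum G g B = finsum G g (h ` A)"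
    using assms by (intro add.finprod_mono_neutral_cong_right) auto
  also have "\<dots> = finsum G (\<lambda>x. g (h x)) A"
    using assms by (intro finsum_reindex) auto
  finally show ?thesis .
qed

lemma (in abelian_monoid) finsum_single:
  assumes "finite B" "i \<in> B" "g i \<in> carrier G" "\<And>j. j \<in> B \<Longrightarrow> j \<noteq> i \<Longrightarrow> g j = \<zero>"
  shows "finsum G g B = g i"
proof -
  have "finsum G g B = finsum G (\<lambda>x. g (id x)) {i}"
  proof (rule finsum_reindex_neutral)
    show "g j \<in> carrier G" if "j \<in> B" for j
      using assms that by (cases "j = i") auto
  qed (use assms in auto)
  then show ?thesis using assms by simp
qed

text \<open>\<open>comp_cancel\<close> says that every morphism is an epimorphism, so pulling back
  is injective on the basis of a representable functor. \<open>lift\<close> is projectivity relative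
  to levels. In \<open>factor\<close> the middle object is one of the representatives
  \<open>R j\<close>, so that the bound on j leaves finitely many candidates for generators; the
  bound itself comes from the order of a product of two groups.\<close>

locale level_category =
  fixes U :: "nat monoid set" and lev :: "nat monoid \<Rightarrow> nat" and R :: "nat \<Rightarrow> nat monoid"
  assumes finite_Hom: "G \<in> U \<Longrightarrow> H \<in> U \<Longrightarrow> finite (Hom G H)"
    and id_Hom: "G \<in> U \<Longrightarrow> id_class G \<in> Hom G G"
    and comp_Hom: "G \<in> U \<Longrightarrow> H \<in> U \<Longrightarrow> L \<in> U \<Longrightarrow> \<alpha> \<in> Hom G H \<Longrightarrow> \<beta> \<in> Hom H L \<Longrightarrow>
      comp_class G \<beta> \<alpha> \<in> Hom G L"
    and comp_id_left: "G \<in> U \<Longrightarrow> H \<in> U \<Longrightarrow> \<alpha> \<in> Hom G H \<Longrightarrow> comp_class G (id_class H) \<alpha> = \<alpha>"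
    and comp_id_right: "G \<in> U \<Longrightarrow> H \<in> U \<Longrightarrow> \<alpha> \<in> Hom G H \<Longrightarrow> comp_class G \<alpha> (id_class G) = \<alpha>"
    and comp_assoc: "G \<in> U \<Longrightarrow> H \<in> U \<Longrightarrow> L \<in> U \<Longrightarrow> T \<in> U \<Longrightarrow> \<alpha> \<in> Hom G H \<Longrightarrow> \<beta> \<in> Hom H L \<Longrightarrow>
      \<delta> \<in> Hom L T \<Longrightarrow> comp_class G (comp_class H \<delta> \<beta>) \<alpha> = comp_class G \<delta> (comp_class G \<beta> \<alpha>)"
    and comp_cancel: "G \<in> U \<Longrightarrow> H \<in> U \<Longrightarrow> L \<in> U \<Longrightarrow> \<alpha> \<in> Hom G H \<Longrightarrow> \<beta> \<in> Hom H L \<Longrightarrow>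
      \<beta>' \<in> Hom H L \<Longrightarrow> comp_class G \<beta> \<alpha> = comp_class G \<beta>' \<alpha> \<Longrightarrow> \<beta> = \<beta>'"
    and lift: "G \<in> U \<Longrightarrow> G' \<in> U \<Longrightarrow> H \<in> U \<Longrightarrow> \<alpha> \<in> Hom G H \<Longrightarrow> \<beta> \<in> Hom G' H \<Longrightarrow> lev G' \<le> lev G \<Longrightarrow>
      \<exists>\<gamma>\<in>Hom G G'. comp_class G \<beta> \<gamma> = \<alpha>"
    and Hom_empty_iff: "G \<in> U \<Longrightarrow> H \<in> U \<Longrightarrow> Hom G H = {} \<longleftrightarrow> lev G < lev H"
    and factor: "W \<in> U \<Longrightarrow> G \<in> U \<Longrightarrow> H \<in> U \<Longrightarrow> \<alpha> \<in> Hom W G \<Longrightarrow> \<beta> \<in> Hom W H \<Longrightarrow>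
      \<exists>j \<le> lev G + lev H. \<exists>\<gamma>\<in>Hom W (R j). \<exists>\<alpha>'\<in>Hom (R j) G. \<exists>\<beta>'\<in>Hom (R j) H.
        comp_class W \<alpha>' \<gamma> = \<alpha> \<and> comp_class W \<beta>' \<gamma> = \<beta>"
    and R_in: "R n \<in> U" and lev_R: "lev (R n) = n"
begin

lemma Hom_lev: "G \<in> U \<Longrightarrow> H \<in> U \<Longrightarrow> \<alpha> \<in> Hom G H \<Longrightarrow> lev H \<le> lev G"
  using Hom_empty_iff by (metis empty_iff not_le_imp_less)

lemma Hom_ex: "G \<in> U \<Longrightarrow> H \<in> U \<Longrightarrow> lev H \<le> lev G \<Longrightarrow> \<exists>\<alpha>. \<alpha> \<in> Hom G H"
  using Hom_empty_iff by (metis equals0I not_less)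

text \<open>\<open>factor_thru T G H \<alpha>\<close> is the partial inverse of precomposition with \<open>\<alpha> : G \<rightarrow> H\<close> on
  morphisms to \<open>T\<close>. With it, pulling back along \<open>\<alpha>\<close> in \<open>e_T\<close> merely relabels coordinates, without
  sums, because \<open>\<alpha>\<close> can be cancelled.\<close>

definition factor_thru ::
    "nat monoid \<Rightarrow> nat monoid \<Rightarrow> nat monoid \<Rightarrow> (nat \<Rightarrow> nat) set \<Rightarrow> (nat \<Rightarrow> nat) set \<Rightarrow> (nat \<Rightarrow> nat) set option"
  where
  "factor_thru T G H \<alpha> \<gamma> =
     (if \<exists>\<beta>\<in>Hom H T. comp_class G \<beta> \<alpha> = \<gamma>
      then Some (SOME \<beta>. \<beta> \<in> Hom H T \<and> comp_class G \<beta> \<alpha> = \<gamma>) else None)"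

lemma factor_thru_Some:
  assumes "T \<in> U" "G \<in> U" "H \<in> U" "\<alpha> \<in> Hom G H" "\<beta> \<in> Hom H T"
  shows "factor_thru T G H \<alpha> (comp_class G \<beta> \<alpha>) = Some \<beta>"
proof -
  have "(SOME \<beta>'. \<beta>' \<in> Hom H T \<and> comp_class G \<beta>' \<alpha> = comp_class G \<beta> \<alpha>) = \<beta>"
    by (rule some_equality) (use assms comp_cancel in blast)+
  then show ?thesis using assms by (auto simp: factor_thru_def)
qed

lemma factor_thru_SomeD:
  assumes "factor_thru T G H \<alpha> \<gamma> = Some \<beta>"
  shows "\<beta> \<in> Hom H T" "comp_class G \<beta> \<alpha> = \<gamma>"
proof -
  have ex: "\<exists>\<beta>. \<beta> \<in> Hom H T \<and> comp_class G \<beta> \<alpha> = \<gamma>"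
    and eq: "\<beta> = (SOME \<beta>. \<beta> \<in> Hom H T \<and> comp_class G \<beta> \<alpha> = \<gamma>)"
    using assms by (auto simp: factor_thru_def split: if_splits)
  from someI_ex[OF ex] show "\<beta> \<in> Hom H T" "comp_class G \<beta> \<alpha> = \<gamma>" by (simp_all add: eq)
qed

lemma factor_thru_NoneD:
  "factor_thru T G H \<alpha> \<gamma> = None \<Longrightarrow> \<beta> \<in> Hom H T \<Longrightarrow> comp_class G \<beta> \<alpha> \<noteq> \<gamma>"
  by (auto simp: factor_thru_def split: if_splits)

lemma factor_thru_id:
  assumes "T \<in> U" "G \<in> U" "\<gamma> \<in> Hom G T"
  shows "factor_thru T G G (id_class G) \<gamma> = Some \<gamma>"
  using factor_thru_Some[OF assms(1,2,2) id_Hom[OF assms(2)] assms(3)] comp_id_right[OF assms(2,1,3)] by simp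

text \<open>A factorization through the composite is a factorization through \<alpha> whose result
  factors through \<beta>; cancellation makes the intermediate morphism unique. This is the
  composition law of an index system.\<close>

lemma factor_thru_comp:
  assumes "T \<in> U" "G \<in> U" "H \<in> U" "L \<in> U" "\<alpha> \<in> Hom G H" "\<beta> \<in> Hom H L"
  shows "factor_thru T G L (comp_class G \<beta> \<alpha>) \<gamma> = Option.bind (factor_thru T G H \<alpha> \<gamma>) (factor_thru T H L \<beta>)"
proof (cases "factor_thru T G L (comp_class G \<beta> \<alpha>) \<gamma>")
  case None
  have "factor_thru T H L \<beta> \<delta> = None" if d: "factor_thru T G H \<alpha> \<gamma> = Some \<delta>" for \<delta>
  proof (rule ccontr)
    assume "factor_thru T H L \<beta> \<delta> \<noteq> None"
    then obtain \<epsilon> where "factor_thru T H L \<beta> \<delta> = Some \<epsilon>" by auto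
    note e = factor_thru_SomeD[OF this] factor_thru_SomeD[OF d]
    have "comp_class G \<epsilon> (comp_class G \<beta> \<alpha>) = \<gamma>"
      using comp_assoc[OF assms(2,3,4,1,5,6) e(1)] e by simp
    then show False using factor_thru_NoneD[OF None e(1)] by simp
  qed
  then show ?thesis using None by (cases "factor_thru T G H \<alpha> \<gamma>") auto
next
  case (Some \<epsilon>)
  note e = factor_thru_SomeD[OF Some]
  have c: "comp_class H \<epsilon> \<beta> \<in> Hom H T" using assms e by (intro comp_Hom[of H L T])
  have "\<gamma> = comp_class G (comp_class H \<epsilon> \<beta>) \<alpha>"
    using comp_assoc[OF assms(2,3,4,1,5,6) e(1)] e by simp
  then show ?thesis
    using Some factor_thru_Some[OF assms(1,2,3,5) c] factor_thru_Some[OF assms(1,3,4,6) e(1)] by simp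
qed

end

text \<open>Spanning is expressed through subspaces, so it can be proved and used without linear
  combinations. For a functor, the existence of such a set is equivalent to
  \<open>finitely_generated\<close>, by two lemmas of the next locale.\<close>

definition generates ::
    "'k ring \<Rightarrow> nat monoid set \<Rightarrow> ('k, 'v) functor_data \<Rightarrow> (nat monoid \<times> 'v) set \<Rightarrow> bool" where
  "generates K U X \<Gamma> \<longleftrightarrow> finite \<Gamma> \<and> (\<forall>(G, x)\<in>\<Gamma>. G \<in> U \<and> x \<in> carrier (obj X G)) \<and>
     (\<forall>W\<in>U. \<forall>N. subspace K N (obj X W) \<longrightarrow> (\<forall>(G, x)\<in>\<Gamma>. \<forall>\<alpha>\<in>Hom W G. arr X W G \<alpha> x \<in> N)
       \<longrightarrow> carrier (obj X W) \<subseteq> N)"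

lemma generatesI:
  assumes "finite \<Gamma>" "\<And>G x. (G, x) \<in> \<Gamma> \<Longrightarrow> G \<in> U \<and> x \<in> carrier (obj X G)"
    and "\<And>W N. W \<in> U \<Longrightarrow> subspace K N (obj X W) \<Longrightarrow>
      (\<And>G x \<alpha>. (G, x) \<in> \<Gamma> \<Longrightarrow> \<alpha> \<in> Hom W G \<Longrightarrow> arr X W G \<alpha> x \<in> N) \<Longrightarrow> carrier (obj X W) \<subseteq> N"
  shows "generates K U X \<Gamma>"
  using assms unfolding generates_def by blast

lemma generatesD:
  assumes "generates K U X \<Gamma>" "W \<in> U" "subspace K N (obj X W)"
    and "\<And>G x \<alpha>. (G, x) \<in> \<Gamma> \<Longrightarrow> \<alpha> \<in> Hom W G \<Longrightarrow> arr X W G \<alpha> x \<in> N"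
  shows "carrier (obj X W) \<subseteq> N"
  using assms unfolding generates_def by blast

lemma generates_closed:
  "generates K U X \<Gamma> \<Longrightarrow> (G, x) \<in> \<Gamma> \<Longrightarrow> G \<in> U \<and> x \<in> carrier (obj X G)"
  unfolding generates_def by blast

section \<open>Generators and the Yoneda lemma\<close>

locale field_level_category = level_category U lev R + K: Ring.field K
  for U lev R and K :: "'k ring"
begin

lemma obj_e_functor: "obj (e_functor K T) G = prod_module (Hom G T) (\<lambda>_. scalar_module K)"
  by (simp add: e_functor_def func_space_eq[OF K.ring_axioms])

lemma arr_e_functor:
  assumes T: "T \<in> U" "G \<in> U" "H \<in> U" "\<alpha> \<in> Hom G H" and c: "c \<in> carrier (obj (e_functor K T) H)"
  shows "arr (e_functor K T) G H \<alpha> c =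
    (\<lambda>\<gamma>\<in>Hom G T. case factor_thru T G H \<alpha> \<gamma> of None \<Rightarrow> \<zero>\<^bsub>K\<^esub> | Some \<beta> \<Rightarrow> c \<beta>)"
proof -
  have "(\<Oplus>\<^bsub>K\<^esub>\<beta>\<in>{\<beta> \<in> Hom H T. comp_class G \<beta> \<alpha> = \<gamma>}. c \<beta>) =
    (case factor_thru T G H \<alpha> \<gamma> of None \<Rightarrow> \<zero>\<^bsub>K\<^esub> | Some \<beta> \<Rightarrow> c \<beta>)" for \<gamma>
  proof (cases "factor_thru T G H \<alpha> \<gamma>")
    case None
    then have eq: "{\<beta> \<in> Hom H T. comp_class G \<beta> \<alpha> = \<gamma>} = {}" using factor_thru_NoneD by blast
    show ?thesis unfolding eq None by simp
  next
    case (Some \<beta>)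
    note b = factor_thru_SomeD[OF Some]
    then have eq: "{\<beta> \<in> Hom H T. comp_class G \<beta> \<alpha> = \<gamma>} = {\<beta>}"
      using comp_cancel[OF T(2,3,1,4)] by blast
    show ?thesis unfolding eq Some using b c by (auto simp: obj_e_functor PiE_iff)
  qed
  then show ?thesis by (simp add: e_functor_def)
qed

lemma arr_e_functor_single:
  assumes T: "T \<in> U" "G \<in> U" "H \<in> U" "\<alpha> \<in> Hom G H" and b: "\<beta> \<in> Hom H T" "a \<in> carrier K"
  shows "arr (e_functor K T) G H \<alpha> (single (Hom H T) (\<lambda>_. scalar_module K) \<beta> a)
    = single (Hom G T) (\<lambda>_. scalar_module K) (comp_class G \<beta> \<alpha>) a" (is "?l = ?r")
proof -
  have "?l = (\<lambda>\<gamma>\<in>Hom G T. case factor_thru T G H \<alpha> \<gamma> of None \<Rightarrow> \<zero>\<^bsub>K\<^esub>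
      | Some \<beta>' \<Rightarrow> single (Hom H T) (\<lambda>_. scalar_module K) \<beta> a \<beta>')"
    using b by (intro arr_e_functor[OF T]) (auto simp: obj_e_functor single_def)
  also have "\<dots> = ?r"
  proof (rule ext)
    fix \<gamma>
    show "(\<lambda>\<gamma>\<in>Hom G T. case factor_thru T G H \<alpha> \<gamma> of None \<Rightarrow> \<zero>\<^bsub>K\<^esub>
      | Some \<beta>' \<Rightarrow> single (Hom H T) (\<lambda>_. scalar_module K) \<beta> a \<beta>') \<gamma> = ?r \<gamma>"
    proof (cases "factor_thru T G H \<alpha> \<gamma>")
      case None
      then show ?thesis using factor_thru_NoneD[OF None b(1)] by (auto simp: single_def)
    next
      case (Some \<beta>')
      have "\<beta>' = \<beta> \<longleftrightarrow> \<gamma> = comp_class G \<beta> \<alpha>"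
        using factor_thru_SomeD(2)[OF Some] factor_thru_Some[OF T b(1)] Some by (metis option.inject)
      then show ?thesis using Some factor_thru_SomeD(1)[OF Some] by (simp add: single_def)
    qed
  qed
  finally show ?thesis .
qed

lemma module_obj_e_functor: "Module.module K (obj (e_functor K T) G)"
  unfolding obj_e_functor
  by (intro module_prod_module module_scalar_module K.is_cring)

lemma obj_functor_sum:
  "obj (functor_sum n (\<lambda>i. e_functor K (Gs i))) W = prod_module {..<n} (\<lambda>i. obj (e_functor K (Gs i)) W)"
  by (simp add: functor_sum_def module_sum_eq)

text \<open>The generators are the images of the identities, the universal elements of the summands:
  the basis vector \<beta> of a summand is the pullback of the identity along \<beta>
  itself.\<close>

lemma generates_of_finitely_generated:
  assumes X: "is_functor K U X" and fg: "finitely_generated K U X"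
  obtains \<Gamma> where "generates K U X \<Gamma>"
proof -
  obtain n Gs \<phi> where Gs: "\<forall>i<n. Gs i \<in> U"
    and epi: "epimorphism K U (functor_sum n (\<lambda>i. e_functor K (Gs i))) X \<phi>"
    using fg by (auto simp: finitely_generated_def)
  define S where "S = functor_sum n (\<lambda>i. e_functor K (Gs i))"
  have nt: "nat_trans K U S X \<phi>" using epi by (simp add: epimorphism_def S_def)
  define e where "e W i \<beta> = single {..<n} (\<lambda>i. obj (e_functor K (Gs i)) W) i
     (single (Hom W (Gs i)) (\<lambda>_. scalar_module K) \<beta> \<one>\<^bsub>K\<^esub>)" for W i \<beta>
  have obj_S: "obj S W = prod_module {..<n} (\<lambda>i. obj (e_functor K (Gs i)) W)" for W
    by (simp add: S_def obj_functor_sum)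
  have mod_S: "Module.module K (obj S W)" for W
    unfolding obj_S by (intro module_prod_module module_obj_e_functor K.is_cring)
  have e1: "single (Hom W (Gs i)) (\<lambda>_. scalar_module K) \<beta> a \<in> carrier (obj (e_functor K (Gs i)) W)"
    if "a \<in> carrier K" for W i \<beta> a
    unfolding obj_e_functor using that by (intro single_closed[where K = K] module_scalar_module K.is_cring) auto
  have e_closed: "e W i \<beta> \<in> carrier (obj S W)" for W i \<beta>
    unfolding obj_S e_def by (intro single_closed[where K = K] module_obj_e_functor e1) auto
  define \<Gamma> where "\<Gamma> = (\<lambda>i. (Gs i, \<phi> (Gs i) (e (Gs i) i (id_class (Gs i))))) ` {..<n}"
  have "generates K U X \<Gamma>"
  proof (rule generatesI)
    show "finite \<Gamma>" by (simp add: \<Gamma>_def)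
    show "G \<in> U \<and> x \<in> carrier (obj X G)" if "(G, x) \<in> \<Gamma>" for G x
      using that Gs lin_closed[OF nat_trans_lin[OF nt] e_closed] by (auto simp: \<Gamma>_def)
  next
    fix W N assume W: "W \<in> U" and N: "subspace K N (obj X W)"
      and *: "\<And>G x \<alpha>. (G, x) \<in> \<Gamma> \<Longrightarrow> \<alpha> \<in> Hom W G \<Longrightarrow> arr X W G \<alpha> x \<in> N"
    interpret N: LinearCombinations.submodule K N "obj X W" by (rule N)
    note l = nat_trans_lin[OF nt W]
    have e_in: "\<phi> W (e W i \<beta>) \<in> N" if i: "i < n" and b: "\<beta> \<in> Hom W (Gs i)" for i \<beta>
    proof -
      have GU: "Gs i \<in> U" using Gs i by auto
      \<comment> \<open>The other components are zero and have to stay zero under the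
        pullback.\<close>
      have z: "arr (e_functor K (Gs j)) W (Gs i) \<beta> \<zero>\<^bsub>obj (e_functor K (Gs j)) (Gs i)\<^esub>
        = \<zero>\<^bsub>obj (e_functor K (Gs j)) W\<^esub>" if "j < n" for j
        using Gs that W GU b arr_e_functor[of "Gs j" W "Gs i" \<beta> "\<zero>\<^bsub>obj (e_functor K (Gs j)) (Gs i)\<^esub>"]
        by (auto simp: obj_e_functor fun_eq_iff dest: factor_thru_SomeD split: option.split)
      have "arr S W (Gs i) \<beta> (e (Gs i) i (id_class (Gs i))) = e W i \<beta>"
        using arr_e_functor_single[OF GU W GU b id_Hom[OF GU] K.one_closed] comp_id_left[OF W GU b] z i
        by (auto simp: S_def functor_sum_def e_def single_def fun_eq_iff)
      moreover have "arr X W (Gs i) \<beta> (\<phi> (Gs i) (e (Gs i) i (id_class (Gs i)))) \<in> N"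
        by (rule *[OF _ b]) (use i in \<open>auto simp: \<Gamma>_def\<close>)
      ultimately show ?thesis
        using nat_trans_natural[OF nt W GU b e_closed[of "Gs i" i "id_class (Gs i)"]] by simp
    qed
    have add: "\<phi> W (x \<oplus>\<^bsub>obj S W\<^esub> y) \<in> N" if "x \<in> carrier (obj S W)" "y \<in> carrier (obj S W)"
      "\<phi> W x \<in> N" "\<phi> W y \<in> N" for x y
      unfolding lin_add[OF l that(1,2)] using that by auto
    have zero: "\<phi> W \<zero>\<^bsub>obj S W\<^esub> \<in> N"
      unfolding lin_zero[OF mod_S functor_module[OF X W] l] by simp
    have "\<phi> W v \<in> N" if v: "v \<in> carrier (obj S W)" for v
      unfolding obj_S
    \<comment> \<open>Outer induction over the summands, inner induction over the morphisms that
      form the basis of one summand.\<close>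
    proof (rule prod_module_induct[OF _ _ v[unfolded obj_S], of K "\<lambda>v. \<phi> W v \<in> N"])
      fix i m assume i: "i \<in> {..<n}" and m: "m \<in> carrier (obj (e_functor K (Gs i)) W)"
      let ?s = "single {..<n} (\<lambda>i. obj (e_functor K (Gs i)) W) i"
      show "\<phi> W (?s m) \<in> N"
      proof (rule prod_module_induct[OF _ _ m[unfolded obj_e_functor], of K "\<lambda>m. \<phi> W (?s m) \<in> N"])
        show "finite (Hom W (Gs i))" using finite_Hom W Gs i by auto
        show "Module.module K (scalar_module K)" by (intro module_scalar_module K.is_cring)
        have "?s \<zero>\<^bsub>obj (e_functor K (Gs i)) W\<^esub> = \<zero>\<^bsub>obj S W\<^esub>"
          by (auto simp: single_def obj_S)
        then show "\<phi> W (?s \<zero>\<^bsub>prod_module (Hom W (Gs i)) (\<lambda>_. scalar_module K)\<^esub>) \<in> N"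
          using zero by (simp only: obj_e_functor)
        fix x y assume xy: "x \<in> carrier (prod_module (Hom W (Gs i)) (\<lambda>_. scalar_module K))"
          "y \<in> carrier (prod_module (Hom W (Gs i)) (\<lambda>_. scalar_module K))"
          "\<phi> W (?s x) \<in> N" "\<phi> W (?s y) \<in> N"
        have c: "?s x \<in> carrier (obj S W)" "?s y \<in> carrier (obj S W)"
          unfolding obj_S
          by (rule single_closed[where K = K], rule module_obj_e_functor, rule xy(1)[folded obj_e_functor])
            (rule single_closed[where K = K], rule module_obj_e_functor, rule xy(2)[folded obj_e_functor])
        have "?s (x \<oplus>\<^bsub>obj (e_functor K (Gs i)) W\<^esub> y) = ?s x \<oplus>\<^bsub>obj S W\<^esub> ?s y"
          by (auto simp: single_def obj_S fun_eq_iff obj_e_functor)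
        then show "\<phi> W (?s (x \<oplus>\<^bsub>prod_module (Hom W (Gs i)) (\<lambda>_. scalar_module K)\<^esub> y)) \<in> N"
          using add[OF c xy(3,4)] by (simp only: obj_e_functor)
      next
        fix \<beta> a assume b: "\<beta> \<in> Hom W (Gs i)" "a \<in> carrier (scalar_module K)"
        have "?s (single (Hom W (Gs i)) (\<lambda>_. scalar_module K) \<beta> a) = a \<odot>\<^bsub>obj S W\<^esub> e W i \<beta>"
          using b by (auto simp: single_def obj_S fun_eq_iff obj_e_functor e_def)
        then show "\<phi> W (?s (single (Hom W (Gs i)) (\<lambda>_. scalar_module K) \<beta> a)) \<in> N"
          using b e_in[of i \<beta>] i by (simp add: lin_smult[OF l _ e_closed])
      qed
    qed (use add zero in \<open>auto simp only: obj_S[symmetric] intro: module_obj_e_functor\<close>)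
    moreover have "\<phi> W ` carrier (obj S W) = carrier (obj X W)"
      using epi W by (simp add: epimorphism_def S_def)
    ultimately show "carrier (obj X W) \<subseteq> N" by (metis imageE subsetI)
  qed
  then show thesis by (rule that)
qed

text \<open>By the Yoneda lemma each generator corresponds to a map from some \<open>e_G\<close>.\<close>

lemma finitely_generated_of_generates:
  assumes X: "is_functor K U X" and gen: "generates K U X \<Gamma>"
  shows "finitely_generated K U X"
proof -
  obtain n :: nat and g where g: "\<Gamma> = g ` {i. i < n}"
    using gen unfolding generates_def finite_conv_nat_seg_image by blast
  define Gs where "Gs i = fst (g i)" for i
  define x where "x i = snd (g i)" for i
  have GsU: "Gs i \<in> U" and xc: "x i \<in> carrier (obj X (Gs i))" if "i < n" for i
    using that gen by (auto simp: generates_def g Gs_def x_def split_beta)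
  define S where "S = functor_sum n (\<lambda>i. e_functor K (Gs i))"
  have obj_S: "obj S W = prod_module {..<n} (\<lambda>i. obj (e_functor K (Gs i)) W)" for W
    by (simp add: S_def obj_functor_sum)
  have mod_S: "Module.module K (obj S W)" for W
    unfolding obj_S by (intro module_prod_module module_obj_e_functor K.is_cring)
  \<comment> \<open>The pairs (i, \<beta>) index the basis of S at W, and \<open>t\<close> is the
    contribution of one basis vector to the Yoneda map.\<close>
  define A where "A W = Sigma {..<n} (\<lambda>i. Hom W (Gs i))" for W
  define t where "t W v p = v (fst p) (snd p) \<odot>\<^bsub>obj X W\<^esub> arr X W (Gs (fst p)) (snd p) (x (fst p))"
    for W v p
  define \<phi> where "\<phi> W v = finsum (obj X W) (t W v) (A W)" for W v
  have fin: "finite (A W)" if "W \<in> U" for W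
    unfolding A_def using that GsU finite_Hom by auto
  have coeff: "v i \<beta> \<in> carrier K" if "v \<in> carrier (obj S W)" "i < n" "\<beta> \<in> Hom W (Gs i)" for W v i \<beta>
    using that by (auto simp: obj_S obj_e_functor PiE_iff)
  have pull: "arr X W (Gs i) \<beta> (x i) \<in> carrier (obj X W)" if "W \<in> U" "i < n" "\<beta> \<in> Hom W (Gs i)" for W i \<beta>
    using that GsU xc by (intro functor_arr_closed[OF X])
  have t_closed: "t W v p \<in> carrier (obj X W)" if "W \<in> U" "v \<in> carrier (obj S W)" "p \<in> A W" for W v p
    using that coeff pull by (auto simp: t_def A_def intro!: module.smult_closed[OF functor_module[OF X]])
  have \<phi>_lin: "\<phi> W \<in> lin K (obj S W) (obj X W)" if W: "W \<in> U" for W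
  proof -
    interpret M: Module.module K "obj X W" by (rule functor_module[OF X W])
    show ?thesis
    proof (rule linI)
      fix u v assume u: "u \<in> carrier (obj S W)" and v: "v \<in> carrier (obj S W)"
      show "\<phi> W u \<in> carrier (obj X W)"
        unfolding \<phi>_def using u W t_closed by (intro M.finsum_closed) auto
      have "\<phi> W (u \<oplus>\<^bsub>obj S W\<^esub> v) = finsum (obj X W) (\<lambda>p. t W u p \<oplus>\<^bsub>obj X W\<^esub> t W v p) (A W)"
        unfolding \<phi>_def
      proof (rule M.finsum_cong')
        fix p assume p: "p \<in> A W"
        then show "t W (u \<oplus>\<^bsub>obj S W\<^esub> v) p = t W u p \<oplus>\<^bsub>obj X W\<^esub> t W v p"
          using coeff[OF u] coeff[OF v] pull[OF W]
          by (auto simp: t_def A_def obj_S obj_e_functor M.smult_l_distr)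
      qed (use u v W t_closed in auto)
      also have "\<dots> = \<phi> W u \<oplus>\<^bsub>obj X W\<^esub> \<phi> W v"
        unfolding \<phi>_def using u v W t_closed by (intro M.finsum_addf) auto
      finally show "\<phi> W (u \<oplus>\<^bsub>obj S W\<^esub> v) = \<phi> W u \<oplus>\<^bsub>obj X W\<^esub> \<phi> W v" .
    next
      fix a v assume a: "a \<in> carrier K" and v: "v \<in> carrier (obj S W)"
      have "\<phi> W (a \<odot>\<^bsub>obj S W\<^esub> v) = finsum (obj X W) (\<lambda>p. a \<odot>\<^bsub>obj X W\<^esub> t W v p) (A W)"
        unfolding \<phi>_def
      proof (rule M.finsum_cong')
        fix p assume p: "p \<in> A W"
        then show "t W (a \<odot>\<^bsub>obj S W\<^esub> v) p = a \<odot>\<^bsub>obj X W\<^esub> t W v p"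
          using coeff[OF v] pull[OF W] a
          by (auto simp: t_def A_def obj_S obj_e_functor M.smult_assoc1)
      qed (use a v W t_closed in auto)
      also have "\<dots> = a \<odot>\<^bsub>obj X W\<^esub> \<phi> W v"
        unfolding \<phi>_def using a v W t_closed fin by (intro M.finsum_smult_ldistr[symmetric]) auto
      finally show "\<phi> W (a \<odot>\<^bsub>obj S W\<^esub> v) = a \<odot>\<^bsub>obj X W\<^esub> \<phi> W v" .
    qed
  qed
  have nt: "nat_trans K U S X \<phi>"
    unfolding nat_trans_def
  proof (intro conjI ballI)
    show "\<phi> W \<in> lin K (obj S W) (obj X W)" if "W \<in> U" for W using that by (rule \<phi>_lin)
    fix W W' \<alpha> v assume W: "W \<in> U" "W' \<in> U" "\<alpha> \<in> Hom W W'" and v: "v \<in> carrier (obj S W')"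
    interpret M: Module.module K "obj X W" by (rule functor_module[OF X W(1)])
    interpret M': Module.module K "obj X W'" by (rule functor_module[OF X W(2)])
    define u where "u = arr S W W' \<alpha> v"
    have vi: "v i \<in> carrier (obj (e_functor K (Gs i)) W')" if "i < n" for i
      using v that by (auto simp: obj_S PiE_iff)
    have u: "u i \<gamma> = (case factor_thru (Gs i) W W' \<alpha> \<gamma> of None \<Rightarrow> \<zero>\<^bsub>K\<^esub> | Some \<beta> \<Rightarrow> v i \<beta>)"
      if "i < n" "\<gamma> \<in> Hom W (Gs i)" for i \<gamma>
      using that arr_e_functor[OF GsU[OF that(1)] W vi[OF that(1)]]
      by (simp add: u_def S_def functor_sum_def)
    have uc: "u \<in> carrier (obj S W)"
    proof -
      have "u i \<in> carrier (obj (e_functor K (Gs i)) W)" if i: "i < n" for i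
        unfolding obj_e_functor prod_module_simps
      proof (rule PiE_I)
        show "u i \<gamma> \<in> carrier (scalar_module K)" if "\<gamma> \<in> Hom W (Gs i)" for \<gamma>
          using u[OF i that] coeff[OF v i] factor_thru_SomeD(1)[of "Gs i" W W' \<alpha> \<gamma>]
          by (cases "factor_thru (Gs i) W W' \<alpha> \<gamma>") auto
        show "u i \<gamma> = undefined" if "\<gamma> \<notin> Hom W (Gs i)" for \<gamma>
          using i that arr_e_functor[OF GsU[OF i] W vi[OF i]] by (simp add: u_def S_def functor_sum_def)
      qed
      then show ?thesis
        unfolding obj_S prod_module_simps
        by (intro PiE_I) (auto simp: u_def S_def functor_sum_def)
    qed
    \<comment> \<open>The injection of bases induced by pulling back along \<alpha>. Coordinates of
      the pullback outside its image are 0, so the sum over the basis at W collapses to a sum over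
      the basis at W'.\<close>
    define h where "h p = (fst p, comp_class W (snd p) \<alpha>)" for p :: "nat \<times> (nat \<Rightarrow> nat) set"
    have inj: "inj_on h (A W')"
      using comp_cancel[OF W(1,2) GsU W(3)] by (auto simp: inj_on_def h_def A_def)
    have "\<phi> W u = finsum (obj X W) (\<lambda>p. t W u (h p)) (A W')"
      unfolding \<phi>_def
    proof (rule M.finsum_reindex_neutral[OF fin[OF W(1)] inj])
      show "h ` A W' \<subseteq> A W" using W GsU by (auto simp: h_def A_def intro: comp_Hom[of W W'])
      show "t W u p \<in> carrier (obj X W)" if "p \<in> A W" for p using t_closed[OF W(1) uc that] .
      fix p assume p: "p \<in> A W" "p \<notin> h ` A W'"
      obtain i \<gamma> where ig: "p = (i, \<gamma>)" "i < n" "\<gamma> \<in> Hom W (Gs i)" using p(1) by (auto simp: A_def)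
      have "factor_thru (Gs i) W W' \<alpha> \<gamma> = None"
      proof (rule ccontr)
        assume "factor_thru (Gs i) W W' \<alpha> \<gamma> \<noteq> None"
        then obtain \<beta> where "factor_thru (Gs i) W W' \<alpha> \<gamma> = Some \<beta>" by auto
        note b = factor_thru_SomeD[OF this]
        then have "p = h (i, \<beta>)" "(i, \<beta>) \<in> A W'" using ig by (auto simp: h_def A_def)
        then show False using p(2) by blast
      qed
      then show "t W u p = \<zero>\<^bsub>obj X W\<^esub>" using u ig pull W by (simp add: t_def)
    qed
    also have "\<dots> = finsum (obj X W) (\<lambda>p. arr X W W' \<alpha> (t W' v p)) (A W')"
    proof (rule M.finsum_cong')
      show "(\<lambda>p. arr X W W' \<alpha> (t W' v p)) \<in> A W' \<rightarrow> carrier (obj X W)"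
        using functor_arr_closed[OF X W t_closed[OF W(2) v]] by auto
      fix p assume "p \<in> A W'"
      then obtain i \<beta> where ib: "p = (i, \<beta>)" "i < n" "\<beta> \<in> Hom W' (Gs i)" by (auto simp: A_def)
      note G = GsU[OF ib(2)]
      have "u i (comp_class W \<beta> \<alpha>) = v i \<beta>"
        using u[OF ib(2) comp_Hom[OF W(1,2) G W(3) ib(3)]] factor_thru_Some[OF G W ib(3)] by simp
      then show "t W u (h p) = arr X W W' \<alpha> (t W' v p)"
        using ib functor_comp[OF X W(1,2) G W(3) ib(3) xc[OF ib(2)]]
          lin_smult[OF functor_arr[OF X W] coeff[OF v ib(2,3)] pull[OF W(2) ib(2,3)]]
        by (simp add: t_def h_def)
    qed simp
    also have "\<dots> = arr X W W' \<alpha> (\<phi> W' v)"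
      unfolding \<phi>_def
      by (rule lin_finsum[symmetric, OF functor_module[OF X W(2)] functor_module[OF X W(1)] functor_arr[OF X W]
            fin[OF W(2)] t_closed[OF W(2) v]])
    finally show "\<phi> W (arr S W W' \<alpha> v) = arr X W W' \<alpha> (\<phi> W' v)" by (simp add: u_def)
  qed
  have surj: "\<phi> W ` carrier (obj S W) = carrier (obj X W)" if W: "W \<in> U" for W
  proof
    interpret M: Module.module K "obj X W" by (rule functor_module[OF X W])
    interpret h: mod_hom K "obj S W" "obj X W" "\<phi> W"
      using mod_S functor_module[OF X W] \<phi>_lin[OF W] by (simp add: mod_hom_def mod_hom_axioms_def)
    show "\<phi> W ` carrier (obj S W) \<subseteq> carrier (obj X W)" using lin_closed[OF \<phi>_lin[OF W]] by auto
    have sub: "subspace K (\<phi> W ` carrier (obj S W)) (obj X W)"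
      using h.im_is_submodule by (simp add: h.im_def)
    \<comment> \<open>The image is a subspace, so it suffices that it contains the pullbacks of the
      generators; each is the value at a basis vector.\<close>
    have "arr X W G \<beta> y \<in> \<phi> W ` carrier (obj S W)" if "(G, y) \<in> \<Gamma>" and b: "\<beta> \<in> Hom W G" for G y \<beta>
    proof -
      obtain i where i: "i < n" "(G, y) = g i" using \<open>(G, y) \<in> \<Gamma>\<close> by (auto simp: g)
      then have Gy: "Gs i = G" "x i = y" by (auto simp: Gs_def x_def dest: sym)
      define e where "e = single {..<n} (\<lambda>i. obj (e_functor K (Gs i)) W) i
        (single (Hom W (Gs i)) (\<lambda>_. scalar_module K) \<beta> \<one>\<^bsub>K\<^esub>)"
      have ec: "e \<in> carrier (obj S W)"
        unfolding e_def obj_S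
        by (intro single_closed[where K = K] module_obj_e_functor)
          (auto simp only: obj_e_functor intro!: single_closed[where K = K] module_scalar_module K.is_cring, simp)
      have "\<phi> W e = t W e (i, \<beta>)"
        unfolding \<phi>_def
      proof (rule M.finsum_single[OF fin[OF W]])
        show "(i, \<beta>) \<in> A W" using i b Gy by (auto simp: A_def)
        then show "t W e (i, \<beta>) \<in> carrier (obj X W)" by (rule t_closed[OF W ec])
        fix p assume "p \<in> A W" "p \<noteq> (i, \<beta>)"
        then show "t W e p = \<zero>\<^bsub>obj X W\<^esub>"
          using pull[OF W] by (auto simp: t_def e_def single_def A_def obj_e_functor)
      qed
      also have "\<dots> = arr X W G \<beta> y"
        using i b Gy pull[OF W i(1), of \<beta>] by (simp add: t_def e_def single_def)
      finally show ?thesis using ec by (metis imageI)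
    qed
    then show "carrier (obj X W) \<subseteq> \<phi> W ` carrier (obj S W)"
      by (rule generatesD[OF gen W sub])
  qed
  have "epimorphism K U S X \<phi>" using nt surj by (simp add: epimorphism_def)
  then show ?thesis using GsU unfolding finitely_generated_def S_def by blast
qed

end

section \<open>Serre subcategories\<close>

lemma is_subfunctor_zero:
  assumes X: "is_functor K U X"
  shows "is_subfunctor K U X (\<lambda>G. {\<zero>\<^bsub>obj X G\<^esub>})"
  unfolding is_subfunctor_def
proof (intro conjI ballI)
  fix G assume G: "G \<in> U"
  interpret M: Module.module K "obj X G" by (rule functor_module[OF X G])
  show "subspace K {\<zero>\<^bsub>obj X G\<^esub>} (obj X G)"
    by (rule submodule.intro[OF functor_module[OF X G]]) auto
  show "arr X G H \<alpha> v \<in> {\<zero>\<^bsub>obj X G\<^esub>}" if "H \<in> U" "\<alpha> \<in> Hom G H" "v \<in> {\<zero>\<^bsub>obj X H\<^esub>}" for H \<alpha> v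
    using that functor_arr_zero[OF X G] by simp
qed

lemma is_subfunctor_kernel:
  assumes X: "is_functor K U X" and Y: "is_functor K U Y" and \<psi>: "nat_trans K U X Y \<psi>"
  shows "is_subfunctor K U X (\<lambda>G. {v \<in> carrier (obj X G). \<psi> G v = \<zero>\<^bsub>obj Y G\<^esub>})"
  unfolding is_subfunctor_def
proof (intro conjI ballI)
  fix G assume G: "G \<in> U"
  interpret h: mod_hom K "obj X G" "obj Y G" "\<psi> G"
    using functor_module[OF X G] functor_module[OF Y G] nat_trans_lin[OF \<psi> G]
    by (simp add: mod_hom_def mod_hom_axioms_def)
  show "subspace K {v \<in> carrier (obj X G). \<psi> G v = \<zero>\<^bsub>obj Y G\<^esub>} (obj X G)"
    using h.ker_is_submodule by (simp add: h.ker_def)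
  fix H \<alpha> v assume H: "H \<in> U" "\<alpha> \<in> Hom G H" "v \<in> {v \<in> carrier (obj X H). \<psi> H v = \<zero>\<^bsub>obj Y H\<^esub>}"
  then show "arr X G H \<alpha> v \<in> {v \<in> carrier (obj X G). \<psi> G v = \<zero>\<^bsub>obj Y G\<^esub>}"
    using functor_arr_closed[OF X G H(1,2)] nat_trans_natural[OF \<psi> G H(1,2)]
      functor_arr_zero[OF Y G H(1,2)] by simp
qed

lemma is_subfunctor_image:
  assumes X: "is_functor K U X" and Y: "is_functor K U Y" and \<psi>: "nat_trans K U X Y \<psi>"
  shows "is_subfunctor K U Y (\<lambda>G. \<psi> G ` carrier (obj X G))"
  unfolding is_subfunctor_def
proof (intro conjI ballI)
  fix G assume G: "G \<in> U"
  interpret h: mod_hom K "obj X G" "obj Y G" "\<psi> G"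
    using functor_module[OF X G] functor_module[OF Y G] nat_trans_lin[OF \<psi> G]
    by (simp add: mod_hom_def mod_hom_axioms_def)
  show "subspace K (\<psi> G ` carrier (obj X G)) (obj Y G)"
    using h.im_is_submodule by (simp add: h.im_def)
  fix H \<alpha> v assume H: "H \<in> U" "\<alpha> \<in> Hom G H" "v \<in> \<psi> H ` carrier (obj X H)"
  then obtain u where u: "u \<in> carrier (obj X H)" "v = \<psi> H u" by auto
  show "arr Y G H \<alpha> v \<in> \<psi> G ` carrier (obj X G)"
    unfolding u(2) nat_trans_natural[OF \<psi> G H(1,2) u(1), symmetric]
    by (rule imageI[OF functor_arr_closed[OF X G H(1,2) u(1)]])
qed

lemma fg_functorsD: "X \<in> fg_functors K U \<Longrightarrow> is_functor K U X"
  by (simp add: fg_functors_def)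

lemma fg_functors_image:
  assumes "image_data K U X A \<phi> \<psi>" "finitely_generated K U X"
  shows "image_functor \<phi> \<psi> X \<in> fg_functors K U"
proof -
  interpret image_data K U X A \<phi> \<psi> by fact
  show ?thesis
    using is_functor finitely_generated_epimorphism[OF assms(2) epimorphism]
    by (simp add: fg_functors_def)
qed

lemma serre_exact:
  assumes "serre_subcategory K U D" "short_exact K U A \<phi> B \<psi> C"
    and "A \<in> fg_functors K U" "B \<in> fg_functors K U" "C \<in> fg_functors K U"
  shows "B \<in> D \<longleftrightarrow> A \<in> D \<and> C \<in> D"
  using assms unfolding serre_subcategory_def by blast

lemma serre_fg: "serre_subcategory K U D \<Longrightarrow> X \<in> D \<Longrightarrow> X \<in> fg_functors K U"
  unfolding serre_subcategory_def by blast

text \<open>The quotient of X by the image of Y is again finitely generated, so it completes a short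
  exact sequence within the category.\<close>

lemma serre_sub:
  assumes D: "serre_subcategory K U D" and X: "X \<in> D" and Y: "Y \<in> fg_functors K U"
    and \<phi>: "nat_trans K U Y X \<phi>" and inj: "\<And>G. G \<in> U \<Longrightarrow> inj_on (\<phi> G) (carrier (obj Y G))"
  shows "Y \<in> D"
proof -
  have X': "X \<in> fg_functors K U" by (rule serre_fg[OF D X])
  note fX = fg_functorsD[OF X'] and fY = fg_functorsD[OF Y]
  define A where "A G = \<phi> G ` carrier (obj Y G)" for G
  have A: "is_subfunctor K U X A"
    unfolding A_def by (rule is_subfunctor_image[OF fY fX \<phi>])
  interpret q: image_data K U X A "coset_rep X A" "\<lambda>G y. y"
    by (rule quotient_image_data[OF fX A])
  have "q.Y \<in> fg_functors K U"
    using X' by (intro fg_functors_image[OF q.image_data_axioms]) (simp add: fg_functors_def)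
  moreover have "short_exact K U Y \<phi> X (coset_rep X A) q.Y"
    unfolding short_exact_def
    using \<phi> inj q.nat_trans q.\<phi>_zero_iff subfunctor_subset[OF A] by (auto simp: A_def)
  ultimately show ?thesis using serre_exact[OF D _ Y X'] X by blast
qed

text \<open>Here the missing term of the sequence is the kernel, which does not inherit finite
  generation for formal reasons; hence the last assumption. For the augmentation it is discharged by
  an explicit generating set.\<close>

lemma serre_quotient:
  assumes D: "serre_subcategory K U D" and X: "X \<in> D" and Y: "Y \<in> fg_functors K U"
    and \<psi>: "nat_trans K U X Y \<psi>"
    and surj: "\<And>G. G \<in> U \<Longrightarrow> \<psi> G ` carrier (obj X G) = carrier (obj Y G)"
    and fg: "finitely_generated K U
      (sub_functor X (\<lambda>G. {v \<in> carrier (obj X G). \<psi> G v = \<zero>\<^bsub>obj Y G\<^esub>}))"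
  shows "Y \<in> D"
proof -
  have X': "X \<in> fg_functors K U" by (rule serre_fg[OF D X])
  note fX = fg_functorsD[OF X'] and fY = fg_functorsD[OF Y]
  define A where "A = (\<lambda>G. {v \<in> carrier (obj X G). \<psi> G v = \<zero>\<^bsub>obj Y G\<^esub>})"
  have A: "is_subfunctor K U X A"
    unfolding A_def by (rule is_subfunctor_kernel[OF fX fY \<psi>])
  have "sub_functor X A \<in> fg_functors K U"
    using fg is_functor_sub_functor[OF fX A] by (simp add: fg_functors_def A_def)
  moreover have "short_exact K U (sub_functor X A) (\<lambda>G v. v) X \<psi> Y"
    unfolding short_exact_def using \<psi> surj nat_trans_sub_functor[OF fX A] by (auto simp: A_def)
  ultimately show ?thesis using serre_exact[OF D _ _ X' Y] X by blast
qed

definition down_closed :: "nat set \<Rightarrow> bool" where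
  "down_closed S \<longleftrightarrow> (\<forall>n\<in>S. \<forall>m\<le>n. m \<in> S)"

section \<open>Index systems for sets of levels and for Hom sets\<close>

context level_category
begin

lemma Hom_R_ex: "W \<in> U \<Longrightarrow> n \<le> lev W \<Longrightarrow> \<exists>\<alpha>. \<alpha> \<in> Hom W (R n)"
  by (rule Hom_ex[OF _ R_in]) (simp_all add: lev_R)

definition interval_index :: "nat set \<Rightarrow> nat monoid \<Rightarrow> nat set" where
  "interval_index A G = (if lev G \<in> A then {0} else {})"

text \<open>Asking for the whole stretch of levels, and not only for its ends, makes composition
  work for every A: a gap in A kills all maps across it. So A may have gaps, as it does in the
  description of the open sets of the spectrum.\<close>

definition interval_map ::
    "nat set \<Rightarrow> nat monoid \<Rightarrow> nat monoid \<Rightarrow> (nat \<Rightarrow> nat) set \<Rightarrow> nat \<Rightarrow> nat option" where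
  "interval_map A G H \<alpha> j = (if {lev H..lev G} \<subseteq> A then Some 0 else None)"

lemma index_system_interval: "index_system U (interval_index A) (interval_map A)"
  unfolding index_system_def
proof (intro conjI ballI allI impI)
  fix G H L \<alpha> \<beta> j
  assume *: "G \<in> U" "H \<in> U" "L \<in> U" "\<alpha> \<in> Hom G H" "\<beta> \<in> Hom H L"
  then have "lev H \<le> lev G" "lev L \<le> lev H" using Hom_lev by blast+
  then have "{lev L..lev G} = {lev L..lev H} \<union> {lev H..lev G}" by auto
  then show "interval_map A G L (comp_class G \<beta> \<alpha>) j
      = Option.bind (interval_map A G H \<alpha> j) (interval_map A H L \<beta>)"
    by (auto simp: interval_map_def)
next
  fix G H \<alpha> j i assume *: "G \<in> U" "H \<in> U" "\<alpha> \<in> Hom G H" "interval_map A G H \<alpha> j = Some i"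
  then have "lev H \<le> lev G" using Hom_lev by blast
  then show "i \<in> interval_index A H"
    using * by (auto simp: interval_map_def interval_index_def split: if_splits)
qed (auto simp: interval_index_def interval_map_def split: if_splits)

text \<open>Morphism sets are numbered because the objects must take their values in
  \<open>nat \<Rightarrow> 'k\<close>.\<close>

definition code :: "nat monoid \<Rightarrow> nat monoid \<Rightarrow> (nat \<Rightarrow> nat) set \<Rightarrow> nat" where
  "code T G = to_nat_on (Hom G T)"

definition decode :: "nat monoid \<Rightarrow> nat monoid \<Rightarrow> nat \<Rightarrow> (nat \<Rightarrow> nat) set" where
  "decode T G = from_nat_into (Hom G T)"

lemma decode_code: "G \<in> U \<Longrightarrow> T \<in> U \<Longrightarrow> \<gamma> \<in> Hom G T \<Longrightarrow> decode T G (code T G \<gamma>) = \<gamma>"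
  by (simp add: code_def decode_def countable_finite finite_Hom)

lemma code_eq_iff:
  "G \<in> U \<Longrightarrow> T \<in> U \<Longrightarrow> \<gamma> \<in> Hom G T \<Longrightarrow> \<gamma>' \<in> Hom G T \<Longrightarrow> code T G \<gamma> = code T G \<gamma>' \<longleftrightarrow> \<gamma> = \<gamma>'"
  by (metis decode_code)

text \<open>The basis of \<open>e_T\<close>, cut off outside the levels in S. For an initial segment
  S the resulting functor is a quotient of \<open>e_T\<close>, because structure maps raise the
  level.\<close>

definition hom_index :: "nat set \<Rightarrow> nat monoid \<Rightarrow> nat monoid \<Rightarrow> nat set" where
  "hom_index S T G = (if lev G \<in> S then code T G ` Hom G T else {})"

definition hom_map ::
    "nat monoid \<Rightarrow> nat monoid \<Rightarrow> nat monoid \<Rightarrow> (nat \<Rightarrow> nat) set \<Rightarrow> nat \<Rightarrow> nat option" where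
  "hom_map T G H \<alpha> j = map_option (code T H) (factor_thru T G H \<alpha> (decode T G j))"

lemma index_system_hom:
  assumes T: "T \<in> U" and S: "down_closed S"
  shows "index_system U (hom_index S T) (hom_map T)"
  unfolding index_system_def
proof (intro conjI ballI allI impI)
  show "finite (hom_index S T G)" if "G \<in> U" for G
    using that T finite_Hom by (simp add: hom_index_def)
  show "hom_map T G G (id_class G) j = Some j" if "G \<in> U" "j \<in> hom_index S T G" for G j
    using that T by (auto simp: hom_map_def hom_index_def decode_code factor_thru_id split: if_splits)
  show "i \<in> hom_index S T H"
    if *: "G \<in> U" "H \<in> U" "\<alpha> \<in> Hom G H" "j \<in> hom_index S T G" "hom_map T G H \<alpha> j = Some i" for G H \<alpha> j i
  proof -
    have "lev G \<in> S" using *(4) by (simp add: hom_index_def split: if_splits)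
    then have "lev H \<in> S" using S Hom_lev[OF *(1-3)] by (auto simp: down_closed_def)
    then show ?thesis using * factor_thru_SomeD(1) by (auto simp: hom_map_def hom_index_def)
  qed
  show "hom_map T G L (comp_class G \<beta> \<alpha>) j = Option.bind (hom_map T G H \<alpha> j) (hom_map T H L \<beta>)"
    if *: "G \<in> U" "H \<in> U" "L \<in> U" "\<alpha> \<in> Hom G H" "\<beta> \<in> Hom H L" for G H L \<alpha> \<beta> j
  proof (cases "factor_thru T G H \<alpha> (decode T G j)")
    case None
    then show ?thesis using factor_thru_comp[OF T *] by (simp add: hom_map_def)
  next
    case (Some \<delta>)
    then show ?thesis
      using factor_thru_comp[OF T *] decode_code[OF *(2) T factor_thru_SomeD(1)[OF Some]]
      by (simp add: hom_map_def)
  qed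
qed

lemma hom_map_eq_Some_iff:
  assumes "T \<in> U" "G \<in> U" "H \<in> U" "\<alpha> \<in> Hom G H" "\<beta> \<in> Hom H T" "\<gamma> \<in> Hom G T"
  shows "hom_map T G H \<alpha> (code T G \<gamma>) = Some (code T H \<beta>) \<longleftrightarrow> \<gamma> = comp_class G \<beta> \<alpha>"
proof
  assume "hom_map T G H \<alpha> (code T G \<gamma>) = Some (code T H \<beta>)"
  then obtain \<beta>' where b: "factor_thru T G H \<alpha> \<gamma> = Some \<beta>'" "code T H \<beta>' = code T H \<beta>"
    using assms by (auto simp: hom_map_def decode_code)
  then have "\<beta>' = \<beta>" using factor_thru_SomeD(1)[OF b(1)] assms code_eq_iff by blast
  then show "\<gamma> = comp_class G \<beta> \<alpha>" using factor_thru_SomeD(2)[OF b(1)] by simp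
next
  assume "\<gamma> = comp_class G \<beta> \<alpha>"
  then show "hom_map T G H \<alpha> (code T G \<gamma>) = Some (code T H \<beta>)"
    using assms factor_thru_Some[OF assms(1-5)] by (simp add: hom_map_def decode_code)
qed

end

lemma copower_arr_single:
  assumes X: "is_functor K U X" and G: "G \<in> U" "H \<in> U" "\<alpha> \<in> Hom G H"
    and s: "\<And>j i'. j \<in> I G \<Longrightarrow> s G H \<alpha> j = Some i' \<Longrightarrow> i' \<in> I H"
    and j0: "\<And>j. j \<in> I G \<Longrightarrow> s G H \<alpha> j = Some i \<longleftrightarrow> j = j0"
  shows "arr (copower X I s) G H \<alpha> (single (I H) (\<lambda>_. obj X H) i m)
    = single (I G) (\<lambda>_. obj X G) j0 (arr X G H \<alpha> m)"
proof (rule ext)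
  fix j
  show "arr (copower X I s) G H \<alpha> (single (I H) (\<lambda>_. obj X H) i m) j
    = single (I G) (\<lambda>_. obj X G) j0 (arr X G H \<alpha> m) j"
    using j0[of j] s[of j] functor_arr_zero[OF X G]
    by (cases "s G H \<alpha> j") (auto simp: single_def)
qed

lemma free_subspace:
  assumes K: "cring K" and I: "finite I" and N: "subspace K N (prod_module I (\<lambda>_. scalar_module K))"
    and single: "\<And>i. i \<in> I \<Longrightarrow> single I (\<lambda>_. scalar_module K) i \<one>\<^bsub>K\<^esub> \<in> N"
  shows "carrier (prod_module I (\<lambda>_. scalar_module K)) \<subseteq> N"
proof
  interpret K: cring K by fact
  interpret N: LinearCombinations.submodule K N "prod_module I (\<lambda>_. scalar_module K)" by fact
  fix v assume v: "v \<in> carrier (prod_module I (\<lambda>_. scalar_module K))"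
  show "v \<in> N"
  proof (rule prod_module_induct[OF I _ v, of K "\<lambda>v. v \<in> N"])
    fix i a assume i: "i \<in> I" and a: "a \<in> carrier (scalar_module K)"
    have "single I (\<lambda>_. scalar_module K) i a
      = a \<odot>\<^bsub>prod_module I (\<lambda>_. scalar_module K)\<^esub> single I (\<lambda>_. scalar_module K) i \<one>\<^bsub>K\<^esub>"
      using a by (auto simp: single_def fun_eq_iff)
    then show "single I (\<lambda>_. scalar_module K) i a \<in> N"
      using N.smult_closed[OF _ single[OF i], of a] a by simp
  qed (use N.m_closed N.zero_closed module_scalar_module[OF K] in blast)+
qed

section \<open>Functors with value k on a set of levels\<close>

context field_level_category
begin

abbreviation free :: "(nat monoid \<Rightarrow> nat set)
      \<Rightarrow> (nat monoid \<Rightarrow> nat monoid \<Rightarrow> (nat \<Rightarrow> nat) set \<Rightarrow> nat \<Rightarrow> nat option)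
      \<Rightarrow> ('k, nat \<Rightarrow> 'k) functor_data" where
  "free \<equiv> copower (const_functor K)"

lemma is_functor_free: "index_system U I s \<Longrightarrow> is_functor K U (free I s)"
  by (rule is_functor_copower[OF is_functor_const_functor[OF K.is_cring]])

text \<open>\<open>ind UNIV\<close> is a copy of the tensor unit, \<open>ind {n}\<close> is
  concentrated at level n, and \<open>ind {}\<close> is zero.\<close>

definition ind :: "nat set \<Rightarrow> ('k, nat \<Rightarrow> 'k) functor_data" where
  "ind A = free (interval_index A) (interval_map A)"

definition tame :: "nat set \<Rightarrow> bool" where
  "tame A \<longleftrightarrow> finite A \<or> finite (- A)"

lemma tame_bound:
  assumes "tame A"
  obtains N where "{N..} \<subseteq> A \<or> {N..} \<inter> A = {}"
proof -
  from assms consider N where "\<forall>x\<in>A. x < N" | N where "\<forall>x\<in>-A. x < N"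
    unfolding tame_def finite_nat_set_iff_bounded by blast
  then show thesis
  proof cases
    case (1 N)
    then have "{N..} \<inter> A = {}" by fastforce
    then show thesis using that by blast
  next
    case (2 N)
    then have "{N..} \<subseteq> A" by (meson ComplI atLeast_iff leD subsetI)
    then show thesis using that by blast
  qed
qed

lemma is_functor_ind: "is_functor K U (ind A)"
  unfolding ind_def by (rule is_functor_free[OF index_system_interval])

lemma carrier_ind:
  "carrier (obj (ind A) G) = (\<Pi>\<^sub>E j\<in>interval_index A G. carrier K)"
  by (simp add: ind_def)

text \<open>Beyond some N the set A contains everything or nothing. In the first case an element
  above level N is pulled back from level N, with no gap in between; the levels of A up to N supply
  their own generators.\<close>

lemma ind_fg:
  assumes "tame A"
  shows "ind A \<in> fg_functors K U"
proof -
  obtain N where N: "{N..} \<subseteq> A \<or> {N..} \<inter> A = {}" using tame_bound[OF assms] .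
  define e where "e G = single (interval_index A G) (\<lambda>_. scalar_module K) 0 \<one>\<^bsub>K\<^esub>" for G
  have "generates K U (ind A) ((\<lambda>j. (R j, e (R j))) ` {..N})"
  proof (rule generatesI)
    fix G x assume "(G, x) \<in> (\<lambda>j. (R j, e (R j))) ` {..N}"
    then show "G \<in> U \<and> x \<in> carrier (obj (ind A) G)"
      using R_in by (auto simp: carrier_ind e_def single_def)
  next
    fix W V assume W: "W \<in> U" and V: "subspace K V (obj (ind A) W)"
      and gen: "\<And>G x \<alpha>. (G, x) \<in> (\<lambda>j. (R j, e (R j))) ` {..N} \<Longrightarrow> \<alpha> \<in> Hom W G \<Longrightarrow> arr (ind A) W G \<alpha> x \<in> V"
    have "carrier (prod_module (interval_index A W) (\<lambda>_. scalar_module K)) \<subseteq> V"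
    proof (rule free_subspace[OF K.is_cring])
      show "finite (interval_index A W)" by (simp add: interval_index_def)
      show "subspace K V (prod_module (interval_index A W) (\<lambda>_. scalar_module K))"
        using V by (simp add: ind_def)
      fix i assume i: "i \<in> interval_index A W"
      then have lW: "lev W \<in> A" "i = 0" by (auto simp: interval_index_def split: if_splits)
      define j where "j = min (lev W) N"
      have "lev W \<notin> {N..}" if "{N..} \<inter> A = {}" using that lW by blast
      then have "lev W \<le> N \<or> {N..} \<subseteq> A" using N by auto
      then have j: "j \<le> N" "j \<le> lev W" "{j..lev W} \<subseteq> A"
        using lW by (auto simp: j_def min_def split: if_splits)
      obtain \<alpha> where \<alpha>: "\<alpha> \<in> Hom W (R j)" using Hom_R_ex[OF W j(2)] by blast
      have "arr (ind A) W (R j) \<alpha> (e (R j)) = single (interval_index A W) (\<lambda>_. scalar_module K) 0 \<one>\<^bsub>K\<^esub>"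
        using j lW by (auto simp: ind_def e_def single_def interval_index_def interval_map_def lev_R fun_eq_iff)
      moreover have "arr (ind A) W (R j) \<alpha> (e (R j)) \<in> V" by (rule gen[OF _ \<alpha>]) (use j in auto)
      ultimately show "single (interval_index A W) (\<lambda>_. scalar_module K) i \<one>\<^bsub>K\<^esub> \<in> V"
        using lW by simp
    qed
    then show "carrier (obj (ind A) W) \<subseteq> V" by (simp add: ind_def)
  qed simp
  then show ?thesis
    using is_functor_ind finitely_generated_of_generates[OF is_functor_ind] by (simp add: fg_functors_def)
qed

text \<open>Structure maps only raise the level. What sits above all of B is therefore preserved by
  them and forms a subfunctor, with the lower part as quotient.\<close>

lemma ind_exact:
  assumes less: "\<And>a b. a \<in> A \<Longrightarrow> b \<in> B \<Longrightarrow> b < a"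
  shows "\<exists>\<phi> \<psi>. short_exact K U (ind A) \<phi> (ind (A \<union> B)) \<psi> (ind B)"
proof -
  define \<phi> :: "nat monoid \<Rightarrow> (nat \<Rightarrow> 'k) \<Rightarrow> nat \<Rightarrow> 'k"
    where "\<phi> G v = (\<lambda>j\<in>interval_index (A \<union> B) G. if lev G \<in> A then v j else \<zero>\<^bsub>K\<^esub>)" for G v
  define \<psi> :: "nat monoid \<Rightarrow> (nat \<Rightarrow> 'k) \<Rightarrow> nat \<Rightarrow> 'k"
    where "\<psi> G v = (\<lambda>j\<in>interval_index B G. v j)" for G v
  have disj: "n \<in> A \<Longrightarrow> n \<notin> B" for n using less by blast
  have 1: "nat_trans K U (ind A) (ind (A \<union> B)) \<phi>"
    unfolding nat_trans_def
  proof (intro conjI ballI)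
    fix G assume G: "G \<in> U"
    show "\<phi> G \<in> lin K (obj (ind A) G) (obj (ind (A \<union> B)) G)"
      by (rule linI) (auto simp: ind_def \<phi>_def interval_index_def fun_eq_iff)
    fix H \<alpha> v assume H: "H \<in> U" "\<alpha> \<in> Hom G H" "v \<in> carrier (obj (ind A) H)"
    have le: "lev H \<le> lev G" using G H Hom_lev by blast
    \<comment> \<open>A stretch of levels that starts in A cannot come back down to B.\<close>
    have "{lev H..lev G} \<subseteq> A \<union> B \<longleftrightarrow> {lev H..lev G} \<subseteq> A" if "lev H \<in> A"
      using less[OF that] by fastforce
    moreover have "lev H \<in> A" if "{lev H..lev G} \<subseteq> A" using that le by auto
    moreover have "lev H \<in> A \<union> B" if "{lev H..lev G} \<subseteq> A \<union> B" using that le by auto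
    ultimately show "\<phi> G (arr (ind A) G H \<alpha> v) = arr (ind (A \<union> B)) G H \<alpha> (\<phi> H v)"
      using le disj
      by (auto simp: ind_def \<phi>_def interval_index_def interval_map_def fun_eq_iff)
  qed
  have 2: "nat_trans K U (ind (A \<union> B)) (ind B) \<psi>"
    unfolding nat_trans_def
  proof (intro conjI ballI)
    fix G assume G: "G \<in> U"
    show "\<psi> G \<in> lin K (obj (ind (A \<union> B)) G) (obj (ind B) G)"
      by (rule linI) (auto simp: ind_def \<psi>_def interval_index_def fun_eq_iff)
    fix H \<alpha> v assume H: "H \<in> U" "\<alpha> \<in> Hom G H" "v \<in> carrier (obj (ind (A \<union> B)) H)"
    have le: "lev H \<le> lev G" using G H Hom_lev by blast
    have "{lev H..lev G} \<subseteq> A \<union> B \<longleftrightarrow> {lev H..lev G} \<subseteq> B" if "lev G \<in> B"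
      using less[OF _ that] by fastforce
    moreover have "lev H \<in> B" if "{lev H..lev G} \<subseteq> B" using that le by auto
    ultimately show "\<psi> G (arr (ind (A \<union> B)) G H \<alpha> v) = arr (ind B) G H \<alpha> (\<psi> H v)"
      by (auto simp: ind_def \<psi>_def interval_index_def interval_map_def fun_eq_iff)
  qed
  have 3: "inj_on (\<phi> G) (carrier (obj (ind A) G))" for G
  proof (rule inj_onI)
    fix x y assume x: "x \<in> carrier (obj (ind A) G)" and y: "y \<in> carrier (obj (ind A) G)"
      and eq: "\<phi> G x = \<phi> G y"
    show "x = y"
    proof (rule PiE_ext[OF x[unfolded carrier_ind] y[unfolded carrier_ind]])
      fix j assume "j \<in> interval_index A G"
      then show "x j = y j"
        using fun_cong[OF eq, of j] by (simp add: \<phi>_def interval_index_def split: if_splits)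
    qed
  qed
  have 4: "\<phi> G ` carrier (obj (ind A) G)
    = {b \<in> carrier (obj (ind (A \<union> B)) G). \<psi> G b = \<zero>\<^bsub>obj (ind B) G\<^esub>}" for G
  proof (cases "lev G \<in> A")
    case True
    then have "\<phi> G v = v" if "v \<in> carrier (obj (ind A) G)" for v
      using that by (auto simp: carrier_ind \<phi>_def interval_index_def PiE_iff fun_eq_iff extensional_def)
    then have "\<phi> G ` carrier (obj (ind A) G) = carrier (obj (ind A) G)" by simp
    then show ?thesis
      using True disj by (auto simp: ind_def interval_index_def \<psi>_def)
  next
    case False
    define z where "z = (\<lambda>j\<in>interval_index (A \<union> B) G. \<zero>\<^bsub>K\<^esub>)"
    \<comment> \<open>Over the empty index set the extensional functions form a single point, which
      is the zero space.\<close>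
    have "carrier (obj (ind A) G) = {\<lambda>_. undefined}"
      using False by (simp add: carrier_ind interval_index_def)
    moreover have "\<phi> G (\<lambda>_. undefined) = z" using False by (simp add: \<phi>_def z_def)
    moreover have "interval_index (A \<union> B) G = interval_index B G"
      using False by (simp add: interval_index_def)
    ultimately show ?thesis
      by (auto simp: ind_def \<psi>_def z_def PiE_restrict)
  qed
  have 5: "\<psi> G ` carrier (obj (ind (A \<union> B)) G) = carrier (obj (ind B) G)" for G
  proof (cases "lev G \<in> B")
    case True
    then have "\<psi> G v = v" if "v \<in> carrier (obj (ind (A \<union> B)) G)" for v
      using that by (auto simp: carrier_ind \<psi>_def interval_index_def PiE_iff fun_eq_iff extensional_def)
    then have "\<psi> G ` carrier (obj (ind (A \<union> B)) G) = carrier (obj (ind (A \<union> B)) G)" by simp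
    then show ?thesis using True by (simp add: carrier_ind interval_index_def)
  next
    case False
    then have "\<psi> G = (\<lambda>_ _. undefined)"
      by (simp add: \<psi>_def[abs_def] interval_index_def restrict_def)
    moreover have "carrier (obj (ind B) G) = {\<lambda>_. undefined}"
      using False by (simp add: interval_index_def carrier_ind)
    moreover have "(\<lambda>j\<in>interval_index (A \<union> B) G. \<zero>\<^bsub>K\<^esub>) \<in> carrier (obj (ind (A \<union> B)) G)"
      by (auto simp: carrier_ind)
    ultimately show ?thesis by (simp add: image_constant)
  qed
  show ?thesis using 1 2 3 4 5 unfolding short_exact_def by blast
qed

lemma ind_serre:
  assumes D: "serre_subcategory K U D" and tame: "tame A" "tame B" "tame (A \<union> B)"
    and less: "\<And>a b. a \<in> A \<Longrightarrow> b \<in> B \<Longrightarrow> b < a"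
  shows "ind (A \<union> B) \<in> D \<longleftrightarrow> ind A \<in> D \<and> ind B \<in> D"
proof -
  obtain \<phi> \<psi> where "short_exact K U (ind A) \<phi> (ind (A \<union> B)) \<psi> (ind B)"
    using ind_exact[OF less] by blast
  then show ?thesis using serre_exact[OF D] ind_fg tame by blast
qed

end

section \<open>Tensor products\<close>

lemma bilinear_map_left: "bilinear_map K M N T b \<Longrightarrow> x \<in> carrier M \<Longrightarrow> b x \<in> lin K N T"
  by (simp add: bilinear_map_def)

lemma bilinear_map_right: "bilinear_map K M N T b \<Longrightarrow> y \<in> carrier N \<Longrightarrow> (\<lambda>x. b x y) \<in> lin K M T"
  by (simp add: bilinear_map_def)

text \<open>A bilinear map with a zero factor vanishes, so the zero map is the only factorization to
  be found.\<close>

lemma tensor_product_zero: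
  assumes T: "Module.module K T" "carrier T = {\<zero>\<^bsub>T\<^esub>}"
    and M: "Module.module K M" and N: "Module.module K N"
    and zero: "carrier M = {\<zero>\<^bsub>M\<^esub>} \<or> carrier N = {\<zero>\<^bsub>N\<^esub>}"
  shows "tensor_product K M N T (\<lambda>_ _. \<zero>\<^bsub>T\<^esub>)"
  unfolding tensor_product_def
proof (intro conjI allI impI)
  interpret T: Module.module K T by fact
  show "Module.module K T" by fact
  show "bilinear_map K M N T (\<lambda>_ _. \<zero>\<^bsub>T\<^esub>)"
    by (auto simp: bilinear_map_def intro!: linI)
  fix W :: "('a, 'b) module" and c assume Wc: "Module.module K W \<and> bilinear_map K M N W c"
  then interpret W: Module.module K W by blast
  have c0: "c x y = \<zero>\<^bsub>W\<^esub>" if "x \<in> carrier M" "y \<in> carrier N" for x y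
    using zero
  proof
    assume "carrier M = {\<zero>\<^bsub>M\<^esub>}"
    then show ?thesis
      using that Wc lin_zero[OF M W.module_axioms bilinear_map_right[OF _ that(2)]] by auto
  next
    assume "carrier N = {\<zero>\<^bsub>N\<^esub>}"
    then show ?thesis
      using that Wc lin_zero[OF N W.module_axioms bilinear_map_left[OF _ that(1)]] by auto
  qed
  show "\<exists>!h. h \<in> lin K T W \<inter> extensional (carrier T) \<and>
    (\<forall>x\<in>carrier M. \<forall>y\<in>carrier N. h \<zero>\<^bsub>T\<^esub> = c x y)"
  proof (rule ex1I[of _ "\<lambda>t\<in>carrier T. \<zero>\<^bsub>W\<^esub>"])
    show "(\<lambda>t\<in>carrier T. \<zero>\<^bsub>W\<^esub>) \<in> lin K T W \<inter> extensional (carrier T) \<and>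
      (\<forall>x\<in>carrier M. \<forall>y\<in>carrier N. (\<lambda>t\<in>carrier T. \<zero>\<^bsub>W\<^esub>) \<zero>\<^bsub>T\<^esub> = c x y)"
      using c0 by (auto intro!: linI)
    fix h assume h: "h \<in> lin K T W \<inter> extensional (carrier T) \<and>
      (\<forall>x\<in>carrier M. \<forall>y\<in>carrier N. h \<zero>\<^bsub>T\<^esub> = c x y)"
    then have "h \<zero>\<^bsub>T\<^esub> = \<zero>\<^bsub>W\<^esub>" using lin_zero[OF T(1) W.module_axioms] by blast
    then show "h = (\<lambda>t\<in>carrier T. \<zero>\<^bsub>W\<^esub>)"
      using h T(2) by (intro extensionalityI[of _ "carrier T"]) auto
  qed
qed

text \<open>The identity and the zero map both factor the zero bilinear map, so the uniqueness
  clause identifies them.\<close>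

lemma tensor_product_eq_zero:
  assumes T: "tensor_product K M N T b" and M: "Module.module K M"
    and zero: "carrier M = {\<zero>\<^bsub>M\<^esub>}"
  shows "carrier T = {\<zero>\<^bsub>T\<^esub>}"
proof -
  interpret T: Module.module K T using T by (simp add: tensor_product_def)
  have b: "bilinear_map K M N T b" using T by (simp add: tensor_product_def)
  have b0: "b x y = \<zero>\<^bsub>T\<^esub>" if "x \<in> carrier M" "y \<in> carrier N" for x y
    using that zero lin_zero[OF M T.module_axioms bilinear_map_right[OF b that(2)]] by auto
  have "bilinear_map K M N T (\<lambda>_ _. \<zero>\<^bsub>T\<^esub>)"
    by (auto simp: bilinear_map_def intro!: linI)
  then have "\<exists>!h. h \<in> lin K T T \<inter> extensional (carrier T) \<and>
      (\<forall>x\<in>carrier M. \<forall>y\<in>carrier N. h (b x y) = \<zero>\<^bsub>T\<^esub>)"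
    using T T.module_axioms unfolding tensor_product_def by blast
  moreover have "(\<lambda>t\<in>carrier T. t) \<in> lin K T T \<inter> extensional (carrier T) \<and>
      (\<forall>x\<in>carrier M. \<forall>y\<in>carrier N. (\<lambda>t\<in>carrier T. t) (b x y) = \<zero>\<^bsub>T\<^esub>)"
    using b0 by (auto intro!: linI)
  moreover have "(\<lambda>t\<in>carrier T. \<zero>\<^bsub>T\<^esub>) \<in> lin K T T \<inter> extensional (carrier T) \<and>
      (\<forall>x\<in>carrier M. \<forall>y\<in>carrier N. (\<lambda>t\<in>carrier T. \<zero>\<^bsub>T\<^esub>) (b x y) = \<zero>\<^bsub>T\<^esub>)"
    using b0 by (auto intro!: linI)
  ultimately have eq: "(\<lambda>t\<in>carrier T. t) = (\<lambda>t\<in>carrier T. \<zero>\<^bsub>T\<^esub>)" by blast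
  have "t = \<zero>\<^bsub>T\<^esub>" if "t \<in> carrier T" for t
    using fun_cong[OF eq, of t] that by simp
  then show ?thesis by auto
qed

text \<open>The universal property tests only modules on the same type, so the bilinear map to be
  factored goes into M itself: multiply u by the scalar f v, where f is a functional with f y = 1.
  It takes (x, y) to x, which is not 0.\<close>

lemma tensor_product_neq_zero:
  fixes M N T :: "('k, 'v) module"
  assumes K: "Ring.field K" and T: "tensor_product K M N T b"
    and M: "Module.module K M" and N: "Module.module K N"
    and nz: "carrier M \<noteq> {\<zero>\<^bsub>M\<^esub>}" "carrier N \<noteq> {\<zero>\<^bsub>N\<^esub>}"
  shows "carrier T \<noteq> {\<zero>\<^bsub>T\<^esub>}"
proof
  assume T0: "carrier T = {\<zero>\<^bsub>T\<^esub>}"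
  interpret K: Ring.field K by fact
  interpret T: Module.module K T using T by (simp add: tensor_product_def)
  interpret M: Module.module K M by fact
  interpret N: Module.module K N by fact
  have b: "bilinear_map K M N T b" using T by (simp add: tensor_product_def)
  obtain x y where x: "x \<in> carrier M" "x \<noteq> \<zero>\<^bsub>M\<^esub>" and y: "y \<in> carrier N" "y \<noteq> \<zero>\<^bsub>N\<^esub>"
    using nz M.zero_closed N.zero_closed by blast
  obtain f where f: "f \<in> lin K N (scalar_module K)" "f y = \<one>\<^bsub>K\<^esub>"
    using subspace_functional[OF K N y] .
  have fc: "f v \<in> carrier K" if "v \<in> carrier N" for v using lin_closed[OF f(1) that] by simp
  have "bilinear_map K M N M (\<lambda>u v. f v \<odot>\<^bsub>M\<^esub> u)"
    unfolding bilinear_map_def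
  proof (intro conjI ballI)
    fix u assume u: "u \<in> carrier M"
    show "(\<lambda>v. f v \<odot>\<^bsub>M\<^esub> u) \<in> lin K N M"
      using u fc lin_add[OF f(1)] lin_smult[OF f(1)]
      by (intro linI) (simp_all add: M.smult_l_distr M.smult_assoc1)
  next
    fix v assume v: "v \<in> carrier N"
    show "(\<lambda>u. f v \<odot>\<^bsub>M\<^esub> u) \<in> lin K M M"
    proof (rule linI)
      fix a u assume "a \<in> carrier K" "u \<in> carrier M"
      then show "f v \<odot>\<^bsub>M\<^esub> (a \<odot>\<^bsub>M\<^esub> u) = a \<odot>\<^bsub>M\<^esub> (f v \<odot>\<^bsub>M\<^esub> u)"
        using fc[OF v] by (simp add: K.m_comm flip: M.smult_assoc1)
    qed (use fc[OF v] in \<open>simp_all add: M.smult_r_distr\<close>)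
  qed
  then obtain h where h: "h \<in> lin K T M" "h (b x y) = f y \<odot>\<^bsub>M\<^esub> x"
    using T M x y unfolding tensor_product_def by blast
  have "b x y = \<zero>\<^bsub>T\<^esub>" using T0 lin_closed[OF bilinear_map_left[OF b x(1)] y(1)] by auto
  then show False using h x f(2) lin_zero[OF T.module_axioms M h(1)] by simp
qed

text \<open>M tensored with the free module on I is the product of copies of M, but its elements
  take one argument too many for the universal property; \<phi> carries it back to a module of the
  right type.\<close>

lemma tensor_product_free:
  fixes M :: "('k, 'i \<Rightarrow> 'k) module" and I :: "'i set"
  assumes K: "cring K" and M: "Module.module K M" and I: "finite I" and T: "Module.module K T"
    and \<phi>: "\<phi> \<in> lin K (prod_module I (\<lambda>_. M)) T"
    and bij: "bij_betw \<phi> (carrier (prod_module I (\<lambda>_. M))) (carrier T)"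
  shows "tensor_product K M (prod_module I (\<lambda>_. scalar_module K)) T (\<lambda>x c. \<phi> (\<lambda>i\<in>I. c i \<odot>\<^bsub>M\<^esub> x))"
    (is "tensor_product K M ?N T ?b")
  unfolding tensor_product_def
proof (intro conjI allI impI)
  let ?P = "prod_module I (\<lambda>_. M)"
  interpret K: cring K by fact
  interpret M: Module.module K M by fact
  interpret T: Module.module K T by fact
  have N: "Module.module K ?N" by (intro module_prod_module module_scalar_module K)
  have P: "Module.module K ?P" by (intro module_prod_module M K)
  show "Module.module K T" by fact
  have \<phi>c: "\<phi> z \<in> carrier T" if "z \<in> carrier ?P" for z using lin_closed[OF \<phi> that] .
  have \<phi>surj: "\<exists>z\<in>carrier ?P. t = \<phi> z" if "t \<in> carrier T" for t
    using bij that by (auto simp: bij_betw_def)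
  have \<phi>inj: "inj_on \<phi> (carrier ?P)" using bij by (simp add: bij_betw_def)
  have mul: "(\<lambda>i\<in>I. c i \<odot>\<^bsub>M\<^esub> x) \<in> carrier ?P" if "x \<in> carrier M" "c \<in> carrier ?N" for x c
    using that by auto
  show "bilinear_map K M ?N T ?b"
    unfolding bilinear_map_def
  proof (intro conjI ballI)
    fix x assume x: "x \<in> carrier M"
    have "(\<lambda>c. \<lambda>i\<in>I. c i \<odot>\<^bsub>M\<^esub> x) \<in> lin K ?N ?P"
      using x by (intro linI ext) (auto simp: PiE_iff M.smult_l_distr M.smult_assoc1)
    then show "?b x \<in> lin K ?N T" by (rule lin_comp[OF _ \<phi>])
  next
    fix c assume c: "c \<in> carrier ?N"
    have "(\<lambda>x. \<lambda>i\<in>I. c i \<odot>\<^bsub>M\<^esub> x) \<in> lin K M ?P"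
    proof (rule linI)
      fix a x assume "a \<in> carrier K" "x \<in> carrier M"
      then show "(\<lambda>i\<in>I. c i \<odot>\<^bsub>M\<^esub> (a \<odot>\<^bsub>M\<^esub> x)) = a \<odot>\<^bsub>?P\<^esub> (\<lambda>i\<in>I. c i \<odot>\<^bsub>M\<^esub> x)"
        using c by (intro ext) (auto simp: PiE_iff K.m_comm simp flip: M.smult_assoc1)
    qed (use c in \<open>auto simp: PiE_iff M.smult_r_distr fun_eq_iff\<close>)
    then show "(\<lambda>x. ?b x c) \<in> lin K M T" by (rule lin_comp[OF _ \<phi>])
  qed
  fix W :: "('k, 'i \<Rightarrow> 'k) module" and c assume Wc: "Module.module K W \<and> bilinear_map K M ?N W c"
  then interpret W: Module.module K W by blast
  have c: "bilinear_map K M ?N W c" using Wc by blast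
  let ?\<delta> = "\<lambda>i. single I (\<lambda>_. scalar_module K) i \<one>\<^bsub>K\<^esub>"
  have \<delta>: "?\<delta> i \<in> carrier ?N" for i
    by (auto simp: single_def)
  have cc: "c x y \<in> carrier W" if "x \<in> carrier M" "y \<in> carrier ?N" for x y
    by (rule lin_closed[OF bilinear_map_left[OF c that(1)] that(2)])
  \<comment> \<open>The only candidate, since a family is the sum of the tensors of its entries with
    the basis vectors.\<close>
  define g where "g z = finsum W (\<lambda>i. c (z i) (?\<delta> i)) I" for z
  have summand: "c (z i) (?\<delta> i) \<in> carrier W" if "z \<in> carrier ?P" "i \<in> I" for z i
    using that by (intro cc \<delta>) auto
  have g: "g \<in> lin K ?P W"
  proof (rule linI)
    fix z assume z: "z \<in> carrier ?P"
    show "g z \<in> carrier W" unfolding g_def using summand[OF z] by (intro W.finsum_closed) auto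
    fix z' assume z': "z' \<in> carrier ?P"
    have "g (z \<oplus>\<^bsub>?P\<^esub> z') = finsum W (\<lambda>i. c (z i) (?\<delta> i) \<oplus>\<^bsub>W\<^esub> c (z' i) (?\<delta> i)) I"
      unfolding g_def
    proof (rule W.finsum_cong')
      fix i assume i: "i \<in> I"
      have "z i \<in> carrier M" "z' i \<in> carrier M" using i z z' by auto
      then show "c ((z \<oplus>\<^bsub>?P\<^esub> z') i) (?\<delta> i) = c (z i) (?\<delta> i) \<oplus>\<^bsub>W\<^esub> c (z' i) (?\<delta> i)"
        using i lin_add[OF bilinear_map_right[OF c \<delta>]] by simp
    qed (use summand[OF z] summand[OF z'] in auto)
    also have "\<dots> = g z \<oplus>\<^bsub>W\<^esub> g z'"
      unfolding g_def using summand[OF z] summand[OF z'] by (intro W.finsum_addf) auto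
    finally show "g (z \<oplus>\<^bsub>?P\<^esub> z') = g z \<oplus>\<^bsub>W\<^esub> g z'" .
  next
    fix a z assume a: "a \<in> carrier K" and z: "z \<in> carrier ?P"
    have "g (a \<odot>\<^bsub>?P\<^esub> z) = finsum W (\<lambda>i. a \<odot>\<^bsub>W\<^esub> c (z i) (?\<delta> i)) I"
      unfolding g_def
    proof (rule W.finsum_cong')
      fix i assume i: "i \<in> I"
      have "z i \<in> carrier M" using i z by auto
      then show "c ((a \<odot>\<^bsub>?P\<^esub> z) i) (?\<delta> i) = a \<odot>\<^bsub>W\<^esub> c (z i) (?\<delta> i)"
        using i a lin_smult[OF bilinear_map_right[OF c \<delta>]] by simp
    qed (use summand[OF z] a in auto)
    also have "\<dots> = a \<odot>\<^bsub>W\<^esub> g z"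
      unfolding g_def using summand[OF z] a I by (intro W.finsum_smult_ldistr[symmetric]) auto
    finally show "g (a \<odot>\<^bsub>?P\<^esub> z) = a \<odot>\<^bsub>W\<^esub> g z" .
  qed
  have g_mul: "g (\<lambda>i\<in>I. y i \<odot>\<^bsub>M\<^esub> x) = c x y" if x: "x \<in> carrier M" and y: "y \<in> carrier ?N" for x y
  proof (rule prod_module_induct[OF I _ y, of K "\<lambda>y. g (\<lambda>i\<in>I. y i \<odot>\<^bsub>M\<^esub> x) = c x y"])
    show "Module.module K (scalar_module K)" by (rule module_scalar_module[OF K])
    have "(\<lambda>i\<in>I. \<zero>\<^bsub>?N\<^esub> i \<odot>\<^bsub>M\<^esub> x) = \<zero>\<^bsub>?P\<^esub>" using x by (auto simp: fun_eq_iff)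
    then show "g (\<lambda>i\<in>I. \<zero>\<^bsub>?N\<^esub> i \<odot>\<^bsub>M\<^esub> x) = c x \<zero>\<^bsub>?N\<^esub>"
      unfolding lin_zero[OF N W.module_axioms bilinear_map_left[OF c x]]
      using lin_zero[OF P W.module_axioms g] by simp
    fix u v assume u: "u \<in> carrier ?N" and v: "v \<in> carrier ?N"
      and eq: "g (\<lambda>i\<in>I. u i \<odot>\<^bsub>M\<^esub> x) = c x u" "g (\<lambda>i\<in>I. v i \<odot>\<^bsub>M\<^esub> x) = c x v"
    have "(\<lambda>i\<in>I. (u \<oplus>\<^bsub>?N\<^esub> v) i \<odot>\<^bsub>M\<^esub> x) = (\<lambda>i\<in>I. u i \<odot>\<^bsub>M\<^esub> x) \<oplus>\<^bsub>?P\<^esub> (\<lambda>i\<in>I. v i \<odot>\<^bsub>M\<^esub> x)"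
      using u v x by (intro ext) (auto simp: PiE_iff M.smult_l_distr)
    then show "g (\<lambda>i\<in>I. (u \<oplus>\<^bsub>?N\<^esub> v) i \<odot>\<^bsub>M\<^esub> x) = c x (u \<oplus>\<^bsub>?N\<^esub> v)"
      unfolding lin_add[OF bilinear_map_left[OF c x] u v]
      using lin_add[OF g mul[OF x u] mul[OF x v]] eq by (simp only:)
  next
    fix i a assume i: "i \<in> I" and a: "a \<in> carrier (scalar_module K)"
    let ?s = "single I (\<lambda>_. scalar_module K) i a"
    have s: "?s \<in> carrier ?N" using a by (auto simp: single_def)
    have eq: "?s = a \<odot>\<^bsub>?N\<^esub> ?\<delta> i" using a by (auto simp: single_def fun_eq_iff)
    have z0: "c \<zero>\<^bsub>M\<^esub> (?\<delta> j) = \<zero>\<^bsub>W\<^esub>" for j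
      using lin_zero[OF M W.module_axioms bilinear_map_right[OF c \<delta>]] .
    have "g (\<lambda>j\<in>I. ?s j \<odot>\<^bsub>M\<^esub> x) = c ((\<lambda>j\<in>I. ?s j \<odot>\<^bsub>M\<^esub> x) i) (?\<delta> i)"
      unfolding g_def
    proof (rule W.finsum_single[OF I i])
      show "c ((\<lambda>j\<in>I. ?s j \<odot>\<^bsub>M\<^esub> x) i) (?\<delta> i) \<in> carrier W"
        by (rule summand[OF mul[OF x s] i])
      show "c ((\<lambda>j\<in>I. ?s j \<odot>\<^bsub>M\<^esub> x) j) (?\<delta> j) = \<zero>\<^bsub>W\<^esub>" if "j \<in> I" "j \<noteq> i" for j
        using that x z0 by (simp add: single_def)
    qed
    also have "\<dots> = c (a \<odot>\<^bsub>M\<^esub> x) (?\<delta> i)" using i by (simp add: single_def)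
    also have "\<dots> = a \<odot>\<^bsub>W\<^esub> c x (?\<delta> i)"
      using a x lin_smult[OF bilinear_map_right[OF c \<delta>]] by simp
    also have "\<dots> = c x ?s"
      unfolding eq using a lin_smult[OF bilinear_map_left[OF c x] _ \<delta>] by simp
    finally show "g (\<lambda>j\<in>I. ?s j \<odot>\<^bsub>M\<^esub> x) = c x ?s" .
  qed
  define h where "h = (\<lambda>t\<in>carrier T. g (the_inv_into (carrier ?P) \<phi> t))"
  have h\<phi>: "h (\<phi> z) = g z" if "z \<in> carrier ?P" for z
    unfolding h_def restrict_apply the_inv_into_f_f[OF \<phi>inj that] using \<phi>c[OF that] by (rule if_P)
  show "\<exists>!h. h \<in> lin K T W \<inter> extensional (carrier T) \<and> (\<forall>x\<in>carrier M. \<forall>y\<in>carrier ?N. h (?b x y) = c x y)"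
  proof (rule ex1I[of _ h])
    have "h \<in> lin K T W"
    proof (rule linI)
      fix t assume "t \<in> carrier T"
      then obtain z where z: "z \<in> carrier ?P" "t = \<phi> z" using \<phi>surj by blast
      show "h t \<in> carrier W" unfolding z(2) h\<phi>[OF z(1)] by (rule lin_closed[OF g z(1)])
      show "h (a \<odot>\<^bsub>T\<^esub> t) = a \<odot>\<^bsub>W\<^esub> h t" if a: "a \<in> carrier K" for a
      proof -
        have az: "a \<odot>\<^bsub>?P\<^esub> z \<in> carrier ?P" by (rule module.smult_closed[OF P a z(1)])
        show ?thesis
          unfolding z(2) lin_smult[OF \<phi> a z(1), symmetric] h\<phi>[OF z(1)] h\<phi>[OF az]
          by (rule lin_smult[OF g a z(1)])
      qed
      fix t' assume "t' \<in> carrier T"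
      then obtain z' where z': "z' \<in> carrier ?P" "t' = \<phi> z'" using \<phi>surj by blast
      have az: "z \<oplus>\<^bsub>?P\<^esub> z' \<in> carrier ?P"
        using z(1) z'(1) by auto
      show "h (t \<oplus>\<^bsub>T\<^esub> t') = h t \<oplus>\<^bsub>W\<^esub> h t'"
        unfolding z(2) z'(2) lin_add[OF \<phi> z(1) z'(1), symmetric] h\<phi>[OF z(1)] h\<phi>[OF z'(1)] h\<phi>[OF az]
        by (rule lin_add[OF g z(1) z'(1)])
    qed
    then show "h \<in> lin K T W \<inter> extensional (carrier T) \<and> (\<forall>x\<in>carrier M. \<forall>y\<in>carrier ?N. h (?b x y) = c x y)"
      using h\<phi>[OF mul] g_mul by (simp add: h_def)
    fix h' assume h': "h' \<in> lin K T W \<inter> extensional (carrier T) \<and> (\<forall>x\<in>carrier M. \<forall>y\<in>carrier ?N. h' (?b x y) = c x y)"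
    then have h'l: "h' \<in> lin K T W" by blast
    have h'\<phi>: "h' (\<phi> z) = g z" if z: "z \<in> carrier ?P" for z
    proof (rule prod_module_induct[OF I M z, of "\<lambda>z. h' (\<phi> z) = g z"])
      show "h' (\<phi> \<zero>\<^bsub>?P\<^esub>) = g \<zero>\<^bsub>?P\<^esub>"
        unfolding lin_zero[OF P W.module_axioms g]
        by (rule lin_zero[OF P W.module_axioms lin_comp[OF \<phi> h'l]])
      show "h' (\<phi> (u \<oplus>\<^bsub>?P\<^esub> v)) = g (u \<oplus>\<^bsub>?P\<^esub> v)"
        if "u \<in> carrier ?P" "v \<in> carrier ?P" "h' (\<phi> u) = g u" "h' (\<phi> v) = g v" for u v
        unfolding lin_add[OF g that(1,2)] lin_add[OF lin_comp[OF \<phi> h'l] that(1,2)] that(3,4) ..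
      fix i m assume im: "i \<in> I" "m \<in> carrier M"
      \<comment> \<open>A family with the single entry m is the pure tensor of m and a basis vector,
        and there the value is prescribed.\<close>
      have "single I (\<lambda>_. M) i m = (\<lambda>j\<in>I. ?\<delta> i j \<odot>\<^bsub>M\<^esub> m)"
        using im by (auto simp: single_def fun_eq_iff)
      then show "h' (\<phi> (single I (\<lambda>_. M) i m)) = g (single I (\<lambda>_. M) i m)"
        using g_mul[OF im(2) \<delta>] h' im \<delta>[of i] by simp
    qed
    show "h' = h"
    proof (rule extensionalityI[of _ "carrier T"])
      show "h' \<in> extensional (carrier T)" using h' by blast
      show "h \<in> extensional (carrier T)" by (simp add: h_def)
      fix t assume "t \<in> carrier T"
      then obtain z where z: "z \<in> carrier ?P" "t = \<phi> z" using \<phi>surj by blast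
      show "h' t = h t" unfolding z(2) h\<phi>[OF z(1)] h'\<phi>[OF z(1)] ..
    qed
  qed
qed

section \<open>Tensor products with free functors\<close>

lemma down_closed_UNIV: "down_closed UNIV"
  by (simp add: down_closed_def)

text \<open>Uncurrying along the pairing of natural numbers, which brings sequences of sequences
  back to the type of objects.\<close>

definition encode :: "(nat \<Rightarrow> nat \<Rightarrow> 'k) \<Rightarrow> nat \<Rightarrow> 'k" where
  "encode z = (\<lambda>n. case prod_decode n of (i, m) \<Rightarrow> z i m)"

definition uncode :: "(nat \<Rightarrow> 'k) \<Rightarrow> nat \<Rightarrow> nat \<Rightarrow> 'k" where
  "uncode w = (\<lambda>i m. w (prod_encode (i, m)))"

lemma uncode_encode [simp]: "uncode (encode z) = z"
  by (simp add: uncode_def encode_def)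

lemma encode_eq_iff: "encode z = encode z' \<longleftrightarrow> z = z'"
  by (metis uncode_encode)

lemma encode_image_data:
  assumes X: "is_functor K U X"
  shows "image_data K U X (\<lambda>G. {\<zero>\<^bsub>obj X G\<^esub>}) (\<lambda>_. encode) (\<lambda>_. uncode)"
proof (unfold_locales, rule X, rule is_subfunctor_zero[OF X])
  fix G x y assume *: "G \<in> U" "x \<in> carrier (obj X G)" "y \<in> carrier (obj X G)"
  interpret M: Module.module K "obj X G" by (rule functor_module[OF X *(1)])
  show "(encode x = encode y) = (x \<ominus>\<^bsub>obj X G\<^esub> y \<in> {\<zero>\<^bsub>obj X G\<^esub>})"
    using * by (simp add: encode_eq_iff)
qed simp_all

text \<open>Since \<open>free I s\<close> has a finite basis at each object, tensoring with it is a
  copower; \<open>encode\<close> restores the type of objects.\<close>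

definition tens ::
    "('k, nat \<Rightarrow> 'k) functor_data \<Rightarrow> (nat monoid \<Rightarrow> nat set)
      \<Rightarrow> (nat monoid \<Rightarrow> nat monoid \<Rightarrow> (nat \<Rightarrow> nat) set \<Rightarrow> nat \<Rightarrow> nat option)
      \<Rightarrow> ('k, nat \<Rightarrow> 'k) functor_data" where
  "tens X I s = image_functor (\<lambda>_. encode) (\<lambda>_. uncode) (copower X I s)"

context field_level_category
begin

lemma tens_image_data:
  assumes "is_functor K U X" "index_system U I s"
  shows "image_data K U (copower X I s) (\<lambda>G. {\<zero>\<^bsub>obj (copower X I s) G\<^esub>}) (\<lambda>_. encode) (\<lambda>_. uncode)"
  by (rule encode_image_data[OF is_functor_copower[OF assms]])

lemma is_tensor_tens:
  assumes X: "is_functor K U X" and I: "index_system U I s"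
  shows "is_tensor K U X (free I s) (tens X I s)"
proof -
  interpret q: image_data K U "copower X I s" "\<lambda>G. {\<zero>\<^bsub>obj (copower X I s) G\<^esub>}" "\<lambda>_. encode" "\<lambda>_. uncode"
    by (rule tens_image_data[OF X I])
  define b where "b G x c = encode (\<lambda>i\<in>I G. c i \<odot>\<^bsub>obj X G\<^esub> x)" for G and x c :: "nat \<Rightarrow> 'k"
  show ?thesis
    unfolding is_tensor_def
  proof (intro exI[of _ b] conjI ballI)
    fix G assume G: "G \<in> U"
    show "tensor_product K (obj X G) (obj (free I s) G) (obj (tens X I s) G) (b G)"
      unfolding b_def[abs_def] copower_simps(1) const_functor_simps(1)
    proof (rule tensor_product_free[OF K.is_cring functor_module[OF X G]])
      show "finite (I G)" using I G by (simp add: index_system_def)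
      show "Module.module K (obj (tens X I s) G)"
        unfolding tens_def by (rule functor_module[OF q.is_functor G])
      show "encode \<in> lin K (prod_module (I G) (\<lambda>_. obj X G)) (obj (tens X I s) G)"
        using nat_trans_lin[OF q.nat_trans G] by (simp add: tens_def)
      show "bij_betw encode (carrier (prod_module (I G) (\<lambda>_. obj X G))) (carrier (obj (tens X I s) G))"
        by (auto simp: tens_def bij_betw_def inj_on_def encode_eq_iff)
    qed
    fix H \<alpha> x c assume H: "H \<in> U" "\<alpha> \<in> Hom G H" and x: "x \<in> carrier (obj X H)"
      and c: "c \<in> carrier (obj (free I s) H)"
    interpret M: Module.module K "obj X G" by (rule functor_module[OF X G])
    have s: "i \<in> I H" if "j \<in> I G" "s G H \<alpha> j = Some i" for i j
      using that I G H unfolding index_system_def by blast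
    note xc = functor_arr_closed[OF X G H x]
    have "arr (copower X I s) G H \<alpha> (\<lambda>i\<in>I H. c i \<odot>\<^bsub>obj X H\<^esub> x) =
      (\<lambda>i\<in>I G. arr (free I s) G H \<alpha> c i \<odot>\<^bsub>obj X G\<^esub> arr X G H \<alpha> x)"
    proof (rule ext)
      fix j
      show "arr (copower X I s) G H \<alpha> (\<lambda>i\<in>I H. c i \<odot>\<^bsub>obj X H\<^esub> x) j =
        (\<lambda>i\<in>I G. arr (free I s) G H \<alpha> c i \<odot>\<^bsub>obj X G\<^esub> arr X G H \<alpha> x) j"
        using c xc s[of j] lin_smult[OF functor_arr[OF X G H] _ x]
        by (cases "s G H \<alpha> j") (auto simp: PiE_iff)
    qed
    then show "arr (tens X I s) G H \<alpha> (b H x c) = b G (arr X G H \<alpha> x) (arr (free I s) G H \<alpha> c)"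
      by (simp add: tens_def b_def del: copower_simps)
  qed
qed

lemma hom_index_map_Some:
  assumes "T \<in> U" "G \<in> U" "H \<in> U" "\<alpha> \<in> Hom G H" "\<beta> \<in> Hom H T" "lev G \<in> S" "j \<in> hom_index S T G"
  shows "hom_map T G H \<alpha> j = Some (code T H \<beta>) \<longleftrightarrow> j = code T G (comp_class G \<beta> \<alpha>)"
proof -
  obtain \<gamma> where g: "\<gamma> \<in> Hom G T" "j = code T G \<gamma>"
    using assms(6,7) by (auto simp: hom_index_def)
  have c: "comp_class G \<beta> \<alpha> \<in> Hom G T" using assms by (intro comp_Hom[of G H T])
  show ?thesis
    unfolding g(2) code_eq_iff[OF assms(2,1) g(1) c] by (rule hom_map_eq_Some_iff[OF assms(1-5) g(1)])
qed

lemma hom_index_map_closed: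
  assumes "T \<in> U" "down_closed S" "G \<in> U" "H \<in> U" "\<alpha> \<in> Hom G H"
    "j \<in> hom_index S T G" "hom_map T G H \<alpha> j = Some i"
  shows "i \<in> hom_index S T H"
  using index_system_hom[OF assms(1,2)] assms(3-) unfolding index_system_def by blast

text \<open>The rule for a pure tensor m \<otimes> \<beta>: both factors are pulled back along
  \<alpha>. The condition on the level keeps the new basis vector inside the truncation.\<close>

lemma copower_hom_arr_single:
  assumes X: "is_functor K U X" and T: "T \<in> U" and S: "down_closed S"
    and G: "G \<in> U" "H \<in> U" "\<alpha> \<in> Hom G H" and b: "\<beta> \<in> Hom H T" and l: "lev G \<in> S"
  shows "arr (copower X (hom_index S T) (hom_map T)) G H \<alpha>
      (single (hom_index S T H) (\<lambda>_. obj X H) (code T H \<beta>) m)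
    = single (hom_index S T G) (\<lambda>_. obj X G) (code T G (comp_class G \<beta> \<alpha>)) (arr X G H \<alpha> m)"
proof (rule copower_arr_single[OF X G])
  show "i' \<in> hom_index S T H" if "j \<in> hom_index S T G" "hom_map T G H \<alpha> j = Some i'" for j i'
    by (rule hom_index_map_closed[OF T S G that])
  show "(hom_map T G H \<alpha> j = Some (code T H \<beta>)) = (j = code T G (comp_class G \<beta> \<alpha>))"
    if "j \<in> hom_index S T G" for j
    by (rule hom_index_map_Some[OF T G b l that])
qed

definition hom_functor :: "nat set \<Rightarrow> nat monoid \<Rightarrow> ('k, nat \<Rightarrow> 'k) functor_data" where
  "hom_functor S T = free (hom_index S T) (hom_map T)"

lemma is_functor_hom_functor:
  assumes "T \<in> U" "down_closed S"
  shows "is_functor K U (hom_functor S T)"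
  unfolding hom_functor_def by (rule is_functor_free[OF index_system_hom[OF assms]])

text \<open>The identity of T generates, as in \<open>e_T\<close>; it survives the truncation
  because the level of T lies in S.\<close>

lemma hom_functor_fg:
  assumes T: "T \<in> U" and S: "down_closed S" and l: "lev T \<in> S"
  shows "hom_functor S T \<in> fg_functors K U"
proof -
  define e where "e G \<gamma> = single (hom_index S T G) (\<lambda>_. scalar_module K) (code T G \<gamma>) \<one>\<^bsub>K\<^esub>" for G \<gamma>
  have "generates K U (hom_functor S T) {(T, e T (id_class T))}"
  proof (rule generatesI)
    show "G \<in> U \<and> x \<in> carrier (obj (hom_functor S T) G)" if "(G, x) \<in> {(T, e T (id_class T))}" for G x
      using that T by (auto simp: hom_functor_def e_def single_def)
    fix W N assume W: "W \<in> U" and N: "subspace K N (obj (hom_functor S T) W)"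
      and gen: "\<And>G x \<alpha>. (G, x) \<in> {(T, e T (id_class T))} \<Longrightarrow> \<alpha> \<in> Hom W G \<Longrightarrow>
        arr (hom_functor S T) W G \<alpha> x \<in> N"
    have "carrier (prod_module (hom_index S T W) (\<lambda>_. scalar_module K)) \<subseteq> N"
    proof (rule free_subspace[OF K.is_cring])
      show "finite (hom_index S T W)"
        using index_system_hom[OF T S] W unfolding index_system_def by blast
      show "subspace K N (prod_module (hom_index S T W) (\<lambda>_. scalar_module K))"
        using N by (simp add: hom_functor_def)
      fix i assume "i \<in> hom_index S T W"
      then obtain \<gamma> where g: "lev W \<in> S" "\<gamma> \<in> Hom W T" "i = code T W \<gamma>"
        by (auto simp: hom_index_def split: if_splits)
      have "arr (hom_functor S T) W T \<gamma> (e T (id_class T)) = e W \<gamma>"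
        unfolding hom_functor_def e_def
        using copower_hom_arr_single[OF is_functor_const_functor[OF K.is_cring] T S W T g(2) id_Hom[OF T] g(1)]
          comp_id_left[OF W T g(2)]
        by (simp del: copower_simps)
      then show "single (hom_index S T W) (\<lambda>_. scalar_module K) i \<one>\<^bsub>K\<^esub> \<in> N"
        using gen[of T _ \<gamma>] g by (simp add: e_def)
    qed
    then show "carrier (obj (hom_functor S T) W) \<subseteq> N" by (simp add: hom_functor_def)
  qed simp
  then show ?thesis
    using is_functor_hom_functor[OF T S] finitely_generated_of_generates by (simp add: fg_functors_def)
qed

text \<open>A generator \<open>\<beta>\<^sup>* x \<otimes> \<gamma>\<close> of \<open>X \<otimes> e_T\<close> is already defined over a group through which
  both \<open>\<beta>\<close> and \<open>\<gamma>\<close> factor, and the level of such a group is bounded.\<close>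

lemma tens_hom_fg:
  assumes X: "X \<in> fg_functors K U" and T: "T \<in> U"
  shows "tens X (hom_index UNIV T) (hom_map T) \<in> fg_functors K U"
proof -
  have fX: "is_functor K U X" by (rule fg_functorsD[OF X])
  have I: "index_system U (hom_index UNIV T) (hom_map T)" by (rule index_system_hom[OF T down_closed_UNIV])
  let ?Z = "copower X (hom_index UNIV T) (hom_map T)"
  have fZ: "is_functor K U ?Z" by (rule is_functor_copower[OF fX I])
  obtain \<Gamma> where \<Gamma>: "generates K U X \<Gamma>"
    using generates_of_finitely_generated[OF fX] X by (auto simp: fg_functors_def)
  note \<Gamma>c = generates_closed[OF \<Gamma>]
  have fin\<Gamma>: "finite \<Gamma>" using \<Gamma> by (simp add: generates_def)
  define e where "e G \<gamma> m = single (hom_index UNIV T G) (\<lambda>_. obj X G) (code T G \<gamma>) m" for G \<gamma> m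
  \<comment> \<open>Bounds the level over which two morphisms from W, one to the home of a generator
    and one to T, factor jointly. The inserted 0 covers an empty \<Gamma>.\<close>
  define N where "N = Max (insert 0 ((\<lambda>(G, x). lev G) ` \<Gamma>)) + lev T"
  have N: "lev G + lev T \<le> N" if "(G, x) \<in> \<Gamma>" for G x
  proof -
    have "lev G \<in> insert 0 ((\<lambda>(G, x). lev G) ` \<Gamma>)" using that by force
    then show ?thesis unfolding N_def using fin\<Gamma> by simp
  qed
  define \<Delta> where "\<Delta> = (\<Union>j\<in>{..N}. \<Union>(G, x)\<in>\<Gamma>. (\<lambda>(\<beta>, \<gamma>). (R j, e (R j) \<gamma> (arr X (R j) G \<beta> x))) `
    (Hom (R j) G \<times> Hom (R j) T))"
  have \<Delta>I: "(R j, e (R j) \<gamma> (arr X (R j) G \<beta> x)) \<in> \<Delta>"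
    if "j \<le> N" "(G, x) \<in> \<Gamma>" "\<beta> \<in> Hom (R j) G" "\<gamma> \<in> Hom (R j) T" for j G x \<beta> \<gamma>
    unfolding \<Delta>_def using that by force
  have "generates K U ?Z \<Delta>"
  proof (rule generatesI)
    show "finite \<Delta>"
      unfolding \<Delta>_def using fin\<Gamma> \<Gamma>c R_in T finite_Hom by (intro finite_UN_I) auto
    show "G \<in> U \<and> x \<in> carrier (obj ?Z G)" if mem: "(G, x) \<in> \<Delta>" for G x
    proof -
      obtain j H y \<beta> \<gamma> where *: "(H, y) \<in> \<Gamma>" "\<beta> \<in> Hom (R j) H" "G = R j" "x = e (R j) \<gamma> (arr X (R j) H \<beta> y)"
        using mem by (auto simp: \<Delta>_def)
      have "arr X (R j) H \<beta> y \<in> carrier (obj X (R j))"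
        using functor_arr_closed[OF fX R_in] \<Gamma>c[OF *(1)] *(2) by blast
      then show ?thesis
        using * R_in single_closed[where K = K, OF functor_module[OF fX R_in]] by (simp add: e_def)
    qed
    fix W V assume W: "W \<in> U" and V: "subspace K V (obj ?Z W)"
      and gen: "\<And>G x \<alpha>. (G, x) \<in> \<Delta> \<Longrightarrow> \<alpha> \<in> Hom W G \<Longrightarrow> arr ?Z W G \<alpha> x \<in> V"
    interpret V: LinearCombinations.submodule K V "obj ?Z W" by (rule V)
    interpret M: Module.module K "obj X W" by (rule functor_module[OF fX W])
    have single_in: "e W \<gamma> m \<in> V" if g: "\<gamma> \<in> Hom W T" and m: "m \<in> carrier (obj X W)" for \<gamma> m
    proof -
      have add: "e W \<gamma> (u \<oplus>\<^bsub>obj X W\<^esub> v) = e W \<gamma> u \<oplus>\<^bsub>obj ?Z W\<^esub> e W \<gamma> v" for u v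
        by (auto simp: e_def single_def fun_eq_iff)
      have smult: "e W \<gamma> (a \<odot>\<^bsub>obj X W\<^esub> u) = a \<odot>\<^bsub>obj ?Z W\<^esub> e W \<gamma> u" if "a \<in> carrier K" for a u
        using that by (auto simp: e_def single_def fun_eq_iff)
      have zero: "e W \<gamma> \<zero>\<^bsub>obj X W\<^esub> = \<zero>\<^bsub>obj ?Z W\<^esub>"
        by (auto simp: e_def single_def fun_eq_iff)
      \<comment> \<open>For fixed \<gamma> the elements m with m \<otimes> \<gamma> in V form a
        subspace. As \<Gamma> generates X, it remains to test the pullbacks of generators.\<close>
      have "subspace K {m \<in> carrier (obj X W). e W \<gamma> m \<in> V} (obj X W)"
        by (rule submodule.intro[OF M.module_axioms])
          (auto simp only: add smult zero mem_Collect_eq intro: V.m_closed V.smult_closed V.zero_closed)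
      then have "carrier (obj X W) \<subseteq> {m \<in> carrier (obj X W). e W \<gamma> m \<in> V}"
      proof (rule generatesD[OF \<Gamma> W])
        fix G x \<beta> assume Gx: "(G, x) \<in> \<Gamma>" and b: "\<beta> \<in> Hom W G"
        have G: "G \<in> U" "x \<in> carrier (obj X G)" using \<Gamma>c[OF Gx] by auto
        obtain j \<delta> \<beta>' \<gamma>' where j: "j \<le> lev G + lev T" and d: "\<delta> \<in> Hom W (R j)"
          and b': "\<beta>' \<in> Hom (R j) G" "comp_class W \<beta>' \<delta> = \<beta>"
          and g': "\<gamma>' \<in> Hom (R j) T" "comp_class W \<gamma>' \<delta> = \<gamma>"
          using factor[OF W G(1) T b g] by blast
        \<comment> \<open>This tensor over \<open>R j\<close> is one of the chosen generators, and
          its pullback along \<delta> is the tensor wanted at W.\<close>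
        have "arr ?Z W (R j) \<delta> (e (R j) \<gamma>' (arr X (R j) G \<beta>' x)) \<in> V"
          using j N[OF Gx] by (intro gen \<Delta>I Gx b' g' d) simp
        also have "arr ?Z W (R j) \<delta> (e (R j) \<gamma>' (arr X (R j) G \<beta>' x)) = e W \<gamma> (arr X W G \<beta> x)"
          unfolding e_def
          using copower_hom_arr_single[OF fX T down_closed_UNIV W R_in d g'(1) UNIV_I]
            functor_comp[OF fX W R_in G(1) d b'(1) G(2)] b'(2) g'(2) by (simp del: copower_simps)
        finally show "arr X W G \<beta> x \<in> {m \<in> carrier (obj X W). e W \<gamma> m \<in> V}"
          using functor_arr_closed[OF fX W G(1) b G(2)] by simp
      qed
      then show ?thesis using m by blast
    qed
    show "carrier (obj ?Z W) \<subseteq> V"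
    proof
      fix z assume z: "z \<in> carrier (obj ?Z W)"
      show "z \<in> V"
      proof (rule prod_module_induct[OF _ _ z[unfolded copower_simps(1)], of K "\<lambda>z. z \<in> V"])
        show "finite (hom_index UNIV T W)" using I W unfolding index_system_def by blast
        show "Module.module K (obj X W)" by (rule M.module_axioms)
        show "\<zero>\<^bsub>prod_module (hom_index UNIV T W) (\<lambda>_. obj X W)\<^esub> \<in> V"
          using V.zero_closed by simp
        show "u \<oplus>\<^bsub>prod_module (hom_index UNIV T W) (\<lambda>_. obj X W)\<^esub> v \<in> V" if "u \<in> V" "v \<in> V" for u v
          using V.m_closed[OF that] by simp
        fix i m assume "i \<in> hom_index UNIV T W" and m: "m \<in> carrier (obj X W)"
        then obtain \<gamma> where "\<gamma> \<in> Hom W T" "i = code T W \<gamma>" by (auto simp: hom_index_def)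
        then show "single (hom_index UNIV T W) (\<lambda>_. obj X W) i m \<in> V"
          using single_in[OF _ m] by (simp add: e_def)
      qed
    qed
  qed
  then have "finitely_generated K U ?Z" by (rule finitely_generated_of_generates[OF fZ])
  then show ?thesis
    unfolding tens_def by (rule fg_functors_image[OF tens_image_data[OF fX I]])
qed

end

section \<open>The augmentation of a truncated representable functor and its kernel\<close>

context field_level_category
begin

text \<open>Every morphism to T goes to 1. The levels of the target are those in S at which a
  morphism to T exists, which is what makes the map onto.\<close>

definition augmentation :: "nat set \<Rightarrow> nat monoid \<Rightarrow> nat monoid \<Rightarrow> (nat \<Rightarrow> 'k) \<Rightarrow> nat \<Rightarrow> 'k" where
  "augmentation S T G z = (\<lambda>j\<in>interval_index (S \<inter> {lev T..}) G. finsum K z (hom_index S T G))"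

lemma obj_hom_functor: "obj (hom_functor S T) G = prod_module (hom_index S T G) (\<lambda>_. scalar_module K)"
  by (simp add: hom_functor_def)

lemma finite_hom_index: "T \<in> U \<Longrightarrow> G \<in> U \<Longrightarrow> finite (hom_index S T G)"
  using finite_Hom by (simp add: hom_index_def)

lemma finsum_lin:
  assumes "finite I"
  shows "(\<lambda>z. finsum K z I) \<in> lin K (prod_module I (\<lambda>_. scalar_module K)) (scalar_module K)"
proof (rule linI)
  fix z assume z: "z \<in> carrier (prod_module I (\<lambda>_. scalar_module K))"
  then have zc: "z \<in> I \<rightarrow> carrier K" by (auto simp: PiE_iff)
  then show "finsum K z I \<in> carrier (scalar_module K)" by simp
  show "finsum K (a \<odot>\<^bsub>prod_module I (\<lambda>_. scalar_module K)\<^esub> z) I = a \<odot>\<^bsub>scalar_module K\<^esub> finsum K z I"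
    if a: "a \<in> carrier K" for a
  proof -
    have "finsum K (a \<odot>\<^bsub>prod_module I (\<lambda>_. scalar_module K)\<^esub> z) I = finsum K (\<lambda>i. a \<otimes>\<^bsub>K\<^esub> z i) I"
      using zc a by (intro K.finsum_cong') auto
    then show ?thesis using K.finsum_rdistr[OF assms a zc] by simp
  qed
  fix z' assume "z' \<in> carrier (prod_module I (\<lambda>_. scalar_module K))"
  then have zc': "z' \<in> I \<rightarrow> carrier K" by (auto simp: PiE_iff)
  have "finsum K (z \<oplus>\<^bsub>prod_module I (\<lambda>_. scalar_module K)\<^esub> z') I = finsum K (\<lambda>i. z i \<oplus>\<^bsub>K\<^esub> z' i) I"
    using zc zc' by (intro K.finsum_cong') auto
  then show "finsum K (z \<oplus>\<^bsub>prod_module I (\<lambda>_. scalar_module K)\<^esub> z') I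
      = finsum K z I \<oplus>\<^bsub>scalar_module K\<^esub> finsum K z' I"
    using K.finsum_addf[OF zc zc'] by simp
qed

text \<open>Pulling back sends distinct basis vectors to distinct basis vectors, so coordinate sums
  are preserved as long as nothing is cut off; what is cut off is zero in the target as
  well.\<close>

lemma nat_trans_augmentation:
  assumes T: "T \<in> U" and S: "down_closed S"
  shows "nat_trans K U (hom_functor S T) (ind (S \<inter> {lev T..})) (augmentation S T)"
  unfolding nat_trans_def
proof (intro conjI ballI)
  fix G assume G: "G \<in> U"
  note l = finsum_lin[OF finite_hom_index[OF T G, of S]]
  show "augmentation S T G \<in> lin K (obj (hom_functor S T) G) (obj (ind (S \<inter> {lev T..})) G)"
    unfolding obj_hom_functor
  proof (rule linI)
    fix x assume x: "x \<in> carrier (prod_module (hom_index S T G) (\<lambda>_. scalar_module K))"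
    show "augmentation S T G x \<in> carrier (obj (ind (S \<inter> {lev T..})) G)"
      using lin_closed[OF l x] by (simp add: augmentation_def carrier_ind)
    show "augmentation S T G (a \<odot>\<^bsub>prod_module (hom_index S T G) (\<lambda>_. scalar_module K)\<^esub> x)
      = a \<odot>\<^bsub>obj (ind (S \<inter> {lev T..})) G\<^esub> augmentation S T G x" if "a \<in> carrier K" for a
      unfolding augmentation_def lin_smult[OF l that x] by (auto simp: ind_def)
    fix y assume y: "y \<in> carrier (prod_module (hom_index S T G) (\<lambda>_. scalar_module K))"
    show "augmentation S T G (x \<oplus>\<^bsub>prod_module (hom_index S T G) (\<lambda>_. scalar_module K)\<^esub> y)
      = augmentation S T G x \<oplus>\<^bsub>obj (ind (S \<inter> {lev T..})) G\<^esub> augmentation S T G y"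
      unfolding augmentation_def lin_add[OF l x y] by (auto simp: ind_def)
  qed
  fix H \<alpha> z assume H: "H \<in> U" "\<alpha> \<in> Hom G H" and z: "z \<in> carrier (obj (hom_functor S T) H)"
  have le: "lev H \<le> lev G" by (rule Hom_lev[OF G H])
  show "augmentation S T G (arr (hom_functor S T) G H \<alpha> z)
    = arr (ind (S \<inter> {lev T..})) G H \<alpha> (augmentation S T H z)"
  proof (cases "lev G \<in> S \<and> lev T \<le> lev G")
    case False
    then have "interval_index (S \<inter> {lev T..}) G = {}" by (auto simp: interval_index_def)
    then show ?thesis by (simp add: augmentation_def ind_def restrict_def)
  next
    case True
    then have lH: "lev H \<in> S" using S le by (auto simp: down_closed_def)
    \<comment> \<open>The injection of basis indices induced by precomposition with
      \<alpha>.\<close>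
    define h where "h i = code T G (comp_class G (decode T H i) \<alpha>)" for i
    have idx: "\<exists>\<beta>\<in>Hom H T. i = code T H \<beta> \<and> h i = code T G (comp_class G \<beta> \<alpha>)"
      if "i \<in> hom_index S T H" for i
      using that lH decode_code[OF H(1) T] by (auto simp: hom_index_def h_def)
    have c: "comp_class G \<beta> \<alpha> \<in> Hom G T" if "\<beta> \<in> Hom H T" for \<beta>
      by (rule comp_Hom[OF G H(1) T H(2) that])
    have hI: "h i \<in> hom_index S T G" if "i \<in> hom_index S T H" for i
      using idx[OF that] c True by (auto simp: hom_index_def)
    have inj: "inj_on h (hom_index S T H)"
    proof (rule inj_onI)
      fix i j assume ij: "i \<in> hom_index S T H" "j \<in> hom_index S T H" "h i = h j"
      obtain \<beta> \<beta>' where b: "\<beta> \<in> Hom H T" "i = code T H \<beta>" "h i = code T G (comp_class G \<beta> \<alpha>)"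
        "\<beta>' \<in> Hom H T" "j = code T H \<beta>'" "h j = code T G (comp_class G \<beta>' \<alpha>)"
        using idx[OF ij(1)] idx[OF ij(2)] by auto
      have "comp_class G \<beta> \<alpha> = comp_class G \<beta>' \<alpha>"
        using b ij(3) code_eq_iff[OF G T c[OF b(1)] c[OF b(4)]] by simp
      then have "\<beta> = \<beta>'" by (rule comp_cancel[OF G H(1) T H(2) b(1,4)])
      then show "i = j" using b by simp
    qed
    let ?u = "arr (hom_functor S T) G H \<alpha> z"
    have zc: "z i \<in> carrier K" if "i \<in> hom_index S T H" for i
      using z that by (auto simp: obj_hom_functor)
    have u: "?u j = (case hom_map T G H \<alpha> j of None \<Rightarrow> \<zero>\<^bsub>K\<^esub> | Some i \<Rightarrow> z i)" if "j \<in> hom_index S T G" for j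
      using that by (simp add: hom_functor_def split: option.split)
    have uh: "?u (h i) = z i" if i: "i \<in> hom_index S T H" for i
    proof -
      obtain \<beta> where b: "\<beta> \<in> Hom H T" "i = code T H \<beta>" "h i = code T G (comp_class G \<beta> \<alpha>)"
        using idx[OF i] by blast
      have "hom_map T G H \<alpha> (h i) = Some i"
        using hom_index_map_Some[OF T G H b(1) _ hI[OF i]] b True by simp
      then show ?thesis using u[OF hI[OF i]] by simp
    qed
    have "finsum K ?u (hom_index S T G) = finsum K (\<lambda>i. ?u (h i)) (hom_index S T H)"
    proof (rule K.finsum_reindex_neutral[OF finite_hom_index[OF T G] inj])
      show "h ` hom_index S T H \<subseteq> hom_index S T G" using hI by blast
      show "?u j \<in> carrier K" if j: "j \<in> hom_index S T G" for j
        using u[OF j] zc[OF hom_index_map_closed[OF T S G H j]] by (cases "hom_map T G H \<alpha> j") auto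
      fix j assume j: "j \<in> hom_index S T G" "j \<notin> h ` hom_index S T H"
      have "hom_map T G H \<alpha> j = None"
      proof (rule ccontr)
        assume "hom_map T G H \<alpha> j \<noteq> None"
        then obtain i where i: "hom_map T G H \<alpha> j = Some i" by auto
        have iI: "i \<in> hom_index S T H" by (rule hom_index_map_closed[OF T S G H j(1) i])
        obtain \<beta> where b: "\<beta> \<in> Hom H T" "i = code T H \<beta>" "h i = code T G (comp_class G \<beta> \<alpha>)"
          using idx[OF iI] by blast
        have "j = h i" using hom_index_map_Some[OF T G H b(1) _ j(1)] b i True by simp
        then show False using j(2) iI by blast
      qed
      then show "?u j = \<zero>\<^bsub>K\<^esub>" using u[OF j(1)] by simp
    qed
    also have "\<dots> = finsum K z (hom_index S T H)"
      using uh zc by (intro K.finsum_cong') auto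
    finally have sum: "finsum K ?u (hom_index S T G) = finsum K z (hom_index S T H)" .
    show ?thesis
    proof (cases "lev T \<le> lev H")
      case le': True
      then have "{lev H..lev G} \<subseteq> S \<inter> {lev T..}" using True S by (auto simp: down_closed_def)
      then show ?thesis
        using sum True lH le' by (simp add: augmentation_def ind_def interval_index_def interval_map_def)
    next
      case False
      \<comment> \<open>H lies below T: the source contributes nothing, and the stretch of levels
        upwards from H starts outside the support of the target.\<close>
      then have "Hom H T = {}" using Hom_empty_iff[OF H(1) T] by simp
      then have "finsum K ?u (hom_index S T G) = \<zero>\<^bsub>K\<^esub>" using sum by (simp add: hom_index_def)
      moreover have "interval_map (S \<inter> {lev T..}) G H \<alpha> j = None" for j
        using False le by (auto simp: interval_map_def)
      ultimately show ?thesis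
        using True by (simp add: augmentation_def ind_def interval_index_def)
    qed
  qed
qed

lemma augmentation_surj:
  assumes T: "T \<in> U" and G: "G \<in> U"
  shows "augmentation S T G ` carrier (obj (hom_functor S T) G) = carrier (obj (ind (S \<inter> {lev T..})) G)"
proof
  note l = finsum_lin[OF finite_hom_index[OF T G, of S]]
  show "augmentation S T G ` carrier (obj (hom_functor S T) G) \<subseteq> carrier (obj (ind (S \<inter> {lev T..})) G)"
    using lin_closed[OF l] by (auto simp: augmentation_def carrier_ind obj_hom_functor)
  show "carrier (obj (ind (S \<inter> {lev T..})) G) \<subseteq> augmentation S T G ` carrier (obj (hom_functor S T) G)"
  proof
    fix v assume v: "v \<in> carrier (obj (ind (S \<inter> {lev T..})) G)"
    show "v \<in> augmentation S T G ` carrier (obj (hom_functor S T) G)"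
    proof (cases "lev G \<in> S \<and> lev T \<le> lev G")
      case True
      obtain \<gamma> where g: "\<gamma> \<in> Hom G T" using Hom_ex[OF G T] True by blast
      define i where "i = code T G \<gamma>"
      have i: "i \<in> hom_index S T G" using g True by (auto simp: i_def hom_index_def)
      have v0: "v 0 \<in> carrier K" using v True by (auto simp: carrier_ind interval_index_def)
      let ?z = "single (hom_index S T G) (\<lambda>_. scalar_module K) i (v 0)"
      have "finsum K ?z (hom_index S T G) = ?z i"
        using i v0 by (intro K.finsum_single finite_hom_index T G) (auto simp: single_def)
      also have "\<dots> = v 0" using i by (simp add: single_def)
      finally have "augmentation S T G ?z = (\<lambda>j\<in>interval_index (S \<inter> {lev T..}) G. v 0)"
        by (simp add: augmentation_def)
      also have "\<dots> = v"
        using v True by (auto simp: carrier_ind interval_index_def PiE_iff extensional_def fun_eq_iff)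
      finally have "v = augmentation S T G ?z" by simp
      moreover have "?z \<in> carrier (obj (hom_functor S T) G)"
        using v0 by (auto simp: obj_hom_functor single_def)
      ultimately show ?thesis by (rule image_eqI)
    next
      case False
      define z where "z = (\<lambda>j\<in>hom_index S T G. \<zero>\<^bsub>K\<^esub>)"
      have "interval_index (S \<inter> {lev T..}) G = {}" using False by (auto simp: interval_index_def)
      then have "v = augmentation S T G z"
        using v by (simp add: carrier_ind augmentation_def restrict_def)
      moreover have "z \<in> carrier (obj (hom_functor S T) G)" by (auto simp: obj_hom_functor z_def)
      ultimately show ?thesis by (rule image_eqI)
    qed
  qed
qed

text \<open>The kernel of the augmentation is spanned by differences of two morphisms to \<open>T\<close>, and
  every pair of morphisms to \<open>T\<close> is induced from level at most \<open>2 * lev T\<close>.\<close>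

lemma augmentation_kernel_fg:
  assumes T: "T \<in> U" and S: "down_closed S"
  shows "finitely_generated K U (sub_functor (hom_functor S T)
    (\<lambda>G. {v \<in> carrier (obj (hom_functor S T) G).
       augmentation S T G v = \<zero>\<^bsub>obj (ind (S \<inter> {lev T..})) G\<^esub>}))"
proof -
  let ?E = "hom_functor S T"
  have E: "is_functor K U ?E" by (rule is_functor_hom_functor[OF T S])
  define A where "A = (\<lambda>G. {v \<in> carrier (obj ?E G).
       augmentation S T G v = \<zero>\<^bsub>obj (ind (S \<inter> {lev T..})) G\<^esub>})"
  have A: "is_subfunctor K U ?E A"
    unfolding A_def by (rule is_subfunctor_kernel[OF E is_functor_ind nat_trans_augmentation[OF T S]])
  have fA: "is_functor K U (sub_functor ?E A)" by (rule is_functor_sub_functor[OF E A])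
  define \<delta> where "\<delta> G \<gamma> = single (hom_index S T G) (\<lambda>_. scalar_module K) (code T G \<gamma>) \<one>\<^bsub>K\<^esub>" for G \<gamma>
  have \<delta>c: "\<delta> G \<gamma> \<in> carrier (obj ?E G)" for G \<gamma>
    by (auto simp: \<delta>_def obj_hom_functor single_def)
  have sum\<delta>: "finsum K (\<delta> G \<gamma>) (hom_index S T G) = \<one>\<^bsub>K\<^esub>"
    if "G \<in> U" "lev G \<in> S" "\<gamma> \<in> Hom G T" for G \<gamma>
  proof -
    have i: "code T G \<gamma> \<in> hom_index S T G" using that by (simp add: hom_index_def)
    have "finsum K (\<delta> G \<gamma>) (hom_index S T G) = \<delta> G \<gamma> (code T G \<gamma>)"
      using i by (intro K.finsum_single finite_hom_index T that) (auto simp: \<delta>_def single_def)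
    then show ?thesis using i by (simp add: \<delta>_def single_def)
  qed
  define d where "d G \<gamma> \<gamma>' = \<delta> G \<gamma> \<ominus>\<^bsub>obj ?E G\<^esub> \<delta> G \<gamma>'" for G \<gamma> \<gamma>'
  have dA: "d G \<gamma> \<gamma>' \<in> A G" if *: "G \<in> U" "lev G \<in> S" "\<gamma> \<in> Hom G T" "\<gamma>' \<in> Hom G T" for G \<gamma> \<gamma>'
  proof -
    interpret M: Module.module K "obj ?E G" by (rule functor_module[OF E *(1)])
    interpret N: Module.module K "obj (ind (S \<inter> {lev T..})) G" by (rule functor_module[OF is_functor_ind *(1)])
    note l = nat_trans_lin[OF nat_trans_augmentation[OF T S] *(1)]
    have "augmentation S T G (\<delta> G \<gamma>) = augmentation S T G (\<delta> G \<gamma>')"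
      using * sum\<delta> by (simp add: augmentation_def)
    then have "augmentation S T G (d G \<gamma> \<gamma>') = \<zero>\<^bsub>obj (ind (S \<inter> {lev T..})) G\<^esub>"
      unfolding d_def lin_diff[OF M.module_axioms N.module_axioms l \<delta>c \<delta>c]
      using lin_closed[OF l \<delta>c] by (simp add: a_minus_def N.r_neg)
    then show ?thesis using \<delta>c by (simp add: A_def d_def)
  qed
  have arr_d: "arr ?E G H \<alpha> (d H \<beta> \<beta>') = d G (comp_class G \<beta> \<alpha>) (comp_class G \<beta>' \<alpha>)"
    if *: "G \<in> U" "H \<in> U" "\<alpha> \<in> Hom G H" "\<beta> \<in> Hom H T" "\<beta>' \<in> Hom H T" "lev G \<in> S" for G H \<alpha> \<beta> \<beta>'
  proof -
    have "arr ?E G H \<alpha> (\<delta> H \<epsilon>) = \<delta> G (comp_class G \<epsilon> \<alpha>)" if "\<epsilon> \<in> Hom H T" for \<epsilon>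
      unfolding hom_functor_def \<delta>_def
      using copower_hom_arr_single[OF is_functor_const_functor[OF K.is_cring] T S *(1-3) that *(6)]
      by (simp del: copower_simps)
    then show ?thesis
      unfolding d_def lin_diff[OF functor_module[OF E *(2)] functor_module[OF E *(1)] functor_arr[OF E *(1-3)] \<delta>c \<delta>c]
      using * by simp
  qed
  define \<Gamma> where "\<Gamma> = (\<Union>j\<in>{..lev T + lev T} \<inter> S. (\<lambda>(\<gamma>, \<gamma>'). (R j, d (R j) \<gamma> \<gamma>')) ` (Hom (R j) T \<times> Hom (R j) T))"
  have "generates K U (sub_functor ?E A) \<Gamma>"
  proof (rule generatesI)
    show "finite \<Gamma>" unfolding \<Gamma>_def using R_in T finite_Hom by (intro finite_UN_I) auto
    show "G \<in> U \<and> x \<in> carrier (obj (sub_functor ?E A) G)" if "(G, x) \<in> \<Gamma>" for G x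
      using that dA[OF R_in] R_in lev_R by (auto simp: \<Gamma>_def)
    fix W V assume W: "W \<in> U" and V: "subspace K V (obj (sub_functor ?E A) W)"
      and gen: "\<And>G x \<alpha>. (G, x) \<in> \<Gamma> \<Longrightarrow> \<alpha> \<in> Hom W G \<Longrightarrow> arr (sub_functor ?E A) W G \<alpha> x \<in> V"
    interpret V: LinearCombinations.submodule K V "obj (sub_functor ?E A) W" by (rule V)
    interpret M: Module.module K "obj ?E W" by (rule functor_module[OF E W])
    show "carrier (obj (sub_functor ?E A) W) \<subseteq> V"
    proof (cases "hom_index S T W = {}")
      case True
      then have "A W \<subseteq> {\<zero>\<^bsub>obj ?E W\<^esub>}" by (auto simp: A_def obj_hom_functor)
      then show ?thesis using V.zero_closed by auto
    next
      case False
      then obtain \<gamma>0 where lW: "lev W \<in> S" and g0: "\<gamma>0 \<in> Hom W T"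
        by (auto simp: hom_index_def split: if_splits)
      have dV: "d W \<gamma> \<gamma>0 \<in> V" if g: "\<gamma> \<in> Hom W T" for \<gamma>
      proof -
        obtain j \<epsilon> \<gamma>' \<gamma>0' where j: "j \<le> lev T + lev T" and e: "\<epsilon> \<in> Hom W (R j)"
          and g': "\<gamma>' \<in> Hom (R j) T" "comp_class W \<gamma>' \<epsilon> = \<gamma>"
          and g0': "\<gamma>0' \<in> Hom (R j) T" "comp_class W \<gamma>0' \<epsilon> = \<gamma>0"
          using factor[OF W T T g g0] by blast
        \<comment> \<open>The middle object receives a morphism from W, so its level stays in the
          initial segment S.\<close>
        have "j \<le> lev W" using Hom_lev[OF W R_in e] by (simp add: lev_R)
        then have "j \<in> S" using lW S by (auto simp: down_closed_def)
        then have "(R j, d (R j) \<gamma>' \<gamma>0') \<in> \<Gamma>" using j g' g0' by (auto simp: \<Gamma>_def)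
        from gen[OF this e] show ?thesis using arr_d[OF W R_in e g'(1) g0'(1) lW] g'(2) g0'(2) by simp
      qed
      define \<sigma> where "\<sigma> z = finsum K z (hom_index S T W)" for z
      have \<sigma>: "\<sigma> \<in> lin K (obj ?E W) (scalar_module K)"
        unfolding \<sigma>_def[abs_def] obj_hom_functor by (rule finsum_lin[OF finite_hom_index[OF T W]])
      have \<sigma>c: "\<sigma> z \<in> carrier K" if "z \<in> carrier (obj ?E W)" for z using lin_closed[OF \<sigma> that] by simp
      \<comment> \<open>Modulo V every z is a multiple of the basis vector at the fixed morphism
        \<gamma>0, with coefficient \<sigma> z. On the kernel of the augmentation this coefficient
        is 0, so the kernel lies in V.\<close>
      let ?P = "\<lambda>z. z \<ominus>\<^bsub>obj ?E W\<^esub> \<sigma> z \<odot>\<^bsub>obj ?E W\<^esub> \<delta> W \<gamma>0 \<in> V"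
      have P: "?P z" if z: "z \<in> carrier (obj ?E W)" for z
      proof (rule prod_module_induct[OF finite_hom_index[OF T W] _ z[unfolded obj_hom_functor], of K ?P])
        show "Module.module K (scalar_module K)" by (rule module_scalar_module[OF K.is_cring])
        have "\<sigma> \<zero>\<^bsub>obj ?E W\<^esub> = \<zero>\<^bsub>K\<^esub>"
          using lin_zero[OF M.module_axioms module_scalar_module[OF K.is_cring] \<sigma>] by simp
        then have "?P \<zero>\<^bsub>obj ?E W\<^esub>"
          using V.zero_closed \<delta>c[of W \<gamma>0] by (simp add: a_minus_def M.neg_zero)
        then show "?P \<zero>\<^bsub>prod_module (hom_index S T W) (\<lambda>_. scalar_module K)\<^esub>"
          by (simp only: obj_hom_functor)
        fix x y assume x: "x \<in> carrier (prod_module (hom_index S T W) (\<lambda>_. scalar_module K))"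
          and y: "y \<in> carrier (prod_module (hom_index S T W) (\<lambda>_. scalar_module K))" and P: "?P x" "?P y"
        have xy: "x \<in> carrier (obj ?E W)" "y \<in> carrier (obj ?E W)" using x y by (simp_all only: obj_hom_functor)
        have "(x \<oplus>\<^bsub>obj ?E W\<^esub> y) \<ominus>\<^bsub>obj ?E W\<^esub> \<sigma> (x \<oplus>\<^bsub>obj ?E W\<^esub> y) \<odot>\<^bsub>obj ?E W\<^esub> \<delta> W \<gamma>0
          = (x \<ominus>\<^bsub>obj ?E W\<^esub> \<sigma> x \<odot>\<^bsub>obj ?E W\<^esub> \<delta> W \<gamma>0) \<oplus>\<^bsub>obj ?E W\<^esub> (y \<ominus>\<^bsub>obj ?E W\<^esub> \<sigma> y \<odot>\<^bsub>obj ?E W\<^esub> \<delta> W \<gamma>0)"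
          using xy \<sigma>c \<delta>c by (simp add: lin_add[OF \<sigma> xy] M.smult_l_distr M.add_diff_add)
        then have "?P (x \<oplus>\<^bsub>obj ?E W\<^esub> y)" using V.m_closed[OF P] by simp
        then show "?P (x \<oplus>\<^bsub>prod_module (hom_index S T W) (\<lambda>_. scalar_module K)\<^esub> y)"
          by (simp only: obj_hom_functor)
      next
        fix i a assume i: "i \<in> hom_index S T W" and a: "a \<in> carrier (scalar_module K)"
        obtain \<gamma> where g: "\<gamma> \<in> Hom W T" "i = code T W \<gamma>" using i by (auto simp: hom_index_def split: if_splits)
        have s: "single (hom_index S T W) (\<lambda>_. scalar_module K) i a = a \<odot>\<^bsub>obj ?E W\<^esub> \<delta> W \<gamma>"
          using a g by (auto simp: obj_hom_functor \<delta>_def single_def fun_eq_iff)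
        have "\<sigma> (a \<odot>\<^bsub>obj ?E W\<^esub> \<delta> W \<gamma>) = a"
          using a lin_smult[OF \<sigma> _ \<delta>c] sum\<delta>[OF W lW g(1)] by (simp add: \<sigma>_def)
        then have "a \<odot>\<^bsub>obj ?E W\<^esub> \<delta> W \<gamma> \<ominus>\<^bsub>obj ?E W\<^esub> \<sigma> (a \<odot>\<^bsub>obj ?E W\<^esub> \<delta> W \<gamma>) \<odot>\<^bsub>obj ?E W\<^esub> \<delta> W \<gamma>0
          = a \<odot>\<^bsub>obj ?E W\<^esub> d W \<gamma> \<gamma>0"
          using a \<delta>c by (simp add: d_def a_minus_def M.smult_r_distr M.smult_r_minus)
        then show "?P (single (hom_index S T W) (\<lambda>_. scalar_module K) i a)"
          unfolding s using V.smult_closed[OF _ dV[OF g(1)], of a] a by simp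
      qed
      show ?thesis
      proof
        fix z assume "z \<in> carrier (obj (sub_functor ?E A) W)"
        then have z: "z \<in> carrier (obj ?E W)" and aug: "augmentation S T W z = \<zero>\<^bsub>obj (ind (S \<inter> {lev T..})) W\<^esub>"
          by (auto simp: A_def)
        have "lev T \<le> lev W" by (rule Hom_lev[OF W T g0])
        then have "\<sigma> z = \<zero>\<^bsub>K\<^esub>"
          using fun_cong[OF aug, of 0] lW by (simp add: augmentation_def \<sigma>_def ind_def interval_index_def)
        then have "z \<ominus>\<^bsub>obj ?E W\<^esub> \<sigma> z \<odot>\<^bsub>obj ?E W\<^esub> \<delta> W \<gamma>0 = z"
          using z \<delta>c by (simp add: a_minus_def M.neg_zero)
        then show "z \<in> V" using P[OF z] by simp
      qed
    qed
  qed
  from finitely_generated_of_generates[OF fA this] show ?thesis by (simp add: A_def)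
qed

end

section \<open>Supports\<close>

lemma tensor_product_sym:
  assumes "tensor_product K M N T b"
  shows "tensor_product K N M T (\<lambda>y x. b x y)"
proof -
  have flip: "bilinear_map K N M W (\<lambda>y x. c x y) \<longleftrightarrow> bilinear_map K M N W c"
    for W :: "('a, 'b) module" and c
    by (auto simp: bilinear_map_def)
  have "\<exists>!h. h \<in> lin K T W \<inter> extensional (carrier T) \<and> (\<forall>y\<in>carrier N. \<forall>x\<in>carrier M. h (b x y) = c y x)"
    if W: "Module.module K W \<and> bilinear_map K N M W c" for W :: "('a, 'b) module" and c
  proof -
    have "\<exists>!h. h \<in> lin K T W \<inter> extensional (carrier T) \<and> (\<forall>x\<in>carrier M. \<forall>y\<in>carrier N. h (b x y) = c y x)"
      using assms W flip[of W "\<lambda>x y. c y x"] unfolding tensor_product_def by blast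
    moreover have "(\<forall>x\<in>carrier M. \<forall>y\<in>carrier N. h (b x y) = c y x) \<longleftrightarrow>
      (\<forall>y\<in>carrier N. \<forall>x\<in>carrier M. h (b x y) = c y x)" for h by blast
    ultimately show ?thesis by simp
  qed
  then show ?thesis using assms flip unfolding tensor_product_def by blast
qed

lemma is_tensor_sym:
  assumes "is_tensor K U X Y Z"
  shows "is_tensor K U Y X Z"
proof -
  obtain b where b: "\<And>G. G \<in> U \<Longrightarrow> tensor_product K (obj X G) (obj Y G) (obj Z G) (b G)"
    "\<And>G H \<alpha> x y. G \<in> U \<Longrightarrow> H \<in> U \<Longrightarrow> \<alpha> \<in> Hom G H \<Longrightarrow> x \<in> carrier (obj X H) \<Longrightarrow> y \<in> carrier (obj Y H) \<Longrightarrow>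
      arr Z G H \<alpha> (b H x y) = b G (arr X G H \<alpha> x) (arr Y G H \<alpha> y)"
    using assms unfolding is_tensor_def by blast
  show ?thesis
    unfolding is_tensor_def
  proof (intro exI[of _ "\<lambda>G y x. b G x y"] conjI ballI)
    show "tensor_product K (obj Y G) (obj X G) (obj Z G) (\<lambda>y x. b G x y)" if "G \<in> U" for G
      by (rule tensor_product_sym[OF b(1)[OF that]])
  qed (rule b(2))
qed

definition vanishes :: "('k, 'v) functor_data \<Rightarrow> nat monoid \<Rightarrow> bool" where
  "vanishes X G \<longleftrightarrow> carrier (obj X G) = {\<zero>\<^bsub>obj X G\<^esub>}"

lemma short_exact_vanishes:
  assumes A: "is_functor K U A" and B: "is_functor K U B" and C: "is_functor K U C"
    and e: "short_exact K U A \<phi> B \<psi> C" and G: "G \<in> U"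
  shows "vanishes B G \<longleftrightarrow> vanishes A G \<and> vanishes C G"
proof -
  interpret A: Module.module K "obj A G" by (rule functor_module[OF A G])
  interpret B: Module.module K "obj B G" by (rule functor_module[OF B G])
  interpret C: Module.module K "obj C G" by (rule functor_module[OF C G])
  have l: "\<phi> G \<in> lin K (obj A G) (obj B G)" "\<psi> G \<in> lin K (obj B G) (obj C G)"
    and inj: "inj_on (\<phi> G) (carrier (obj A G))"
    and im: "\<phi> G ` carrier (obj A G) = {b \<in> carrier (obj B G). \<psi> G b = \<zero>\<^bsub>obj C G\<^esub>}"
    and surj: "\<psi> G ` carrier (obj B G) = carrier (obj C G)"
    using e G by (auto simp: short_exact_def nat_trans_def)
  have z: "\<phi> G \<zero>\<^bsub>obj A G\<^esub> = \<zero>\<^bsub>obj B G\<^esub>" "\<psi> G \<zero>\<^bsub>obj B G\<^esub> = \<zero>\<^bsub>obj C G\<^esub>"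
    by (rule lin_zero[OF A.module_axioms B.module_axioms l(1)],
        rule lin_zero[OF B.module_axioms C.module_axioms l(2)])
  show ?thesis
  proof
    assume v: "vanishes B G"
    have "carrier (obj C G) = {\<zero>\<^bsub>obj C G\<^esub>}" using surj v z by (simp add: vanishes_def)
    moreover have "x = \<zero>\<^bsub>obj A G\<^esub>" if x: "x \<in> carrier (obj A G)" for x
    proof -
      have "\<phi> G x = \<phi> G \<zero>\<^bsub>obj A G\<^esub>" using lin_closed[OF l(1) x] v z by (simp add: vanishes_def)
      then show ?thesis using inj x A.zero_closed by (meson inj_onD)
    qed
    ultimately show "vanishes A G \<and> vanishes C G" by (auto simp: vanishes_def)
  next
    assume v: "vanishes A G \<and> vanishes C G"
    have "b = \<zero>\<^bsub>obj B G\<^esub>" if b: "b \<in> carrier (obj B G)" for b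
    proof -
      have "\<psi> G b = \<zero>\<^bsub>obj C G\<^esub>" using lin_closed[OF l(2) b] v by (simp add: vanishes_def)
      then have "b \<in> \<phi> G ` carrier (obj A G)" using im b by simp
      then show ?thesis using v z by (simp add: vanishes_def)
    qed
    then show "vanishes B G" by (auto simp: vanishes_def)
  qed
qed

text \<open>Over a field a tensor product vanishes only together with one of its factors. Supports
  therefore intersect under tensor products, which is the source of primality.\<close>

lemma is_tensor_vanishes_iff:
  assumes K: "Ring.field K" and X: "is_functor K U X" and Y: "is_functor K U Y"
    and t: "is_tensor K U X Y Z" and G: "G \<in> U"
  shows "vanishes Z G \<longleftrightarrow> vanishes X G \<or> vanishes Y G"
proof -
  obtain b where b: "tensor_product K (obj X G) (obj Y G) (obj Z G) b"
    using t G unfolding is_tensor_def by blast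
  note X' = functor_module[OF X G] and Y' = functor_module[OF Y G]
  show ?thesis
    unfolding vanishes_def
    using tensor_product_eq_zero[OF b X'] tensor_product_eq_zero[OF tensor_product_sym[OF b] Y']
      tensor_product_neq_zero[OF K b X' Y'] by blast
qed

section \<open>Dependence on the level, and elements that stay alive\<close>

context field_level_category
begin

lemma nonvanishing_ex:
  assumes "is_functor K U X" "G \<in> U" "\<not> vanishes X G"
  obtains x where "x \<in> carrier (obj X G)" "x \<noteq> \<zero>\<^bsub>obj X G\<^esub>"
  using assms functor_zero_closed[OF assms(1,2)] by (auto simp: vanishes_def)

text \<open>Lift the identity of G along \<beta>; equality of the levels permits this.\<close>

lemma right_inverse:
  assumes "G \<in> U" "H \<in> U" "lev H = lev G" "\<beta> \<in> Hom H G"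
  obtains \<gamma> where "\<gamma> \<in> Hom G H" "comp_class G \<beta> \<gamma> = id_class G"
  using lift[OF assms(1,2,1) id_Hom[OF assms(1)] assms(4)] assms(3) by auto

text \<open>A right inverse of \<beta> takes the pullback of x back to x, so pulling back between
  equal levels is injective.\<close>

lemma arr_neq_zero_of_lev_eq:
  assumes X: "is_functor K U X" and G: "G \<in> U" "H \<in> U" "lev H = lev G" "\<beta> \<in> Hom H G"
    and x: "x \<in> carrier (obj X G)" "arr X H G \<beta> x = \<zero>\<^bsub>obj X H\<^esub>"
  shows "x = \<zero>\<^bsub>obj X G\<^esub>"
proof -
  obtain \<gamma> where g: "\<gamma> \<in> Hom G H" "comp_class G \<beta> \<gamma> = id_class G" using right_inverse[OF G] .
  have "x = arr X G H \<gamma> (arr X H G \<beta> x)"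
    using functor_comp[OF X G(1,2,1) g(1) G(4) x(1)] functor_id[OF X G(1) x(1)] g(2) by simp
  then show ?thesis using x(2) functor_arr_zero[OF X G(1,2) g(1)] by simp
qed

text \<open>Groups of equal level are joined by a morphism, and pulling back along it is injective.
  So vanishing depends on the level alone.\<close>

lemma vanishes_lev_eq:
  assumes X: "is_functor K U X" and G: "G \<in> U" "H \<in> U" "lev G = lev H" and v: "vanishes X H"
  shows "vanishes X G"
proof -
  obtain \<beta> where b: "\<beta> \<in> Hom H G" using Hom_ex[OF G(2,1)] G(3) by auto
  have "x = \<zero>\<^bsub>obj X G\<^esub>" if x: "x \<in> carrier (obj X G)" for x
    using functor_arr_closed[OF X G(2,1) b x] v
    by (intro arr_neq_zero_of_lev_eq[OF X G(1,2) G(3)[symmetric] b x]) (simp add: vanishes_def)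
  then show ?thesis unfolding vanishes_def using functor_zero_closed[OF X G(1)] by blast
qed

lemma vanishes_ind_iff: "vanishes (ind A) G \<longleftrightarrow> lev G \<notin> A"
proof
  assume v: "vanishes (ind A) G"
  show "lev G \<notin> A"
  proof
    assume l: "lev G \<in> A"
    then have "(\<lambda>j\<in>{0}. \<one>\<^bsub>K\<^esub>) \<in> carrier (obj (ind A) G)" by (simp add: carrier_ind interval_index_def)
    then have "(\<lambda>j\<in>{0::nat}. \<one>\<^bsub>K\<^esub>) = (\<lambda>j\<in>{0}. \<zero>\<^bsub>K\<^esub>)"
      using v unfolding vanishes_def by (simp only: singleton_iff) (simp add: ind_def interval_index_def l)
    from fun_cong[OF this, of 0] show False by simp
  qed
qed (auto simp: vanishes_def ind_def interval_index_def)

text \<open>If \<open>A\<close> is an initial segment of the levels, tensoring with \<open>ind A\<close> truncates.\<close>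

lemma is_tensor_ind:
  assumes X: "is_functor K U X" and A: "down_closed A"
    and v: "\<And>G. G \<in> U \<Longrightarrow> lev G \<notin> A \<Longrightarrow> vanishes X G"
  shows "is_tensor K U X (ind A) X"
proof -
  define \<phi> where "\<phi> G z = (if lev G \<in> A then z 0 else \<zero>\<^bsub>obj X G\<^esub>)" for G and z :: "nat \<Rightarrow> nat \<Rightarrow> 'k"
  define b where "b G x c = \<phi> G (\<lambda>i\<in>interval_index A G. c i \<odot>\<^bsub>obj X G\<^esub> x)" for G and x c :: "nat \<Rightarrow> 'k"
  show ?thesis
    unfolding is_tensor_def
  proof (intro exI[of _ b] conjI ballI)
    fix G assume G: "G \<in> U"
    interpret M: Module.module K "obj X G" by (rule functor_module[OF X G])
    show "tensor_product K (obj X G) (obj (ind A) G) (obj X G) (b G)"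
      unfolding b_def[abs_def] ind_def copower_simps(1) const_functor_simps(1)
    proof (rule tensor_product_free[OF K.is_cring M.module_axioms _ M.module_axioms])
      show "finite (interval_index A G)" by (simp add: interval_index_def)
      show "\<phi> G \<in> lin K (prod_module (interval_index A G) (\<lambda>_. obj X G)) (obj X G)"
        by (rule linI) (auto simp: \<phi>_def interval_index_def)
      show "bij_betw (\<phi> G) (carrier (prod_module (interval_index A G) (\<lambda>_. obj X G))) (carrier (obj X G))"
      proof (cases "lev G \<in> A")
        case True
        then have \<phi>: "\<phi> G = (\<lambda>z. z 0)" and I: "interval_index A G = {0}"
          by (auto simp: \<phi>_def interval_index_def)
        show ?thesis
          unfolding \<phi> I prod_module_simps(1)
        proof (rule bij_betwI[of _ _ _ "\<lambda>m. \<lambda>j\<in>{0}. m"])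
          show "(\<lambda>j\<in>{0}. z 0) = z" if "z \<in> {0::nat} \<rightarrow>\<^sub>E carrier (obj X G)" for z
            using that by (intro ext) (auto simp: PiE_iff extensional_def)
        qed auto
      next
        case False
        then show ?thesis
          using v[OF G] by (simp add: \<phi>_def interval_index_def bij_betw_def vanishes_def)
      qed
    qed
    fix H \<alpha> x c assume H: "H \<in> U" "\<alpha> \<in> Hom G H" and x: "x \<in> carrier (obj X H)"
      and c: "c \<in> carrier (obj (ind A) H)"
    have xc: "arr X G H \<alpha> x \<in> carrier (obj X G)" by (rule functor_arr_closed[OF X G H x])
    show "arr X G H \<alpha> (b H x c) = b G (arr X G H \<alpha> x) (arr (ind A) G H \<alpha> c)"
    proof (cases "lev G \<in> A")
      case True
      have "lev H \<le> lev G" by (rule Hom_lev[OF G H])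
      then have "{lev H..lev G} \<subseteq> A" "lev H \<in> A" using A True by (auto simp: down_closed_def)
      moreover have "c 0 \<in> carrier K" using c calculation by (auto simp: carrier_ind interval_index_def)
      ultimately show ?thesis
        using True lin_smult[OF functor_arr[OF X G H] _ x]
        by (simp add: b_def \<phi>_def ind_def interval_index_def interval_map_def)
    next
      case False
      interpret N: Module.module K "obj X H" by (rule functor_module[OF X H(1)])
      have "b H x c \<in> carrier (obj X H)"
        using x c by (auto simp: b_def \<phi>_def interval_index_def carrier_ind)
      then have "arr X G H \<alpha> (b H x c) = \<zero>\<^bsub>obj X G\<^esub>"
        using functor_arr_closed[OF X G H] v[OF G False] by (simp add: vanishes_def)
      then show ?thesis using False by (simp add: b_def \<phi>_def)
    qed
  qed
qed

text \<open>This feeds primality: a prime contains zero, hence at least one of any two finitely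
  generated functors with disjoint supports.\<close>

lemma is_tensor_zero:
  assumes X: "is_functor K U X" and Y: "is_functor K U Y"
    and v: "\<And>G. G \<in> U \<Longrightarrow> vanishes X G \<or> vanishes Y G"
  shows "is_tensor K U X Y (ind {})"
  unfolding is_tensor_def
proof (intro exI[of _ "\<lambda>G _ _. \<zero>\<^bsub>obj (ind {}) G\<^esub>"] conjI ballI)
  fix G assume G: "G \<in> U"
  show "tensor_product K (obj X G) (obj Y G) (obj (ind {}) G) (\<lambda>_ _. \<zero>\<^bsub>obj (ind {}) G\<^esub>)"
    using v[OF G] vanishes_ind_iff[of "{}" G]
    by (intro tensor_product_zero functor_module[OF X G] functor_module[OF Y G]
        functor_module[OF is_functor_ind G]) (simp_all add: vanishes_def)
  show "arr (ind {}) G H \<alpha> \<zero>\<^bsub>obj (ind {}) H\<^esub> = \<zero>\<^bsub>obj (ind {}) G\<^esub>" if "H \<in> U" "\<alpha> \<in> Hom G H" for H \<alpha>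
    by (rule functor_arr_zero[OF is_functor_ind G that])
qed

text \<open>Below the level of T there are no morphisms to T and the condition is vacuous. These
  levels count as alive, which makes the set an initial segment of all levels.\<close>

definition alive :: "('k, nat \<Rightarrow> 'k) functor_data \<Rightarrow> nat monoid \<Rightarrow> (nat \<Rightarrow> 'k) \<Rightarrow> nat set" where
  "alive X T x = {k. \<forall>W\<in>U. lev W = k \<longrightarrow> (\<forall>\<gamma>\<in>Hom W T. arr X W T \<gamma> x \<noteq> \<zero>\<^bsub>obj X W\<^esub>)}"

text \<open>Some \<gamma>' from the same level kills x, and by lifting \<gamma> factors through it.
  So one dead morphism kills its whole level.\<close>

lemma not_alive_arr:
  assumes X: "is_functor K U X" and T: "T \<in> U" and x: "x \<in> carrier (obj X T)"
    and W: "W \<in> U" "lev W \<notin> alive X T x" "\<gamma> \<in> Hom W T"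
  shows "arr X W T \<gamma> x = \<zero>\<^bsub>obj X W\<^esub>"
proof -
  obtain W' \<gamma>' where W': "W' \<in> U" "lev W' = lev W" "\<gamma>' \<in> Hom W' T" "arr X W' T \<gamma>' x = \<zero>\<^bsub>obj X W'\<^esub>"
    using W(2) by (auto simp: alive_def)
  obtain \<delta> where d: "\<delta> \<in> Hom W W'" "comp_class W \<gamma>' \<delta> = \<gamma>"
    using lift[OF W(1) W'(1) T W(3) W'(3)] W'(2) by auto
  show ?thesis
    using functor_comp[OF X W(1) W'(1) T d(1) W'(3) x] d(2) W'(4) functor_arr_zero[OF X W(1) W'(1) d(1)] by simp
qed

lemma down_closed_alive:
  assumes X: "is_functor K U X" and T: "T \<in> U" and x: "x \<in> carrier (obj X T)"
  shows "down_closed (alive X T x)"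
  unfolding down_closed_def
proof (intro ballI allI impI)
  fix n m assume n: "n \<in> alive X T x" and m: "m \<le> n"
  show "m \<in> alive X T x"
    unfolding alive_def
  proof (intro CollectI ballI impI notI)
    fix W \<gamma> assume W: "W \<in> U" "lev W = m" "\<gamma> \<in> Hom W T" and z: "arr X W T \<gamma> x = \<zero>\<^bsub>obj X W\<^esub>"
    \<comment> \<open>If x were dead at level m, precomposing with a morphism from level n would
      make it dead at level n too.\<close>
    obtain \<delta> where d: "\<delta> \<in> Hom (R n) W" using Hom_ex[OF R_in W(1)] lev_R W(2) m by auto
    have "arr X (R n) T (comp_class (R n) \<gamma> \<delta>) x = \<zero>\<^bsub>obj X (R n)\<^esub>"
      using functor_comp[OF X R_in W(1) T d W(3) x] z functor_arr_zero[OF X R_in W(1) d] by simp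
    moreover have "comp_class (R n) \<gamma> \<delta> \<in> Hom (R n) T" by (rule comp_Hom[OF R_in W(1) T d W(3)])
    ultimately show False using n R_in lev_R unfolding alive_def by blast
  qed
qed

lemma lev_alive:
  assumes X: "is_functor K U X" and T: "T \<in> U" and x: "x \<in> carrier (obj X T)" "x \<noteq> \<zero>\<^bsub>obj X T\<^esub>"
  shows "lev T \<in> alive X T x"
  unfolding alive_def using arr_neq_zero_of_lev_eq[OF X T] x by blast

text \<open>The elements \<open>\<gamma>\<^sup>* x \<otimes> \<gamma>\<close> of \<open>X \<otimes> e_T\<close> are linearly independent as
  long as they are nonzero, so \<open>x\<close> embeds a truncation of \<open>e_T\<close> in \<open>X \<otimes> e_T\<close>.\<close>

lemma hom_functor_in_ideal:
  assumes D: "serre_ideal K U D" and X: "X \<in> D" and T: "T \<in> U"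
    and x: "x \<in> carrier (obj X T)" "x \<noteq> \<zero>\<^bsub>obj X T\<^esub>"
  shows "hom_functor (alive X T x) T \<in> D"
proof -
  have sD: "serre_subcategory K U D" using D by (simp add: serre_ideal_def)
  have Xfg: "X \<in> fg_functors K U" by (rule serre_fg[OF sD X])
  have fX: "is_functor K U X" by (rule fg_functorsD[OF Xfg])
  define S where "S = alive X T x"
  have S: "down_closed S" unfolding S_def by (rule down_closed_alive[OF fX T x(1)])
  have lT: "lev T \<in> S" unfolding S_def by (rule lev_alive[OF fX T x])
  define Z where "Z = tens X (hom_index UNIV T) (hom_map T)"
  let ?C = "copower X (hom_index UNIV T) (hom_map T)"
  have I: "index_system U (hom_index UNIV T) (hom_map T)" by (rule index_system_hom[OF T down_closed_UNIV])
  have "is_tensor K U X (hom_functor UNIV T) Z"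
    unfolding hom_functor_def Z_def by (rule is_tensor_tens[OF fX I])
  moreover have "Z \<in> fg_functors K U" unfolding Z_def by (rule tens_hom_fg[OF Xfg T])
  ultimately have ZD: "Z \<in> D"
    using D X hom_functor_fg[OF T down_closed_UNIV UNIV_I] unfolding serre_ideal_def by blast
  interpret q: image_data K U ?C "\<lambda>G. {\<zero>\<^bsub>obj ?C G\<^esub>}" "\<lambda>_. encode" "\<lambda>_. uncode"
    by (rule tens_image_data[OF fX I])
  \<comment> \<open>Sends the basis vector \<gamma> to the tensor of the pullback of x along
    \<gamma> with \<gamma> itself. Outside S that pullback is 0, in agreement with the
    truncation.\<close>
  define \<phi> where "\<phi> G c = (\<lambda>j\<in>hom_index UNIV T G.
     if lev G \<in> S then c j \<odot>\<^bsub>obj X G\<^esub> arr X G T (decode T G j) x else \<zero>\<^bsub>obj X G\<^esub>)" for G and c :: "nat \<Rightarrow> 'k"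
  have dec: "decode T G j \<in> Hom G T" if "G \<in> U" "j \<in> hom_index UNIV T G" for G j
    using that decode_code[OF that(1) T] by (auto simp: hom_index_def)
  have pull: "arr X G T (decode T G j) x \<in> carrier (obj X G)" if "G \<in> U" "j \<in> hom_index UNIV T G" for G j
    by (rule functor_arr_closed[OF fX that(1) T dec[OF that] x(1)])
  have idx: "hom_index S T G = hom_index UNIV T G" if "lev G \<in> S" for G
    using that by (simp add: hom_index_def)
  have nt: "nat_trans K U (hom_functor S T) ?C \<phi>"
    unfolding nat_trans_def
  proof (intro conjI ballI)
    fix G assume G: "G \<in> U"
    interpret M: Module.module K "obj X G" by (rule functor_module[OF fX G])
    show "\<phi> G \<in> lin K (obj (hom_functor S T) G) (obj ?C G)"
      using pull[OF G] idx[of G]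
      by (intro linI ext) (auto simp: \<phi>_def obj_hom_functor PiE_iff M.smult_l_distr M.smult_assoc1)
    fix H \<alpha> c assume H: "H \<in> U" "\<alpha> \<in> Hom G H" and c: "c \<in> carrier (obj (hom_functor S T) H)"
    have le: "lev H \<le> lev G" by (rule Hom_lev[OF G H])
    show "\<phi> G (arr (hom_functor S T) G H \<alpha> c) = arr ?C G H \<alpha> (\<phi> H c)"
    proof (rule ext)
      fix j
      show "\<phi> G (arr (hom_functor S T) G H \<alpha> c) j = arr ?C G H \<alpha> (\<phi> H c) j"
      proof (cases "j \<in> hom_index UNIV T G")
        case False
        then show ?thesis by (simp add: \<phi>_def)
      next
        case j: True
        show ?thesis
        proof (cases "hom_map T G H \<alpha> j")
          case None
          then show ?thesis using j idx[of G] pull[OF G j] by (simp add: \<phi>_def hom_functor_def)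
        next
          case (Some i)
          have i: "i \<in> hom_index UNIV T H"
            by (rule hom_index_map_closed[OF T down_closed_UNIV G H j Some])
          have "hom_map T G H \<alpha> j = Some (code T H (decode T H i))"
            using Some i decode_code[OF H(1) T] by (auto simp: hom_index_def)
          then have jc: "j = code T G (comp_class G (decode T H i) \<alpha>)"
            using hom_index_map_Some[OF T G H dec[OF H(1) i] UNIV_I j] by blast
          have "decode T G j = comp_class G (decode T H i) \<alpha>"
            unfolding jc by (rule decode_code[OF G T comp_Hom[OF G H(1) T H(2) dec[OF H(1) i]]])
          then have a: "arr X G H \<alpha> (arr X H T (decode T H i) x) = arr X G T (decode T G j) x"
            using functor_comp[OF fX G H(1) T H(2) dec[OF H(1) i] x(1)] by simp
          show ?thesis
          proof (cases "lev G \<in> S")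
            case True
            then have lH: "lev H \<in> S" using le S by (auto simp: down_closed_def)
            have "c i \<in> carrier K" using c i lH idx by (auto simp: obj_hom_functor)
            then show ?thesis
              using True lH j i idx[of G] Some a lin_smult[OF functor_arr[OF fX G H] _ pull[OF H(1) i]]
              by (simp add: \<phi>_def hom_functor_def)
          next
            case False
            have z: "arr X G T (decode T G j) x = \<zero>\<^bsub>obj X G\<^esub>"
              using False unfolding S_def by (rule not_alive_arr[OF fX T x(1) G _ dec[OF G j]])
            show ?thesis
            proof (cases "lev H \<in> S")
              case True
              then have "c i \<in> carrier K" using c i idx by (auto simp: obj_hom_functor)
              then show ?thesis
                using True False j i Some a z lin_smult[OF functor_arr[OF fX G H] _ pull[OF H(1) i]]
                by (simp add: \<phi>_def)
            next
              case False': False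
              show ?thesis using False False' j i Some functor_arr_zero[OF fX G H] by (simp add: \<phi>_def)
            qed
          qed
        qed
      qed
    qed
  qed
  have "hom_functor S T \<in> D"
  proof (rule serre_sub[OF sD ZD hom_functor_fg[OF T S lT]])
    show "nat_trans K U (hom_functor S T) Z (\<lambda>G c. encode (\<phi> G c))"
      unfolding Z_def tens_def by (rule nat_trans_comp[OF nt q.nat_trans])
    fix G assume G: "G \<in> U"
    interpret M: Module.module K "obj X G" by (rule functor_module[OF fX G])
    show "inj_on (\<lambda>c. encode (\<phi> G c)) (carrier (obj (hom_functor S T) G))"
    proof (rule inj_onI)
      fix c c' assume c: "c \<in> carrier (obj (hom_functor S T) G)" "c' \<in> carrier (obj (hom_functor S T) G)"
        and "encode (\<phi> G c) = encode (\<phi> G c')"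
      then have eq: "\<phi> G c = \<phi> G c'" by (simp add: encode_eq_iff)
      show "c = c'"
      proof (rule PiE_ext[OF c[unfolded obj_hom_functor prod_module_simps]])
        fix j assume j: "j \<in> hom_index S T G"
        then have lG: "lev G \<in> S" by (auto simp: hom_index_def split: if_splits)
        have j': "j \<in> hom_index UNIV T G" using j idx[OF lG] by simp
        \<comment> \<open>The entry at j is the coordinate times m, and m is nonzero because the
          level is alive; so the coordinate can be recovered.\<close>
        define m where "m = arr X G T (decode T G j) x"
        have m: "m \<in> carrier (obj X G)" "m \<noteq> \<zero>\<^bsub>obj X G\<^esub>"
          using pull[OF G j'] lG dec[OF G j'] G by (auto simp: m_def S_def alive_def)
        have cK: "c j \<in> carrier K" "c' j \<in> carrier K" using c j by (auto simp: obj_hom_functor)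
        have "c j \<odot>\<^bsub>obj X G\<^esub> m = c' j \<odot>\<^bsub>obj X G\<^esub> m"
          using fun_cong[OF eq, of j] j' lG by (simp add: \<phi>_def m_def)
        then have 0: "(c j \<ominus>\<^bsub>K\<^esub> c' j) \<odot>\<^bsub>obj X G\<^esub> m = \<zero>\<^bsub>obj X G\<^esub>"
          using cK m(1) by (simp add: a_minus_def M.smult_l_distr M.smult_l_minus M.r_neg)
        show "c j = c' j"
        proof (rule ccontr)
          assume ne: "c j \<noteq> c' j"
          define d where "d = c j \<ominus>\<^bsub>K\<^esub> c' j"
          have d: "d \<in> carrier K" "d \<noteq> \<zero>\<^bsub>K\<^esub>" using ne cK by (auto simp: d_def)
          then have di: "inv\<^bsub>K\<^esub> d \<in> carrier K" "inv\<^bsub>K\<^esub> d \<otimes>\<^bsub>K\<^esub> d = \<one>\<^bsub>K\<^esub>"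
            by (auto simp: K.field_Units)
          have "m = (inv\<^bsub>K\<^esub> d \<otimes>\<^bsub>K\<^esub> d) \<odot>\<^bsub>obj X G\<^esub> m" using di m by simp
          also have "\<dots> = inv\<^bsub>K\<^esub> d \<odot>\<^bsub>obj X G\<^esub> (d \<odot>\<^bsub>obj X G\<^esub> m)"
            by (rule M.smult_assoc1[OF di(1) d(1) m(1)])
          also have "\<dots> = \<zero>\<^bsub>obj X G\<^esub>" using 0 di by (simp add: d_def)
          finally show False using m(2) by simp
        qed
      qed
    qed
  qed
  then show ?thesis by (simp add: S_def)
qed

lemma down_closed_cases:
  assumes "down_closed S"
  shows "S = UNIV \<or> finite S"
proof (cases "S = UNIV")
  case False
  then obtain n where n: "n \<notin> S" by blast
  have "S \<subseteq> {..<n}" using n assms unfolding down_closed_def by (metis lessThan_iff not_le_imp_less subsetI)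
  then show ?thesis using finite_subset by blast
qed simp

lemma tame_simps:
  "finite A \<Longrightarrow> tame A" "tame {n..}" "tame UNIV" "tame (- {n})"
proof -
  have "- {n..} = {..<n}" by auto
  then show "tame {n..}" by (simp add: tame_def)
qed (simp_all add: tame_def)

lemma ind_in_ideal:
  assumes D: "serre_ideal K U D" and X: "X \<in> D" and T: "T \<in> U"
    and x: "x \<in> carrier (obj X T)" "x \<noteq> \<zero>\<^bsub>obj X T\<^esub>"
  shows "tame (alive X T x \<inter> {lev T..})" and "ind (alive X T x \<inter> {lev T..}) \<in> D"
proof -
  have sD: "serre_subcategory K U D" using D by (simp add: serre_ideal_def)
  have fX: "is_functor K U X" by (rule fg_functorsD[OF serre_fg[OF sD X]])
  have S: "down_closed (alive X T x)" by (rule down_closed_alive[OF fX T x(1)])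
  show t: "tame (alive X T x \<inter> {lev T..})"
    using down_closed_cases[OF S] by (auto simp: tame_simps)
  show "ind (alive X T x \<inter> {lev T..}) \<in> D"
    by (rule serre_quotient[OF sD hom_functor_in_ideal[OF D X T x] ind_fg[OF t]
          nat_trans_augmentation[OF T S] augmentation_surj[OF T] augmentation_kernel_fg[OF T S]])
qed

text \<open>If no element stays alive forever, each of the finitely many generators dies at some
  level, and X vanishes from the last of these levels on.\<close>

lemma support_dichotomy:
  assumes X: "X \<in> fg_functors K U"
  shows "(\<exists>N. \<forall>W\<in>U. N \<le> lev W \<longrightarrow> vanishes X W) \<or>
    (\<exists>T\<in>U. \<exists>x\<in>carrier (obj X T). x \<noteq> \<zero>\<^bsub>obj X T\<^esub> \<and> alive X T x = UNIV)"
proof (rule disjCI)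
  assume none: "\<not> (\<exists>T\<in>U. \<exists>x\<in>carrier (obj X T). x \<noteq> \<zero>\<^bsub>obj X T\<^esub> \<and> alive X T x = UNIV)"
  have fX: "is_functor K U X" by (rule fg_functorsD[OF X])
  obtain \<Gamma> where \<Gamma>: "generates K U X \<Gamma>"
    using generates_of_finitely_generated[OF fX] X by (auto simp: fg_functors_def)
  have fin: "finite \<Gamma>" using \<Gamma> by (simp add: generates_def)
  have "\<exists>n. \<forall>W\<in>U. n \<le> lev W \<longrightarrow> (\<forall>\<gamma>\<in>Hom W G. arr X W G \<gamma> x = \<zero>\<^bsub>obj X W\<^esub>)"
    if Gx: "(G, x) \<in> \<Gamma>" for G x
  proof (cases "x = \<zero>\<^bsub>obj X G\<^esub>")
    case True
    then show ?thesis using functor_arr_zero[OF fX] generates_closed[OF \<Gamma> Gx] by blast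
  next
    case False
    have G: "G \<in> U" and x: "x \<in> carrier (obj X G)" using generates_closed[OF \<Gamma> Gx] by auto
    obtain n where n: "n \<notin> alive X G x" using none G x False by blast
    have "lev W \<notin> alive X G x" if "n \<le> lev W" for W
      using n that down_closed_alive[OF fX G x] by (auto simp: down_closed_def)
    then show ?thesis using not_alive_arr[OF fX G x] by blast
  qed
  then obtain n where n: "\<And>G x W \<gamma>. (G, x) \<in> \<Gamma> \<Longrightarrow> W \<in> U \<Longrightarrow> n G x \<le> lev W \<Longrightarrow> \<gamma> \<in> Hom W G \<Longrightarrow>
      arr X W G \<gamma> x = \<zero>\<^bsub>obj X W\<^esub>"
    by metis
  define N where "N = Max (insert 0 ((\<lambda>(G, x). n G x) ` \<Gamma>))"
  have N: "n G x \<le> N" if "(G, x) \<in> \<Gamma>" for G x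
  proof -
    have "n G x \<in> insert 0 ((\<lambda>(G, x). n G x) ` \<Gamma>)" using that by force
    then show ?thesis unfolding N_def using fin by simp
  qed
  have "vanishes X W" if W: "W \<in> U" "N \<le> lev W" for W
  proof -
    interpret M: Module.module K "obj X W" by (rule functor_module[OF fX W(1)])
    have "subspace K {\<zero>\<^bsub>obj X W\<^esub>} (obj X W)"
      using is_subfunctor_zero[OF fX] W by (simp add: is_subfunctor_def)
    then have "carrier (obj X W) \<subseteq> {\<zero>\<^bsub>obj X W\<^esub>}"
    proof (rule generatesD[OF \<Gamma> W(1)])
      show "arr X W G \<gamma> x \<in> {\<zero>\<^bsub>obj X W\<^esub>}" if "(G, x) \<in> \<Gamma>" "\<gamma> \<in> Hom W G" for G x \<gamma>
        using n[OF that(1) W(1) _ that(2)] N[OF that(1)] W(2) by simp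
    qed
    then show ?thesis by (auto simp: vanishes_def)
  qed
  then show "\<exists>N. \<forall>W\<in>U. N \<le> lev W \<longrightarrow> vanishes X W" by blast
qed

end

section \<open>The spectrum\<close>

text \<open>The compact subsets of a discrete space are the finite ones.\<close>

lemma openin_Alexandroff_nat_iff:
  "openin (Alexandroff_compactification (discrete_topology (UNIV :: nat set))) V \<longleftrightarrow>
     (None \<in> V \<longrightarrow> finite (- V))"
proof
  assume "openin (Alexandroff_compactification (discrete_topology (UNIV :: nat set))) V"
  then consider A where "V = Some ` A"
    | C where "finite C" "V = insert None (Some ` (UNIV - C))"
    by (auto simp: openin_Alexandroff_compactification compactin_discrete_topology)
  then show "None \<in> V \<longrightarrow> finite (- V)"
  proof cases
    case (2 C)
    have "- V \<subseteq> Some ` C"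
    proof
      fix q assume "q \<in> - V"
      then show "q \<in> Some ` C" using 2 by (cases q) auto
    qed
    then show ?thesis using 2(1) finite_subset by blast
  qed auto
next
  assume V: "None \<in> V \<longrightarrow> finite (- V)"
  show "openin (Alexandroff_compactification (discrete_topology (UNIV :: nat set))) V"
  proof (cases "None \<in> V")
    case True
    define C where "C = {n. Some n \<notin> V}"
    have "Some ` C \<subseteq> - V" by (auto simp: C_def)
    then have "finite C" using V True finite_subset finite_imageD by (metis inj_Some subset_UNIV inj_on_subset)
    moreover have "V = insert None (Some ` (UNIV - C))"
    proof (rule Set.set_eqI)
      show "q \<in> V \<longleftrightarrow> q \<in> insert None (Some ` (UNIV - C))" for q
        using True by (cases q) (auto simp: C_def)
    qed
    ultimately show ?thesis
      by (auto simp: openin_Alexandroff_compactification compactin_discrete_topology)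
  next
    case False
    then have "V = Some ` {n. Some n \<in> V}"
    proof (intro Set.set_eqI)
      show "q \<in> V \<longleftrightarrow> q \<in> Some ` {n. Some n \<in> V}" for q
        using False by (cases q) auto
    qed
    then show ?thesis by (auto simp: openin_Alexandroff_compactification)
  qed
qed

section \<open>The points of the spectrum\<close>

context field_level_category
begin

text \<open>Both kinds of prime take this form: F is {{n}} at a finite point and the set of all
  tails at infinity.\<close>

definition vanishing :: "nat set set \<Rightarrow> ('k, nat \<Rightarrow> 'k) functor_data set" where
  "vanishing F = {X \<in> fg_functors K U. \<exists>L\<in>F. \<forall>G\<in>U. lev G \<in> L \<longrightarrow> vanishes X G}"

lemma vanishingI:
  "X \<in> fg_functors K U \<Longrightarrow> L \<in> F \<Longrightarrow> (\<And>G. G \<in> U \<Longrightarrow> lev G \<in> L \<Longrightarrow> vanishes X G) \<Longrightarrow> X \<in> vanishing F"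
  unfolding vanishing_def by blast

text \<open>F acts as a filter base: if the two ends of an exact sequence vanish on members of F,
  the middle term vanishes on their intersection. Subobjects, quotients and tensor products vanish
  wherever the given functor does.\<close>

lemma serre_ideal_vanishing:
  assumes ne: "F \<noteq> {}" and Int: "\<And>A B. A \<in> F \<Longrightarrow> B \<in> F \<Longrightarrow> A \<inter> B \<in> F"
  shows "serre_ideal K U (vanishing F)"
  unfolding serre_ideal_def serre_subcategory_def
proof (intro conjI ballI allI impI)
  show "vanishing F \<subseteq> fg_functors K U" by (auto simp: vanishing_def)
  obtain L where "L \<in> F" using ne by blast
  then have "ind {} \<in> vanishing F"
    by (rule vanishingI[rotated]) (simp_all add: ind_fg tame_simps vanishes_ind_iff)
  then show "vanishing F \<noteq> {}" by blast
next
  fix A B C \<phi> \<psi>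
  assume fg: "A \<in> fg_functors K U" "B \<in> fg_functors K U" "C \<in> fg_functors K U"
    and e: "short_exact K U A \<phi> B \<psi> C"
  note v = short_exact_vanishes[OF fg(1-3)[THEN fg_functorsD] e]
  show "B \<in> vanishing F \<longleftrightarrow> A \<in> vanishing F \<and> C \<in> vanishing F"
  proof
    assume "B \<in> vanishing F"
    then show "A \<in> vanishing F \<and> C \<in> vanishing F" using fg v unfolding vanishing_def by blast
  next
    assume "A \<in> vanishing F \<and> C \<in> vanishing F"
    then obtain L M where L: "L \<in> F" "\<And>G. G \<in> U \<Longrightarrow> lev G \<in> L \<Longrightarrow> vanishes A G"
      and M: "M \<in> F" "\<And>G. G \<in> U \<Longrightarrow> lev G \<in> M \<Longrightarrow> vanishes C G"
      unfolding vanishing_def by blast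
    show "B \<in> vanishing F"
    proof (rule vanishingI[OF fg(2) Int[OF L(1) M(1)]])
      show "vanishes B G" if "G \<in> U" "lev G \<in> L \<inter> M" for G
        using v[OF that(1)] L(2)[OF that(1)] M(2)[OF that(1)] that(2) by simp
    qed
  qed
next
  fix X Y Z assume "X \<in> vanishing F" and Y: "Y \<in> fg_functors K U" and Z: "Z \<in> fg_functors K U"
    and t: "is_tensor K U X Y Z"
  then obtain L where X: "X \<in> fg_functors K U" and L: "L \<in> F" "\<And>G. G \<in> U \<Longrightarrow> lev G \<in> L \<Longrightarrow> vanishes X G"
    unfolding vanishing_def by blast
  show "Z \<in> vanishing F"
    by (rule vanishingI[OF Z L(1)])
      (simp add: L(2) is_tensor_vanishes_iff[OF K.field_axioms fg_functorsD[OF X] fg_functorsD[OF Y] t])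
qed

definition point :: "nat option \<Rightarrow> ('k, nat \<Rightarrow> 'k) functor_data set" where
  "point q = vanishing (case q of Some n \<Rightarrow> {{n}} | None \<Rightarrow> range (\<lambda>N. {N..}))"

lemma point_Some_iff: "X \<in> point (Some n) \<longleftrightarrow> X \<in> fg_functors K U \<and> vanishes X (R n)"
proof
  assume "X \<in> point (Some n)"
  then show "X \<in> fg_functors K U \<and> vanishes X (R n)"
    using R_in[of n] lev_R[of n] by (simp add: point_def vanishing_def)
next
  assume X: "X \<in> fg_functors K U \<and> vanishes X (R n)"
  have "vanishes X G" if G: "G \<in> U" "lev G \<in> {n}" for G
    by (rule vanishes_lev_eq[of X G "R n"]) (use X G R_in lev_R fg_functorsD in auto)
  then show "X \<in> point (Some n)"
    using X unfolding point_def by (auto intro: vanishingI[of X "{n}"])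
qed

lemma point_None_iff:
  "X \<in> point None \<longleftrightarrow> X \<in> fg_functors K U \<and> (\<exists>N. \<forall>G\<in>U. N \<le> lev G \<longrightarrow> vanishes X G)"
  by (simp add: point_def vanishing_def)

lemma serre_ideal_point: "serre_ideal K U (point q)"
proof (cases q)
  case None
  have "{M..} \<inter> {N..} \<in> range (\<lambda>N. {N..})" for M N :: nat
    by (rule image_eqI[of _ _ "max M N"]) auto
  then show ?thesis unfolding None point_def option.case by (intro serre_ideal_vanishing) auto
next
  case (Some n)
  show ?thesis unfolding Some point_def option.case by (rule serre_ideal_vanishing) auto
qed

lemma ind_point_Some_iff: "tame A \<Longrightarrow> ind A \<in> point (Some n) \<longleftrightarrow> n \<notin> A"
  by (simp add: point_Some_iff ind_fg vanishes_ind_iff lev_R)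

lemma ind_point_None_iff: "tame A \<Longrightarrow> ind A \<in> point None \<longleftrightarrow> finite A"
proof -
  assume A: "tame A"
  have "(\<forall>G\<in>U. N \<le> lev G \<longrightarrow> lev G \<notin> A) \<longleftrightarrow> (\<forall>n\<ge>N. n \<notin> A)" for N
    using R_in lev_R by metis
  then show ?thesis
    using A by (simp add: point_None_iff ind_fg vanishes_ind_iff)
      (metis finite_nat_set_iff_bounded linorder_not_le)
qed

text \<open>An element that never dies witnesses that X is nonzero at every level from its own on.
  Two such functors are then jointly nonzero far out, which gives primality at infinity.\<close>

lemma nonvanishing_of_not_point_None:
  assumes X: "X \<in> fg_functors K U" "X \<notin> point None"
  obtains T x where "T \<in> U" "x \<in> carrier (obj X T)" "x \<noteq> \<zero>\<^bsub>obj X T\<^esub>" "alive X T x = UNIV"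
    and "\<And>G. G \<in> U \<Longrightarrow> lev T \<le> lev G \<Longrightarrow> \<not> vanishes X G"
proof -
  obtain T x where T: "T \<in> U" "x \<in> carrier (obj X T)" "x \<noteq> \<zero>\<^bsub>obj X T\<^esub>" "alive X T x = UNIV"
    using support_dichotomy[OF X(1)] X by (auto simp: point_None_iff)
  have "\<not> vanishes X G" if G: "G \<in> U" "lev T \<le> lev G" for G
  proof
    assume v: "vanishes X G"
    obtain \<gamma> where g: "\<gamma> \<in> Hom G T" using Hom_ex[OF G(1) T(1) G(2)] by blast
    have "arr X G T \<gamma> x \<in> carrier (obj X G)"
      by (rule functor_arr_closed[OF fg_functorsD[OF X(1)] G(1) T(1) g T(2)])
    then have "arr X G T \<gamma> x = \<zero>\<^bsub>obj X G\<^esub>" using v by (simp add: vanishes_def)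
    moreover have "lev G \<in> alive X T x" using T(4) by simp
    ultimately show False using G(1) g unfolding alive_def by blast
  qed
  then show thesis using that T by blast
qed

lemma prime_point: "prime_serre_ideal K U (point q)"
  unfolding prime_serre_ideal_def
proof (intro conjI ballI impI)
  show "serre_ideal K U (point q)" by (rule serre_ideal_point)
  have "ind UNIV \<notin> point q"
    by (cases q) (simp_all add: ind_point_None_iff ind_point_Some_iff tame_simps)
  then show "point q \<noteq> fg_functors K U" using ind_fg[OF tame_simps(3)] by blast
  fix X Y Z assume X: "X \<in> fg_functors K U" and Y: "Y \<in> fg_functors K U" and Z: "Z \<in> point q"
    and t: "is_tensor K U X Y Z"
  note v = is_tensor_vanishes_iff[OF K.field_axioms fg_functorsD[OF X] fg_functorsD[OF Y] t]
  show "X \<in> point q \<or> Y \<in> point q"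
  proof (cases q)
    case (Some n)
    then show ?thesis using Z X Y v[OF R_in] by (simp add: point_Some_iff)
  next
    case None
    show ?thesis
    proof (rule ccontr)
      assume "\<not> ?thesis"
      then have nX: "X \<notin> point None" and nY: "Y \<notin> point None" using None by auto
      obtain T where T: "\<And>G. G \<in> U \<Longrightarrow> lev T \<le> lev G \<Longrightarrow> \<not> vanishes X G"
        using nonvanishing_of_not_point_None[OF X nX] by metis
      obtain T' where T': "\<And>G. G \<in> U \<Longrightarrow> lev T' \<le> lev G \<Longrightarrow> \<not> vanishes Y G"
        using nonvanishing_of_not_point_None[OF Y nY] by metis
      obtain N where N: "\<And>G. G \<in> U \<Longrightarrow> N \<le> lev G \<Longrightarrow> vanishes Z G"
        using Z None by (auto simp: point_None_iff)
      \<comment> \<open>A level to which the bounds for all three functors apply.\<close>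
      let ?G = "R (max N (max (lev T) (lev T')))"
      have "vanishes Z ?G" "\<not> vanishes X ?G" "\<not> vanishes Y ?G"
        by (intro N T T' R_in; simp add: lev_R)+
      then show False using v[OF R_in] by blast
    qed
  qed
qed

lemma prime_eq_point:
  assumes P: "prime_serre_ideal K U P"
  shows "\<exists>q. P = point q"
proof -
  have iP: "serre_ideal K U P" and proper: "P \<noteq> fg_functors K U" using P by (auto simp: prime_serre_ideal_def)
  have sP: "serre_subcategory K U P" using iP by (simp add: serre_ideal_def)
  have Pfg: "P \<subseteq> fg_functors K U" using serre_fg[OF sP] by blast
  have ideal: "Z \<in> P" if "X \<in> P" "Y \<in> fg_functors K U" "Z \<in> fg_functors K U" "is_tensor K U X Y Z" for X Y Z
    using iP that unfolding serre_ideal_def by blast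
  \<comment> \<open>Zero is the tensor product of any member of P with zero.\<close>
  have ind0: "ind {} \<in> P"
  proof -
    obtain X where X: "X \<in> P" using sP by (auto simp: serre_subcategory_def)
    note Xfg = subsetD[OF Pfg X]
    have "is_tensor K U X (ind {}) (ind {})"
      by (rule is_tensor_zero[OF fg_functorsD[OF Xfg] is_functor_ind]) (simp add: vanishes_ind_iff)
    moreover have "ind {} \<in> fg_functors K U" by (simp add: ind_fg tame_simps)
    ultimately show ?thesis using ideal[OF X] by blast
  qed
  show ?thesis
  proof (cases "\<exists>n. ind {n} \<notin> P")
    case True
    then obtain n where n: "ind {n} \<notin> P" by blast
    have "P = point (Some n)"
    proof
      show "point (Some n) \<subseteq> P"
      proof
        fix X assume X: "X \<in> point (Some n)"
        then have Xfg: "X \<in> fg_functors K U" by (simp add: point_Some_iff)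
        have fX: "is_functor K U X" by (rule fg_functorsD[OF Xfg])
        \<comment> \<open>X and \<open>ind {n}\<close> have disjoint supports, so their product is
          zero and lies in P. As \<open>ind {n}\<close> does not, primality yields X.\<close>
        have "is_tensor K U X (ind {n}) (ind {})"
        proof (rule is_tensor_zero[OF fX is_functor_ind])
          show "vanishes X G \<or> vanishes (ind {n}) G" if "G \<in> U" for G
            using vanishes_lev_eq[OF fX that R_in[of n]] X by (auto simp: vanishes_ind_iff point_Some_iff lev_R)
        qed
        moreover have "ind {n} \<in> fg_functors K U" by (simp add: ind_fg tame_simps)
        ultimately show "X \<in> P"
          using P Xfg ind0 n unfolding prime_serre_ideal_def by blast
      qed
      show "P \<subseteq> point (Some n)"
      proof
        fix X assume X: "X \<in> P"
        have Xfg: "X \<in> fg_functors K U" using X Pfg by blast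
        have fX: "is_functor K U X" by (rule fg_functorsD[OF Xfg])
        have "vanishes X (R n)"
        proof (rule ccontr)
          assume "\<not> vanishes X (R n)"
          then obtain x where x: "x \<in> carrier (obj X (R n))" "x \<noteq> \<zero>\<^bsub>obj X (R n)\<^esub>"
            using nonvanishing_ex[OF fX R_in] by blast
          define S where "S = alive X (R n) x"
          have S: "down_closed S" unfolding S_def by (rule down_closed_alive[OF fX R_in x(1)])
          have nS: "n \<in> S" using lev_alive[OF fX R_in x] by (simp add: S_def lev_R)
          have i: "tame (S \<inter> {n..})" "ind (S \<inter> {n..}) \<in> P"
            using ind_in_ideal[OF iP X R_in x] by (simp_all add: S_def lev_R)
          \<comment> \<open>Split off the lowest level: \<open>ind {n}\<close> is the quotient of
            the interval functor by the part above n, so it would lie in P.\<close>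
          have eq: "S \<inter> {n..} = (S \<inter> {Suc n..}) \<union> {n}" using nS by auto
          have "ind ((S \<inter> {Suc n..}) \<union> {n}) \<in> P \<longleftrightarrow> ind (S \<inter> {Suc n..}) \<in> P \<and> ind {n} \<in> P"
          proof (rule ind_serre[OF sP])
            show "tame (S \<inter> {Suc n..})" using down_closed_cases[OF S] by (auto simp: tame_simps)
            show "tame {n}" by (simp add: tame_simps)
            show "tame ((S \<inter> {Suc n..}) \<union> {n})" using i(1) by (simp add: eq)
          qed auto
          then show False using i(2) n by (simp add: eq)
        qed
        then show "X \<in> point (Some n)" using Xfg by (simp add: point_Some_iff)
      qed
    qed
    then show ?thesis by blast
  next
    case False
    then have simple: "ind {n} \<in> P" for n by blast
    \<comment> \<open>Finite initial segments are iterated extensions of single levels, each new top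
      level entering as a subobject.\<close>
    have lower: "ind {..<n} \<in> P" for n
    proof (induction n)
      case 0
      then show ?case using ind0 by simp
    next
      case (Suc n)
      have "ind ({n} \<union> {..<n}) \<in> P \<longleftrightarrow> ind {n} \<in> P \<and> ind {..<n} \<in> P"
        by (rule ind_serre[OF sP]) (auto simp: tame_simps)
      moreover have "{n} \<union> {..<n} = {..<Suc n}" by auto
      ultimately show ?case using simple Suc by simp
    qed
    have "P = point None"
    proof
      show "point None \<subseteq> P"
      proof
        fix X assume X: "X \<in> point None"
        then obtain N where Xfg: "X \<in> fg_functors K U" and N: "\<And>G. G \<in> U \<Longrightarrow> N \<le> lev G \<Longrightarrow> vanishes X G"
          by (auto simp: point_None_iff)
        \<comment> \<open>X lives below N, so it is its own truncation, and the ideal property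
          derives it from \<open>ind {..<N}\<close>.\<close>
        have "is_tensor K U X (ind {..<N}) X"
          by (rule is_tensor_ind[OF fg_functorsD[OF Xfg]]) (auto simp: down_closed_def N)
        then show "X \<in> P" using ideal[OF lower Xfg Xfg] is_tensor_sym by blast
      qed
      show "P \<subseteq> point None"
      proof (rule subsetI, rule ccontr)
        fix X assume X: "X \<in> P" and nX: "X \<notin> point None"
        have Xfg: "X \<in> fg_functors K U" using X Pfg by blast
        obtain T x where T: "T \<in> U" "x \<in> carrier (obj X T)" "x \<noteq> \<zero>\<^bsub>obj X T\<^esub>" "alive X T x = UNIV"
          by (rule nonvanishing_of_not_point_None[OF Xfg nX])
        have "ind {lev T..} \<in> P" using ind_in_ideal(2)[OF iP X T(1-3)] T(4) by simp
        \<comment> \<open>Gluing the tail to the segment below it assembles the tensor unit, and an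
          ideal that contains the unit is everything.\<close>
        moreover have "ind ({lev T..} \<union> {..<lev T}) \<in> P \<longleftrightarrow> ind {lev T..} \<in> P \<and> ind {..<lev T} \<in> P"
        proof (rule ind_serre[OF sP])
          have "{lev T..} \<union> {..<lev T} = UNIV" by auto
          then show "tame ({lev T..} \<union> {..<lev T})" by (simp add: tame_simps)
        qed (auto simp: tame_simps)
        moreover have "{lev T..} \<union> {..<lev T} = UNIV" by auto
        ultimately have one: "ind UNIV \<in> P" using lower by simp
        have "fg_functors K U \<subseteq> P"
        proof
          fix Y assume Y: "Y \<in> fg_functors K U"
          have "is_tensor K U Y (ind UNIV) Y"
            by (rule is_tensor_ind[OF fg_functorsD[OF Y] down_closed_UNIV]) simp
          then show "Y \<in> P" using ideal[OF one Y Y] is_tensor_sym by blast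
        qed
        then show False using proper Pfg by blast
      qed
    qed
    then show ?thesis by blast
  qed
qed

text \<open>\<open>ind {n}\<close> separates the points: it lies in every one except
  \<open>Some n\<close>.\<close>

lemma inj_point: "inj point"
proof (rule injI)
  fix q r assume eq: "point q = point r"
  show "q = r"
  proof (cases q; cases r)
    fix n m assume "q = Some n" "r = Some m"
    then show ?thesis using eq ind_point_Some_iff[OF tame_simps(1), of "{m}"] by simp blast
  next
    fix n assume *: "q = None" "r = Some n"
    have "ind {n} \<notin> point (Some n)" "ind {n} \<in> point None"
      by (simp_all add: ind_point_Some_iff ind_point_None_iff tame_simps)
    then show ?thesis using eq * by blast
  next
    fix n assume *: "q = Some n" "r = None"
    have "ind {n} \<notin> point (Some n)" "ind {n} \<in> point None"
      by (simp_all add: ind_point_Some_iff ind_point_None_iff tame_simps)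
    then show ?thesis using eq * by blast
  qed simp
qed

section \<open>The topology of the spectrum\<close>

lemma Spc_points_eq: "Spc_points K U = range point"
  unfolding Spc_points_def using prime_point prime_eq_point by blast

text \<open>The open set given by S consists of the primes that meet S. If infinity is among them,
  some member of S vanishes far out and so lies in almost all finite points. Conversely, functors
  \<open>ind A\<close> suffice to cut out every open set.\<close>

lemma Spc_open_iff:
  "(\<exists>S\<subseteq>fg_functors K U. W = Spc_points K U - Spc_closed K U S) \<longleftrightarrow>
   (\<exists>V. openin (Alexandroff_compactification (discrete_topology (UNIV :: nat set))) V \<and> W = point ` V)"
proof
  assume "\<exists>S\<subseteq>fg_functors K U. W = Spc_points K U - Spc_closed K U S"
  then obtain S where S: "S \<subseteq> fg_functors K U" "W = Spc_points K U - Spc_closed K U S" by blast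
  define V where "V = {q. \<exists>X\<in>S. X \<in> point q}"
  have "W = point ` V"
    unfolding S(2) Spc_closed_def Spc_points_eq V_def by auto
  moreover have "finite (- V)" if None: "None \<in> V"
  proof -
    obtain X N where X: "X \<in> S" and N: "\<And>G. G \<in> U \<Longrightarrow> N \<le> lev G \<Longrightarrow> vanishes X G"
      using None by (auto simp: V_def point_None_iff)
    have "Some n \<in> V" if "N \<le> n" for n
      using X S(1) N[OF R_in[of n]] that by (auto simp: V_def point_Some_iff lev_R)
    then have "- V \<subseteq> Some ` {..<N}" using None
      by (metis ComplD image_eqI lessThan_iff not_le_imp_less option.exhaust subsetI)
    then show ?thesis using finite_subset by blast
  qed
  ultimately show "\<exists>V. openin (Alexandroff_compactification (discrete_topology (UNIV :: nat set))) V \<and> W = point ` V"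
    unfolding openin_Alexandroff_nat_iff by blast
next
  assume "\<exists>V. openin (Alexandroff_compactification (discrete_topology (UNIV :: nat set))) V \<and> W = point ` V"
  then obtain V where V: "None \<in> V \<longrightarrow> finite (- V)" and W: "W = point ` V"
    unfolding openin_Alexandroff_nat_iff by blast
  \<comment> \<open>A neighbourhood of infinity misses finitely many points, and the functor
    supported on exactly those levels lies in all the others. If V omits infinity, it is a union of
    finite points, and \<open>ind (- {n})\<close> lies in the point n and in no other.\<close>
  define S where "S = (if None \<in> V then {ind {n. Some n \<notin> V}} else {ind (- {n}) | n. Some n \<in> V})"
  have fin: "finite {n. Some n \<notin> V}" if "None \<in> V"
    using finite_vimageI[of "- V" Some] V that by (simp add: vimage_def)
  have Sfg: "S \<subseteq> fg_functors K U"
    using fin by (auto simp: S_def intro!: ind_fg tame_simps)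
  have "(\<exists>X\<in>S. X \<in> point q) \<longleftrightarrow> q \<in> V" for q
  proof (cases "None \<in> V")
    case True
    then show ?thesis
      using ind_point_Some_iff[OF tame_simps(1)[OF fin]] ind_point_None_iff[OF tame_simps(1)[OF fin]] fin
      by (cases q) (simp_all add: S_def)
  next
    case False
    have inf: "infinite (- {n :: nat})" for n by (simp add: finite_compl)
    show ?thesis
      using False ind_point_Some_iff[OF tame_simps(4)] ind_point_None_iff[OF tame_simps(4)] inf
      by (cases q) (auto simp: S_def)
  qed
  then have "W = Spc_points K U - Spc_closed K U S"
    unfolding W Spc_closed_def Spc_points_eq by auto
  then show "\<exists>S\<subseteq>fg_functors K U. W = Spc_points K U - Spc_closed K U S" using Sfg by blast
qed

theorem Spc_homeomorphic:
  "Spc K U homeomorphic_space Alexandroff_compactification (discrete_topology (UNIV :: nat set))"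
proof -
  let ?A = "Alexandroff_compactification (discrete_topology (UNIV :: nat set))"
  define isopen where "isopen W \<longleftrightarrow> (\<exists>V. openin ?A V \<and> W = point ` V)" for W
  \<comment> \<open>\<open>topology\<close> yields the intended open sets only for a predicate that
    satisfies the axioms. They are transported from the compactification along the injection
    \<open>point\<close>.\<close>
  have "istopology isopen"
    unfolding istopology_def
  proof (intro conjI allI impI)
    fix W W' assume "isopen W" "isopen W'"
    then obtain V V' where "openin ?A V" "W = point ` V" "openin ?A V'" "W' = point ` V'"
      by (auto simp: isopen_def)
    then show "isopen (W \<inter> W')"
      unfolding isopen_def by (intro exI[of _ "V \<inter> V'"]) (simp add: image_Int[OF inj_point] openin_Int)
  next
    fix \<W> assume "\<forall>W\<in>\<W>. isopen W"
    then obtain V where V: "\<And>W. W \<in> \<W> \<Longrightarrow> openin ?A (V W) \<and> W = point ` V W"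
      unfolding isopen_def by metis
    then have "\<Union>\<W> = point ` (\<Union>(V ` \<W>))" by (auto simp: image_UN)
    moreover have "openin ?A (\<Union>(V ` \<W>))" using V by (intro openin_Union) auto
    ultimately show "isopen (\<Union>\<W>)" unfolding isopen_def by blast
  qed
  moreover have "Spc K U = topology isopen"
    unfolding Spc_def isopen_def Spc_open_iff ..
  ultimately have opn: "openin (Spc K U) W \<longleftrightarrow> (\<exists>V. openin ?A V \<and> W = point ` V)" for W
    using topology_inverse' by (simp add: isopen_def)
  have tA: "topspace ?A = UNIV"
    using not_None_eq by (auto simp: topspace_Alexandroff_compactification) (metis option.exhaust rangeI)
  have top: "topspace (Spc K U) = range point"
  proof
    show "topspace (Spc K U) \<subseteq> range point"
      using opn[of "topspace (Spc K U)"] by auto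
    have "openin (Spc K U) (range point)"
      unfolding opn using openin_topspace[of ?A] tA by (intro exI[of _ UNIV]) simp
    then show "range point \<subseteq> topspace (Spc K U)" by (rule openin_subset)
  qed
  have "homeomorphic_map ?A (Spc K U) point"
  proof (rule bijective_open_imp_homeomorphic_map)
    show "open_map ?A (Spc K U) point" unfolding open_map_def opn by blast
    show "point ` topspace ?A = topspace (Spc K U)" by (simp only: tA top)
    show "inj_on point (topspace ?A)" using inj_point by (simp only: tA)
    show "continuous_map ?A (Spc K U) point"
      unfolding continuous_map_def
    proof (intro conjI allI impI)
      show "point \<in> topspace ?A \<rightarrow> topspace (Spc K U)" by (simp only: tA top) auto
      fix W assume "openin (Spc K U) W"
      then obtain V where V: "openin ?A V" "W = point ` V" unfolding opn by blast
      have "{q \<in> topspace ?A. point q \<in> W} = V"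
        unfolding tA V(2) using inj_point by (auto simp: inj_image_mem_iff)
      then show "openin ?A {q \<in> topspace ?A. point q \<in> W}" using V(1) by simp
    qed
  qed
  then show ?thesis
    using homeomorphic_map_imp_homeomorphic_space homeomorphic_space_sym by blast
qed

end

section \<open>Finite elementary abelian and cyclic groups\<close>

text \<open>Members of the families have natural numbers as elements, so images and products of
  groups have to be copied to that type.\<close>

lemma finite_group_transport:
  assumes "group Q" "finite (carrier Q)"
  obtains N :: "nat monoid" and e where "group N" "finite (carrier N)" "e \<in> iso Q N"
proof -
  interpret Q: group Q by fact
  obtain e :: "'a \<Rightarrow> nat" where e: "inj_on e (carrier Q)"
    using finite_imp_inj_to_nat_seg[OF assms(2)] by blast
  define d where "d = the_inv_into (carrier Q) e"
  have d: "d (e x) = x" if "x \<in> carrier Q" for x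
    unfolding d_def by (rule the_inv_into_f_f[OF e that])
  define N where "N = \<lparr>carrier = e ` carrier Q, mult = (\<lambda>a b. e (d a \<otimes>\<^bsub>Q\<^esub> d b)), one = e \<one>\<^bsub>Q\<^esub>\<rparr>"
  have "group N"
  proof (rule groupI)
    show "x \<otimes>\<^bsub>N\<^esub> y \<otimes>\<^bsub>N\<^esub> z = x \<otimes>\<^bsub>N\<^esub> (y \<otimes>\<^bsub>N\<^esub> z)"
      if "x \<in> carrier N" "y \<in> carrier N" "z \<in> carrier N" for x y z
      using that d by (auto simp: N_def Q.m_assoc)
    show "\<exists>y\<in>carrier N. y \<otimes>\<^bsub>N\<^esub> x = \<one>\<^bsub>N\<^esub>" if x: "x \<in> carrier N" for x
    proof -
      obtain u where "u \<in> carrier Q" "x = e u" using x by (auto simp: N_def)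
      then show ?thesis by (intro bexI[of _ "e (inv\<^bsub>Q\<^esub> u)"]) (auto simp: N_def d)
    qed
  qed (auto simp: N_def d)
  moreover have "finite (carrier N)" using assms(2) by (simp add: N_def)
  moreover have "e \<in> iso Q N"
    using e by (auto simp: iso_def hom_def bij_betw_def N_def d)
  ultimately show thesis by (rule that)
qed

lemma hom_pow_nat:
  fixes n :: nat
  assumes "group G" "group H" "f \<in> hom G H" "x \<in> carrier G"
  shows "f (x [^]\<^bsub>G\<^esub> n) = f x [^]\<^bsub>H\<^esub> n"
proof -
  interpret group_hom G H f using assms by (simp add: group_hom_def group_hom_axioms_def)
  show ?thesis using assms(4) by (rule hom_nat_pow)
qed

text \<open>A homomorphism out of a cyclic group is determined by the image of a generator, which
  may be any element satisfying the relations of the generator.\<close>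

lemma hom_of_generator:
  assumes G: "group G" and H: "group H" and g: "g \<in> carrier G" and h: "h \<in> carrier H"
    and gen: "carrier G = range (\<lambda>i::nat. g [^]\<^bsub>G\<^esub> i)"
    and rel: "\<And>n::nat. g [^]\<^bsub>G\<^esub> n = \<one>\<^bsub>G\<^esub> \<Longrightarrow> h [^]\<^bsub>H\<^esub> n = \<one>\<^bsub>H\<^esub>"
  obtains f where "f \<in> hom G H" "\<And>i::nat. f (g [^]\<^bsub>G\<^esub> i) = h [^]\<^bsub>H\<^esub> i"
proof -
  interpret G: group G by fact
  interpret H: group H by fact
  have le: "h [^]\<^bsub>H\<^esub> i = h [^]\<^bsub>H\<^esub> j" if "g [^]\<^bsub>G\<^esub> i = g [^]\<^bsub>G\<^esub> j" "i \<le> j" for i j :: nat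
  proof -
    have "g [^]\<^bsub>G\<^esub> i \<otimes>\<^bsub>G\<^esub> g [^]\<^bsub>G\<^esub> (j - i) = g [^]\<^bsub>G\<^esub> j"
      using that(2) g by (simp add: G.nat_pow_mult)
    then have "g [^]\<^bsub>G\<^esub> i \<otimes>\<^bsub>G\<^esub> g [^]\<^bsub>G\<^esub> (j - i) = g [^]\<^bsub>G\<^esub> i"
      unfolding that(1) .
    then have "g [^]\<^bsub>G\<^esub> (j - i) = \<one>\<^bsub>G\<^esub>" using g by (simp only: G.l_cancel_one G.nat_pow_closed)
    then have "h [^]\<^bsub>H\<^esub> i \<otimes>\<^bsub>H\<^esub> h [^]\<^bsub>H\<^esub> (j - i) = h [^]\<^bsub>H\<^esub> i" using rel h by simp
    then show ?thesis using that(2) h by (simp add: H.nat_pow_mult)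
  qed
  have eq: "h [^]\<^bsub>H\<^esub> i = h [^]\<^bsub>H\<^esub> j" if "g [^]\<^bsub>G\<^esub> i = g [^]\<^bsub>G\<^esub> j" for i j :: nat
    using le[OF that] le[OF that[symmetric]] by (metis nat_le_linear)
  define f where "f x = h [^]\<^bsub>H\<^esub> (SOME i::nat. x = g [^]\<^bsub>G\<^esub> i)" for x
  have f: "f (g [^]\<^bsub>G\<^esub> i) = h [^]\<^bsub>H\<^esub> i" for i :: nat
    unfolding f_def by (rule eq, rule someI[where P = "\<lambda>j. g [^]\<^bsub>G\<^esub> i = g [^]\<^bsub>G\<^esub> j", THEN sym], rule refl)
  have "f \<in> hom G H"
  proof (rule homI)
    show "f x \<in> carrier H" for x using h by (simp add: f_def)
    fix x y assume "x \<in> carrier G" "y \<in> carrier G"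
    then obtain i j :: nat where "x = g [^]\<^bsub>G\<^esub> i" "y = g [^]\<^bsub>G\<^esub> j" using gen by auto
    then show "f (x \<otimes>\<^bsub>G\<^esub> y) = f x \<otimes>\<^bsub>H\<^esub> f y"
      using g h by (simp add: G.nat_pow_mult H.nat_pow_mult f)
  qed
  then show thesis using f that by blast
qed

text \<open>Invert i modulo m.\<close>

lemma (in group) exists_root_of_power:
  fixes i m :: nat
  assumes "x \<in> carrier G" "x [^] m = \<one>" "coprime i m"
  shows "\<exists>j::nat. (x [^] i) [^] j = x"
proof (cases "m = 0")
  case True
  \<comment> \<open>Being coprime to 0 means that i is 1.\<close>
  then show ?thesis using assms by (intro exI[of _ 1]) simp
next
  case False
  obtain j where j: "[i * j = Suc 0] (mod m)" using cong_solve_coprime_nat assms(3) by blast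
  show ?thesis
  proof (cases "m = 1")
    case True
    \<comment> \<open>Modulo 1 the residue of i j is 0 instead of 1, but here x is the
      identity.\<close>
    then show ?thesis using assms by (intro exI[of _ 1]) simp
  next
    case m1: False
    then have "(i * j) mod m = 1" using j False by (simp add: cong_def)
    then have "i * j = 1 + m * (i * j div m)" by (metis mult_div_mod_eq add.commute)
    then have "x [^] (i * j) = x [^] (1::nat) \<otimes> (x [^] m) [^] (i * j div m)"
      using assms(1) by (metis nat_pow_mult nat_pow_pow)
    then show ?thesis using assms by (intro exI[of _ j]) (simp add: nat_pow_pow)
  qed
qed

text \<open>Polymorphic in the carrier, so that it applies to products as well; for prime p and
  groups of natural numbers it coincides with membership in the family.\<close>

definition elementary :: "nat \<Rightarrow> ('a, 'b) monoid_scheme \<Rightarrow> bool" where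
  "elementary p G \<longleftrightarrow> comm_group G \<and> finite (carrier G) \<and> (\<forall>x\<in>carrier G. x [^]\<^bsub>G\<^esub> p = \<one>\<^bsub>G\<^esub>)"

section \<open>Elementary abelian groups: orders and direct factors\<close>

context
  fixes p :: nat
  assumes p: "Factorial_Ring.prime p"
begin

lemma prime_power_of_unique_prime_divisor:
  "n > 0 \<Longrightarrow> (\<And>q. Factorial_Ring.prime q \<Longrightarrow> q dvd n \<Longrightarrow> q = p) \<Longrightarrow> \<exists>k. n = p ^ k" for n :: nat
proof (induction n rule: less_induct)
  case (less n)
  show ?case
  proof (cases "n = 1")
    case True
    then show ?thesis by (intro exI[of _ 0]) simp
  next
    case False
    then obtain q where q: "Factorial_Ring.prime q" "q dvd n" using prime_factor_nat by blast
    then have "p dvd n" using less.prems(2) by blast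
    then obtain m where m: "n = p * m" by (auto simp: dvd_def)
    have "\<exists>k. m = p ^ k"
    proof (rule less.IH)
      show "m < n" "m > 0" using m less.prems(1) prime_gt_1_nat[OF p] by auto
      show "r = p" if "Factorial_Ring.prime r" "r dvd m" for r using less.prems(2) that m by auto
    qed
    then show ?thesis using m by (metis power_Suc)
  qed
qed

text \<open>A prime q dividing the order yields a subgroup of order q. A nontrivial element of it
  has order dividing both q and p, so q = p.\<close>

lemma elementary_order:
  fixes G (structure)
  assumes G: "elementary p G"
  shows "\<exists>n. order G = p ^ n"
proof (rule prime_power_of_unique_prime_divisor)
  interpret comm_group G using G by (simp add: elementary_def)
  have fin: "finite (carrier G)" using G by (simp add: elementary_def)
  then show "order G > 0" using order_gt_0_iff_finite by blast
  fix q :: nat assume q: "Factorial_Ring.prime q" "q dvd order G"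
  \<comment> \<open>Exponent 1 is enough: the Sylow theorem is used as Cauchy's theorem.\<close>
  obtain m where "order G = q ^ 1 * m" using q(2) by (auto simp: dvd_def)
  from sylow_thm[OF q(1) is_group this fin] obtain H where H: "subgroup H G" "card H = q" by auto
  have "\<not> H \<subseteq> {\<one>}"
  proof
    assume "H \<subseteq> {\<one>}"
    then have "card H \<le> 1" using card_mono[of "{\<one>}" H] by simp
    then show False using H(2) prime_gt_1_nat[OF q(1)] by simp
  qed
  then obtain x where x: "x \<in> H" "x \<noteq> \<one>" by blast
  have xG: "x \<in> carrier G" by (rule subgroup.mem_carrier[OF H(1) x(1)])
  have "x [^] p = \<one>" using G xG by (simp add: elementary_def)
  then have 1: "ord x dvd p" using pow_eq_id[OF xG] by blast
  interpret H: group "G\<lparr>carrier := H\<rparr>" using H(1) subgroup.subgroup_is_group[OF _ is_group] by blast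
  have "x [^]\<^bsub>G\<lparr>carrier := H\<rparr>\<^esub> order (G\<lparr>carrier := H\<rparr>) = \<one>\<^bsub>G\<lparr>carrier := H\<rparr>\<^esub>"
    by (rule H.pow_order_eq_1) (simp add: x)
  then have "x [^] q = \<one>" using H(2) by (simp add: order_def nat_pow_def)
  then have 2: "ord x dvd q" using pow_eq_id[OF xG] by blast
  have "ord x \<noteq> 1" using x(2) ord_eq_1[OF xG] by blast
  then show "q = p"
    using 1 2 p q(1) by (metis prime_nat_iff)
qed

lemma elementary_subgroup:
  fixes G (structure)
  assumes G: "elementary p G" and M: "subgroup M G"
  shows "elementary p (G\<lparr>carrier := M\<rparr>)"
proof -
  interpret comm_group G using G by (simp add: elementary_def)
  have sub: "M \<subseteq> carrier G" by (rule subgroup.subset[OF M])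
  have "comm_group (G\<lparr>carrier := M\<rparr>)"
    by (rule group.group_comm_groupI[OF subgroup.subgroup_is_group[OF M is_group]])
      (use sub in \<open>auto simp: subset_iff m_comm\<close>)
  then show ?thesis
    using G sub finite_subset by (auto simp: elementary_def nat_pow_def)
qed

text \<open>A subgroup maximal among those that avoid \<open>x\<close> is a complement of the group generated by
  \<open>x\<close>.\<close>

lemma elementary_retraction:
  fixes G (structure)
  assumes G: "elementary p G" and x: "x \<in> carrier G"
  obtains r where "r \<in> hom G G" "r x = x" "\<And>y. y \<in> carrier G \<Longrightarrow> \<exists>i::nat. r y = x [^] i"
proof (cases "x = \<one>")
  case True
  interpret comm_group G using G by (simp add: elementary_def)
  have "(\<lambda>_. \<one>) \<in> hom G G" by (rule homI) auto
  then show thesis using that[of "\<lambda>_. \<one>"] True by (metis nat_pow_one)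
next
  case x1: False
  interpret comm_group G using G by (simp add: elementary_def)
  have fin: "finite (carrier G)" using G by (simp add: elementary_def)
  have ex: "y [^] p = \<one>" if "y \<in> carrier G" for y using G that by (simp add: elementary_def)
  define \<M> where "\<M> = {M. subgroup M G \<and> x \<notin> M}"
  have "finite \<M>"
    by (rule finite_subset[of _ "Pow (carrier G)"]) (auto simp: \<M>_def fin subgroup.mem_carrier)
  moreover have "{\<one>} \<in> \<M>" using x1 triv_subgroup by (auto simp: \<M>_def)
  ultimately obtain M where "M \<in> \<M>" and max: "\<And>M'. M' \<in> \<M> \<Longrightarrow> M \<subseteq> M' \<Longrightarrow> M = M'"
    using finite_has_maximal[of \<M>] by blast
  then have M: "subgroup M G" and xM: "x \<notin> M" by (auto simp: \<M>_def)
  interpret M: subgroup M G by (rule M)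
  have Mpow: "m [^] j \<in> M" if "m \<in> M" for m and j :: nat
    using that by (induction j) (auto simp: M.m_closed M.one_closed)
  \<comment> \<open>The group generated by x. Natural exponents suffice because the power with
    exponent p - 1 is the inverse.\<close>
  define C where "C = range (\<lambda>i::nat. x [^] i)"
  have CG: "z \<in> carrier G" if "z \<in> C" for z using that x by (auto simp: C_def)
  have C_mult: "z \<otimes> z' \<in> C" if "z \<in> C" "z' \<in> C" for z z'
    using that x by (auto simp: C_def nat_pow_mult)
  have inv_pow: "inv y = y [^] (p - 1)" if "y \<in> carrier G" for y
  proof -
    have "y \<otimes> y [^] (p - 1) = y [^] p"
      using that prime_gt_0_nat[OF p] by (metis Suc_diff_1 nat_pow_Suc2)
    then show ?thesis using ex that by (metis inv_equality m_comm nat_pow_closed)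
  qed
  have C_inv: "inv z \<in> C" if z: "z \<in> C" for z
  proof -
    obtain i :: nat where "z = x [^] i" using z by (auto simp: C_def)
    then have "inv z = x [^] (i * (p - 1))" using x inv_pow[of z] by (simp add: nat_pow_pow)
    then show ?thesis by (auto simp: C_def)
  qed
  \<comment> \<open>A nontrivial power of y has exponent prime to p, so y is in turn a power of
    it.\<close>
  have root: "\<exists>j::nat. (y [^] i) [^] j = y" if y: "y \<in> carrier G" and i: "y [^] i \<noteq> \<one>" for y and i :: nat
  proof -
    have "\<not> p dvd i"
    proof
      assume "p dvd i"
      then obtain k where "i = p * k" by (auto simp: dvd_def)
      then have "y [^] i = (y [^] p) [^] k" using y by (simp add: nat_pow_pow)
      then show False using i ex[OF y] by simp
    qed
    then have "coprime i p" using p by (metis coprime_commute prime_imp_coprime_nat)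
    then show ?thesis by (rule exists_root_of_power[OF y ex[OF y]])
  qed
  have CM: "z = \<one>" if z: "z \<in> C" "z \<in> M" for z
  proof (rule ccontr)
    assume ne: "z \<noteq> \<one>"
    obtain i :: nat where i: "z = x [^] i" using z by (auto simp: C_def)
    then obtain j :: nat where "z [^] j = x" using root[OF x] ne by blast
    then show False using Mpow[OF z(2), of j] xM by simp
  qed
  have exists: "\<exists>z\<in>C. y \<otimes> inv z \<in> M" if y: "y \<in> carrier G" for y
  proof (cases "y \<in> M")
    case True
    have "\<one> \<in> C" unfolding C_def by (rule range_eqI[of _ _ 0]) simp
    then show ?thesis using True y by (intro bexI[of _ \<one>]) auto
  next
    case False
    \<comment> \<open>By maximality the group generated by M and y contains x. Then x is m times a
      nontrivial power of y, and taking a root of that power expresses y modulo M as a power of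
      x.\<close>
    define M' where "M' = {m \<otimes> y [^] k | m (k::nat). m \<in> M}"
    have "subgroup M' G"
    proof (rule subgroupI)
      show "M' \<subseteq> carrier G" using y by (auto simp: M'_def)
      have "\<one> \<otimes> y [^] (0::nat) \<in> M'" unfolding M'_def using M.one_closed by blast
      then show "M' \<noteq> {}" by blast
      fix a assume "a \<in> M'"
      then obtain m and k :: nat where a: "m \<in> M" "a = m \<otimes> y [^] k" by (auto simp: M'_def)
      have "inv a = inv m \<otimes> y [^] (k * (p - 1))"
        using a y inv_pow[of "y [^] k"] by (simp add: inv_mult nat_pow_pow)
      then show "inv a \<in> M'" using a(1) by (auto simp: M'_def)
      fix b assume "b \<in> M'"
      then obtain m' and k' :: nat where b: "m' \<in> M" "b = m' \<otimes> y [^] k'" by (auto simp: M'_def)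
      have "a \<otimes> b = (m \<otimes> m') \<otimes> y [^] (k + k')"
        using a b y by (simp add: nat_pow_mult[symmetric] m_ac)
      then show "a \<otimes> b \<in> M'" using a(1) b(1) by (auto simp: M'_def)
    qed
    moreover have "y \<in> M'"
      unfolding M'_def using y by (intro CollectI exI[of _ \<one>] exI[of _ 1]) auto
    moreover have "M \<subseteq> M'"
    proof
      fix m assume "m \<in> M"
      then show "m \<in> M'" unfolding M'_def by (intro CollectI exI[of _ m] exI[of _ 0]) auto
    qed
    ultimately have "x \<in> M'" using max[of M'] False by (auto simp: \<M>_def)
    then obtain m and k :: nat where m: "m \<in> M" "x = m \<otimes> y [^] k" by (auto simp: M'_def)
    then have "y [^] k \<noteq> \<one>" using xM by auto
    then obtain j :: nat where j: "(y [^] k) [^] j = y" using root[OF y] by blast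
    have "x [^] j = m [^] j \<otimes> y"
      unfolding m(2) using m(1) y j by (simp add: nat_pow_distrib)
    then have "y \<otimes> inv (x [^] j) = inv (m [^] j)"
      using m(1) y by (simp add: inv_mult m_comm[of "inv (m [^] j)"] m_assoc[symmetric])
    then have "y \<otimes> inv (x [^] j) \<in> M" using Mpow[OF m(1)] by simp
    then show ?thesis by (auto simp: C_def)
  qed
  have unique: "z = z'" if "z \<in> C" "z' \<in> C" "y \<in> carrier G" "y \<otimes> inv z \<in> M" "y \<otimes> inv z' \<in> M" for y z z'
  proof -
    have "inv (y \<otimes> inv z) \<otimes> (y \<otimes> inv z') \<in> M" using that by blast
    also have "inv (y \<otimes> inv z) \<otimes> (y \<otimes> inv z') = z \<otimes> inv z'"
      using that CG by (simp add: inv_mult m_assoc m_lcomm[of "inv y"])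
        (simp add: m_comm[of "inv y"] m_assoc m_lcomm[of y])
    finally have "z \<otimes> inv z' = \<one>" using that C_mult C_inv CM by blast
    then show ?thesis using that CG by (metis inv_equality inv_inv inv_closed)
  qed
  \<comment> \<open>The projection to C along M.\<close>
  define r where "r y = (THE z. z \<in> C \<and> y \<otimes> inv z \<in> M)" for y
  have r_eq: "r y = z" if "y \<in> carrier G" "z \<in> C" "y \<otimes> inv z \<in> M" for y z
    unfolding r_def using that unique by (intro the_equality) blast+
  have r: "r y \<in> C" "y \<otimes> inv (r y) \<in> M" if y: "y \<in> carrier G" for y
    using exists[OF y] r_eq[OF y] by auto
  show thesis
  proof
    show "r \<in> hom G G"
    proof (rule homI)
      show "r y \<in> carrier G" if "y \<in> carrier G" for y using r[OF that] CG by blast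
      fix y y' assume y: "y \<in> carrier G" and y': "y' \<in> carrier G"
      have "(y \<otimes> y') \<otimes> inv (r y \<otimes> r y') = (y \<otimes> inv (r y)) \<otimes> (y' \<otimes> inv (r y'))"
        using y y' r CG by (simp add: inv_mult m_ac)
      then show "r (y \<otimes> y') = r y \<otimes> r y'"
        using y y' r C_mult by (intro r_eq) auto
    qed
    have "x \<in> C" unfolding C_def by (rule range_eqI[of _ _ 1]) (simp add: x)
    then show "r x = x" using x by (intro r_eq) auto
    show "\<exists>i::nat. r y = x [^] i" if "y \<in> carrier G" for y using r(1)[OF that] by (auto simp: C_def)
  qed
qed

end

lemma (in group) carrier_eq_powers:
  assumes "finite (carrier G)" "cyclic_group G"
  obtains g where "g \<in> carrier G" "carrier G = range (\<lambda>i::nat. g [^] i)"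
proof -
  obtain g where g: "g \<in> carrier G" "carrier G = range (\<lambda>n::int. g [^] n)"
    using assms(2) cyclic_group by blast
  have "generate G {g} = range (\<lambda>n::int. g [^] n)" using generate_pow[OF g(1)] by auto
  moreover have "generate G {g} = range (\<lambda>i::nat. g [^] i)"
    using generate_pow_on_finite_carrier[OF assms(1) g(1)] by auto
  ultimately show thesis using that[OF g(1)] g(2) by metis
qed

lemma (in group) ord_generator:
  assumes "finite (carrier G)" "g \<in> carrier G" "carrier G = range (\<lambda>i::nat. g [^] i)"
  shows "ord g = order G"
proof -
  have "generate G {g} = carrier G"
    using generate_pow_on_finite_carrier[OF assms(1,2)] assms(3) by auto
  then show ?thesis using generate_pow_card[OF assms(2)] by (simp add: order_def)
qed

lemma (in group) not_inj_kernel: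
  assumes "group H" "f \<in> hom G H" "\<not> inj_on f (carrier G)"
  obtains u where "u \<in> carrier G" "u \<noteq> \<one>" "f u = \<one>\<^bsub>H\<^esub>"
proof -
  interpret h: group_hom G H f using assms by (simp add: group_hom_def group_hom_axioms_def is_group)
  obtain a b where ab: "a \<in> carrier G" "b \<in> carrier G" "a \<noteq> b" "f a = f b"
    using assms(3) by (auto simp: inj_on_def)
  have "a \<otimes> inv b \<noteq> \<one>" using ab by (metis inv_equality inv_inv inv_closed)
  moreover have "f (a \<otimes> inv b) = \<one>\<^bsub>H\<^esub>" using ab by simp
  ultimately show thesis using ab that[of "a \<otimes> inv b"] by simp
qed

section \<open>Lifting surjections\<close>

context
  fixes p :: nat
  assumes p: "Factorial_Ring.prime p"
begin

text \<open>The element u has order exactly p, so n is a multiple of p. Hence a homomorphism may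
  send u to any element of an elementary abelian group.\<close>

lemma elementary_pow_eq_one:
  fixes G (structure)
  assumes G: "elementary p G" and u: "u \<in> carrier G" "u \<noteq> \<one>" "u [^] n = \<one>" and H: "elementary p H"
    and z: "z \<in> carrier H"
  shows "z [^]\<^bsub>H\<^esub> (n::nat) = \<one>\<^bsub>H\<^esub>"
proof -
  interpret G: comm_group G using G by (simp add: elementary_def)
  interpret H: comm_group H using H by (simp add: elementary_def)
  have "u [^] p = \<one>" using G u(1) by (simp add: elementary_def)
  then have "G.ord u dvd p" using G.pow_eq_id[OF u(1)] by blast
  moreover have "G.ord u \<noteq> 1" using u G.ord_eq_1 by blast
  ultimately have "G.ord u = p" using p by (metis prime_nat_iff)
  then have "p dvd n" using u G.pow_eq_id[OF u(1)] by blast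
  then obtain k where "n = p * k" by (auto simp: dvd_def)
  then have "z [^]\<^bsub>H\<^esub> n = (z [^]\<^bsub>H\<^esub> p) [^]\<^bsub>H\<^esub> k" using z by (simp add: H.nat_pow_pow)
  then show ?thesis using H z by (simp add: elementary_def)
qed

text \<open>Induction on the order of G'. If g is injective, invert it. Otherwise split a kernel
  element z off G' with complement M, and lift f to a surjection h1 onto M. For reasons of order h1
  kills a nontrivial u; splitting u off G and sending it to z makes up for the missing
  factor.\<close>

lemma elementary_lift:
  fixes G' :: "'b monoid"
  assumes G: "elementary p G" and H: "group H" and f: "f \<in> epi G H"
  shows "elementary p G' \<Longrightarrow> g \<in> epi G' H \<Longrightarrow> order G' \<le> order G \<Longrightarrow>
    \<exists>h\<in>epi G G'. \<forall>x\<in>carrier G. g (h x) = f x"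
proof (induction "card (carrier G')" arbitrary: G' rule: less_induct)
  case less
  note G' = less.prems(1) and g = less.prems(2)
  interpret G: comm_group G using G by (simp add: elementary_def)
  interpret G': comm_group G' using G' by (simp add: elementary_def)
  interpret H: group H by (rule H)
  have finG': "finite (carrier G')" using G' by (simp add: elementary_def)
  have finG: "finite (carrier G)" using G by (simp add: elementary_def)
  have fh: "f \<in> hom G H" and fs: "f ` carrier G = carrier H" using f by (auto simp: epi_def)
  have gh: "g \<in> hom G' H" and gs: "g ` carrier G' = carrier H" using g by (auto simp: epi_def)
  interpret g: group_hom G' H g using gh by (simp add: group_hom_def group_hom_axioms_def G'.is_group H)
  show ?case
  proof (cases "inj_on g (carrier G')")
    case True
    define k where "k = inv_into (carrier G') g"
    have "g \<in> iso G' H" using gh gs True by (simp add: iso_def bij_betw_def)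
    then have k: "k \<in> iso H G'" unfolding k_def by (rule G'.iso_set_sym)
    then have kh: "k \<in> hom H G'" and ks: "k ` carrier H = carrier G'"
      by (auto simp: iso_def bij_betw_def)
    have "(\<lambda>x. k (f x)) \<in> hom G G'"
      using hom_compose[OF fh kh] by (simp add: o_def)
    moreover have "(\<lambda>x. k (f x)) ` carrier G = carrier G'"
      using fs ks by (metis image_image)
    moreover have "g (k (f x)) = f x" if "x \<in> carrier G" for x
      unfolding k_def using that fs gs by (intro f_inv_into_f) auto
    ultimately show ?thesis by (intro bexI[of _ "\<lambda>x. k (f x)"]) (auto simp: epi_def)
  next
    case False
    obtain z where z: "z \<in> carrier G'" "z \<noteq> \<one>\<^bsub>G'\<^esub>" "g z = \<one>\<^bsub>H\<^esub>"
      using G'.not_inj_kernel[OF H gh False] .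
    obtain r' where r': "r' \<in> hom G' G'" "r' z = z"
      and r'_pow: "\<And>y. y \<in> carrier G' \<Longrightarrow> \<exists>i::nat. r' y = z [^]\<^bsub>G'\<^esub> i"
      using elementary_retraction[OF p G' z(1)] by blast
    interpret r': group_hom G' G' r' using r'(1) by (simp add: group_hom_def group_hom_axioms_def G'.is_group)
    define M where "M = kernel G' G' r'"
    have M: "subgroup M G'" unfolding M_def by (rule r'.subgroup_kernel)
    define G1 where "G1 = G'\<lparr>carrier := M\<rparr>"
    have G1: "elementary p G1" unfolding G1_def by (rule elementary_subgroup[OF p G' M])
    have Msub: "M \<subseteq> carrier G'" by (rule subgroup.subset[OF M])
    have "z \<notin> M" using z r'(2) by (simp add: M_def kernel_def)
    then have "M \<subset> carrier G'" using Msub z(1) by blast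
    then have card: "card (carrier G1) < card (carrier G')"
      using finG' by (simp add: G1_def psubset_card_mono)
    have gz: "g (z [^]\<^bsub>G'\<^esub> i) = \<one>\<^bsub>H\<^esub>" for i :: nat
      using g.hom_nat_pow[OF z(1)] z(3) by simp
    \<comment> \<open>The component of y in the complement M.\<close>
    have split: "y \<otimes>\<^bsub>G'\<^esub> inv\<^bsub>G'\<^esub> (r' y) \<in> M" if y: "y \<in> carrier G'" for y
    proof -
      obtain i :: nat where i: "r' y = z [^]\<^bsub>G'\<^esub> i" using r'_pow[OF y] by blast
      have "r' (r' y) = r' y" using i r'.hom_nat_pow[OF z(1), of i] r'(2) by simp
      then show ?thesis using y by (simp add: M_def kernel_def)
    qed
    have "g \<in> epi G1 H"
    proof -
      have "g \<in> hom G1 H" using gh Msub by (auto simp: hom_def G1_def subset_iff)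
      moreover have "y \<in> g ` M" if "y \<in> carrier H" for y
      proof -
        obtain a where a: "a \<in> carrier G'" "y = g a" using \<open>y \<in> carrier H\<close> gs by blast
        obtain i :: nat where i: "r' a = z [^]\<^bsub>G'\<^esub> i" using r'_pow[OF a(1)] by blast
        have "g (a \<otimes>\<^bsub>G'\<^esub> inv\<^bsub>G'\<^esub> (r' a)) = y" using a gz[of i] z(1) by (simp add: i)
        then show ?thesis using split[OF a(1)] by blast
      qed
      ultimately show ?thesis using Msub gs by (auto simp: epi_def G1_def)
    qed
    moreover have "order G1 \<le> order G" using card less.prems(3) by (simp add: order_def)
    ultimately obtain h1 where h1: "h1 \<in> epi G G1" "\<And>x. x \<in> carrier G \<Longrightarrow> g (h1 x) = f x"
      using less.hyps[OF card G1] by blast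
    have h1h: "h1 \<in> hom G G1" and h1s: "h1 ` carrier G = M" using h1(1) by (auto simp: epi_def G1_def)
    have h1M: "h1 x \<in> M" if "x \<in> carrier G" for x using that h1s by blast
    then have h1G': "h1 x \<in> carrier G'" if "x \<in> carrier G" for x using that Msub by blast
    have h1_mult: "h1 (x \<otimes>\<^bsub>G\<^esub> y) = h1 x \<otimes>\<^bsub>G'\<^esub> h1 y" if "x \<in> carrier G" "y \<in> carrier G" for x y
      using hom_mult[OF h1h that] by (simp add: G1_def)
    interpret G1: group G1 using G1 by (simp add: elementary_def comm_group_def)
    \<comment> \<open>Here the comparison of orders enters: M is smaller than G', hence smaller than
      G.\<close>
    have "\<not> inj_on h1 (carrier G)"
    proof
      assume "inj_on h1 (carrier G)"
      then have "card (carrier G) = card M" using h1s card_image by metis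
      then show False using card less.prems(3) by (simp add: order_def G1_def)
    qed
    then obtain u where u: "u \<in> carrier G" "u \<noteq> \<one>\<^bsub>G\<^esub>" "h1 u = \<one>\<^bsub>G1\<^esub>"
      using G.not_inj_kernel[OF G1.is_group h1h] by blast
    have h1u: "h1 (u [^]\<^bsub>G\<^esub> i) = \<one>\<^bsub>G'\<^esub>" for i :: nat
    proof -
      have "h1 (u [^]\<^bsub>G\<^esub> i) = \<one>\<^bsub>G1\<^esub>"
        using hom_pow_nat[OF G.is_group G1.is_group h1h u(1), of i] u(3) by simp
      then show ?thesis by (simp add: G1_def)
    qed
    obtain r where r: "r \<in> hom G G" "r u = u"
      and r_pow: "\<And>y. y \<in> carrier G \<Longrightarrow> \<exists>i::nat. r y = u [^]\<^bsub>G\<^esub> i"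
      using elementary_retraction[OF p G u(1)] by blast
    define C where "C = G\<lparr>carrier := range (\<lambda>i::nat. u [^]\<^bsub>G\<^esub> i)\<rparr>"
    have "generate G {u} = range (\<lambda>i::nat. u [^]\<^bsub>G\<^esub> i)"
      using G.generate_pow_on_finite_carrier[OF finG u(1)] by auto
    then have "subgroup (range (\<lambda>i::nat. u [^]\<^bsub>G\<^esub> i)) G"
      using G.generate_is_subgroup[of "{u}"] u(1) by simp
    then have C: "group C" unfolding C_def by (rule subgroup.subgroup_is_group[OF _ G.is_group])
    have C_pow: "x [^]\<^bsub>C\<^esub> i = x [^]\<^bsub>G\<^esub> i" for x and i :: nat
      by (simp add: C_def G.nat_pow_consistent[symmetric])
    obtain \<zeta> where \<zeta>: "\<zeta> \<in> hom C G'" and \<zeta>_pow: "\<And>i::nat. \<zeta> (u [^]\<^bsub>C\<^esub> i) = z [^]\<^bsub>G'\<^esub> i"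
    proof (rule hom_of_generator[OF C G'.is_group _ z(1)])
      show "u \<in> carrier C" unfolding C_def using G.nat_pow_eone[OF u(1)] by (simp add: range_eqI[of _ _ 1])
      show "carrier C = range (\<lambda>i::nat. u [^]\<^bsub>C\<^esub> i)" unfolding C_pow by (simp add: C_def)
      show "z [^]\<^bsub>G'\<^esub> n = \<one>\<^bsub>G'\<^esub>" if "u [^]\<^bsub>C\<^esub> n = \<one>\<^bsub>C\<^esub>" for n :: nat
        using that unfolding C_pow
        by (intro elementary_pow_eq_one[OF G u(1,2) _ G' z(1)]) (simp add: C_def)
    qed blast
    have \<zeta>u: "\<zeta> (u [^]\<^bsub>G\<^esub> i) = z [^]\<^bsub>G'\<^esub> i" for i :: nat using \<zeta>_pow by (simp add: C_pow)
    \<comment> \<open>The second factor is the power of z that matches the component of x along u; g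
      does not see it.\<close>
    define h where "h x = h1 x \<otimes>\<^bsub>G'\<^esub> \<zeta> (r x)" for x
    have \<zeta>r: "\<exists>i::nat. \<zeta> (r x) = z [^]\<^bsub>G'\<^esub> i" if "x \<in> carrier G" for x
      using r_pow[OF that] \<zeta>u by metis
    have \<zeta>c: "\<zeta> (r x) \<in> carrier G'" if "x \<in> carrier G" for x
      using \<zeta>r[OF that] z(1) by auto
    have h_hom: "h \<in> hom G G'"
    proof (rule homI)
      show "h x \<in> carrier G'" if "x \<in> carrier G" for x
        using that h1G' \<zeta>c by (simp add: h_def)
      fix x y assume x: "x \<in> carrier G" and y: "y \<in> carrier G"
      obtain i j :: nat where ij: "r x = u [^]\<^bsub>G\<^esub> i" "r y = u [^]\<^bsub>G\<^esub> j" using r_pow x y by metis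
      have "r (x \<otimes>\<^bsub>G\<^esub> y) = u [^]\<^bsub>G\<^esub> (i + j)"
        using hom_mult[OF r(1) x y] ij u(1) by (simp add: G.nat_pow_mult)
      then have "\<zeta> (r (x \<otimes>\<^bsub>G\<^esub> y)) = \<zeta> (r x) \<otimes>\<^bsub>G'\<^esub> \<zeta> (r y)"
        using z(1) by (simp add: \<zeta>u ij G'.nat_pow_mult)
      then show "h (x \<otimes>\<^bsub>G\<^esub> y) = h x \<otimes>\<^bsub>G'\<^esub> h y"
        using x y h1G' \<zeta>c by (simp add: h_def h1_mult G'.m_ac)
    qed
    have "y \<in> h ` carrier G" if y: "y \<in> carrier G'" for y
    proof -
      obtain i :: nat where i: "r' y = z [^]\<^bsub>G'\<^esub> i" using r'_pow[OF y] by blast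
      define m where "m = y \<otimes>\<^bsub>G'\<^esub> inv\<^bsub>G'\<^esub> (r' y)"
      have "m \<in> M" unfolding m_def by (rule split[OF y])
      then obtain a where a: "a \<in> carrier G" "h1 a = m" using h1s by blast
      obtain k :: nat where k: "r a = u [^]\<^bsub>G\<^esub> k" using r_pow[OF a(1)] by blast
      \<comment> \<open>The element a already contributes the k-th power of z. Adding (p - 1) k to
        the exponent cancels it, since the total p k is killed, and leaves the i-th power that is
        wanted.\<close>
      define l where "l = i + (p - 1) * k"
      have kl: "k + l = i + p * k"
        unfolding l_def using prime_gt_0_nat[OF p] by (cases p) auto
      have u_l: "u [^]\<^bsub>G\<^esub> l \<in> carrier G" using u(1) by simp
      have "r (u [^]\<^bsub>G\<^esub> l) = u [^]\<^bsub>G\<^esub> l"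
        using hom_pow_nat[OF G.is_group G.is_group r(1) u(1), of l] r(2) by simp
      then have "r (a \<otimes>\<^bsub>G\<^esub> u [^]\<^bsub>G\<^esub> l) = u [^]\<^bsub>G\<^esub> (k + l)"
        using hom_mult[OF r(1) a(1) u_l] k u(1) by (simp add: G.nat_pow_mult)
      then have "\<zeta> (r (a \<otimes>\<^bsub>G\<^esub> u [^]\<^bsub>G\<^esub> l)) = z [^]\<^bsub>G'\<^esub> (i + p * k)" by (simp add: \<zeta>u kl)
      also have "\<dots> = z [^]\<^bsub>G'\<^esub> i \<otimes>\<^bsub>G'\<^esub> (z [^]\<^bsub>G'\<^esub> p) [^]\<^bsub>G'\<^esub> k"
        using z(1) by (simp add: G'.nat_pow_mult G'.nat_pow_pow)
      also have "\<dots> = r' y" using G' z(1) by (simp add: elementary_def i)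
      finally have "h (a \<otimes>\<^bsub>G\<^esub> u [^]\<^bsub>G\<^esub> l) = m \<otimes>\<^bsub>G'\<^esub> r' y"
        using h1_mult[OF a(1) u_l] h1u a h1G'[OF a(1)] by (simp add: h_def)
      also have "\<dots> = y" using y by (simp add: m_def G'.m_assoc)
      finally show ?thesis using a(1) u_l by (metis G.m_closed imageI)
    qed
    then have "h \<in> epi G G'" using h_hom by (auto simp: epi_def hom_def)
    moreover have "g (h x) = f x" if x: "x \<in> carrier G" for x
    proof -
      obtain i :: nat where "\<zeta> (r x) = z [^]\<^bsub>G'\<^esub> i" using \<zeta>r[OF x] by blast
      then have "g (h x) = g (h1 x) \<otimes>\<^bsub>H\<^esub> \<one>\<^bsub>H\<^esub>" using h1G'[OF x] z(1) gz by (simp add: h_def)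
      then show ?thesis using h1(2)[OF x] fh x by (simp add: hom_def Pi_iff)
    qed
    ultimately show ?thesis by blast
  qed
qed

text \<open>With u a generator of G, it is enough to find a generator w of G' over y = f u; then u
  \<mapsto> w defines the lift. If H is trivial, any generator of G' does; otherwise every preimage
  of y turns out to be a generator.\<close>

lemma cyclic_lift:
  assumes G: "group G" "finite (carrier G)" "cyclic_group G" "order G = p ^ a"
    and G': "group G'" "finite (carrier G')" "cyclic_group G'" "order G' = p ^ b"
    and H: "group H" "finite (carrier H)" "order H = p ^ c"
    and f: "f \<in> epi G H" and g: "g \<in> epi G' H" and le: "order G' \<le> order G"
  shows "\<exists>h\<in>epi G G'. \<forall>x\<in>carrier G. g (h x) = f x"
proof -
  interpret G: group G by fact
  interpret G': group G' by fact
  interpret H: group H by fact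
  have fh: "f \<in> hom G H" and fs: "f ` carrier G = carrier H" using f by (auto simp: epi_def)
  have gh: "g \<in> hom G' H" and gs: "g ` carrier G' = carrier H" using g by (auto simp: epi_def)
  note fpow = hom_pow_nat[OF G(1) H(1) fh] and gpow = hom_pow_nat[OF G'(1) H(1) gh]
  obtain u where u: "u \<in> carrier G" "carrier G = range (\<lambda>i::nat. u [^]\<^bsub>G\<^esub> i)"
    using G.carrier_eq_powers[OF G(2,3)] .
  obtain v where v: "v \<in> carrier G'" "carrier G' = range (\<lambda>i::nat. v [^]\<^bsub>G'\<^esub> i)"
    using G'.carrier_eq_powers[OF G'(2,3)] .
  define y where "y = f u"
  have y: "y \<in> carrier H" using fs u(1) by (auto simp: y_def)
  have "carrier H = range (\<lambda>i::nat. y [^]\<^bsub>H\<^esub> i)"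
  proof -
    have "carrier H = f ` range (\<lambda>i::nat. u [^]\<^bsub>G\<^esub> i)" using fs u(2) by simp
    also have "\<dots> = range (\<lambda>i::nat. y [^]\<^bsub>H\<^esub> i)"
      unfolding image_image fpow[OF u(1)] y_def ..
    finally show ?thesis .
  qed
  then have ordy: "H.ord y = p ^ c" using H.ord_generator[OF H(2) y] H(3) by simp
  obtain w where w: "w \<in> carrier G'" "g w = y" "carrier G' = range (\<lambda>i::nat. w [^]\<^bsub>G'\<^esub> i)"
  proof (cases "c = 0")
    case True
    then have "card (carrier H) = 1" using H(3) by (simp add: order_def)
    then obtain e where "carrier H = {e}" using card_1_singletonE by blast
    moreover have "g v \<in> carrier H" using gs v(1) by blast
    ultimately have "g v = y" using y by simp
    then show thesis using that v by blast
  next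
    case False
    obtain w where w: "w \<in> carrier G'" "g w = y" using gs y by (metis imageE)
    obtain i :: nat where i: "w = v [^]\<^bsub>G'\<^esub> i" using w(1) v(2) by auto
    have gv: "g v \<in> carrier H" using gs v(1) by blast
    \<comment> \<open>If p divided i, then y would be a p-th power in H and its order would be
      smaller than that of H, which y generates.\<close>
    have "\<not> p dvd i"
    proof
      assume "p dvd i"
      then obtain m where m: "i = p * m" by (auto simp: dvd_def)
      have "y = g v [^]\<^bsub>H\<^esub> i" using w(2) i gpow[OF v(1)] by simp
      then have "y [^]\<^bsub>H\<^esub> (p ^ (c - 1)) = g v [^]\<^bsub>H\<^esub> (p * m * p ^ (c - 1))"
        using gv by (simp add: H.nat_pow_pow m)
      also have "p * m * p ^ (c - 1) = order H * m"
        using False H(3) by (cases c) (auto simp: ac_simps)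
      also have "g v [^]\<^bsub>H\<^esub> (order H * m) = (g v [^]\<^bsub>H\<^esub> order H) [^]\<^bsub>H\<^esub> m"
        using gv by (simp add: H.nat_pow_pow)
      also have "\<dots> = \<one>\<^bsub>H\<^esub>" using H.pow_order_eq_1[OF gv] by simp
      finally have "p ^ c dvd p ^ (c - 1)" using H.pow_eq_id[OF y] ordy by simp
      then have "p ^ c \<le> p ^ (c - 1)" using prime_gt_0_nat[OF p] by (simp add: dvd_imp_le)
      then have "c \<le> c - 1" using prime_gt_1_nat[OF p] power_le_imp_le_exp by blast
      then show False using False by simp
    qed
    then have "coprime i (p ^ b)"
      using p by (metis coprime_commute coprime_power_right_iff prime_imp_coprime_nat)
    moreover have "v [^]\<^bsub>G'\<^esub> (p ^ b) = \<one>\<^bsub>G'\<^esub>" using G'.pow_order_eq_1[OF v(1)] G'(4) by simp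
    ultimately obtain j :: nat where j: "w [^]\<^bsub>G'\<^esub> j = v"
      using G'.exists_root_of_power[OF v(1)] i by blast
    have "carrier G' \<subseteq> range (\<lambda>i::nat. w [^]\<^bsub>G'\<^esub> i)"
    proof
      fix x assume "x \<in> carrier G'"
      then obtain n :: nat where "x = v [^]\<^bsub>G'\<^esub> n" using v(2) by auto
      then have "x = w [^]\<^bsub>G'\<^esub> (j * n)" using G'.nat_pow_pow[OF w(1), of j n] j by simp
      then show "x \<in> range (\<lambda>i::nat. w [^]\<^bsub>G'\<^esub> i)" by (rule range_eqI)
    qed
    moreover have "range (\<lambda>i::nat. w [^]\<^bsub>G'\<^esub> i) \<subseteq> carrier G'" using w(1) by auto
    ultimately show thesis using that[OF w] by blast
  qed
  have "b \<le> a" using le G(4) G'(4) prime_gt_1_nat[OF p] power_le_imp_le_exp by metis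
  \<comment> \<open>Between powers of p, comparison of orders becomes divisibility; this is why w
    satisfies the relations of u.\<close>
  then have dvd: "order G' dvd order G" using G(4) G'(4) by (simp add: le_imp_power_dvd)
  obtain h where h: "h \<in> hom G G'" and h_pow: "\<And>i::nat. h (u [^]\<^bsub>G\<^esub> i) = w [^]\<^bsub>G'\<^esub> i"
  proof (rule hom_of_generator[OF G(1) G'(1) u(1) w(1) u(2)])
    fix n :: nat assume "u [^]\<^bsub>G\<^esub> n = \<one>\<^bsub>G\<^esub>"
    then have "order G dvd n" using G.pow_eq_id[OF u(1)] G.ord_generator[OF G(2) u] by simp
    then obtain k where "n = order G' * k" using dvd dvd_trans by (metis dvd_def)
    then have "w [^]\<^bsub>G'\<^esub> n = (w [^]\<^bsub>G'\<^esub> order G') [^]\<^bsub>G'\<^esub> k" using w(1) by (simp add: G'.nat_pow_pow)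
    then show "w [^]\<^bsub>G'\<^esub> n = \<one>\<^bsub>G'\<^esub>" using G'.pow_order_eq_1[OF w(1)] by simp
  qed blast
  have "h ` carrier G = carrier G'" unfolding u(2) w(3) image_image h_pow ..
  then have "h \<in> epi G G'" using h by (simp add: epi_def)
  moreover have "g (h x) = f x" if x: "x \<in> carrier G" for x
  proof -
    obtain i :: nat where i: "x = u [^]\<^bsub>G\<^esub> i" using x u(2) by auto
    show ?thesis unfolding i h_pow gpow[OF w(1)] fpow[OF u(1)] w(2) y_def ..
  qed
  ultimately show ?thesis by blast
qed

end

section \<open>From families of abelian p-groups to categories with levels\<close>

lemma surjectionsD:
  assumes "f \<in> surjections G H"
  shows "f \<in> hom G H" "f ` carrier G = carrier H" "f \<in> extensional (carrier G)" "f \<in> epi G H"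
  using assms by (auto simp: surjections_def epi_def)

lemma surjections_closed: "f \<in> surjections G H \<Longrightarrow> x \<in> carrier G \<Longrightarrow> f x \<in> carrier H"
  using surjectionsD(2) by blast

lemma restrict_epi:
  assumes "f \<in> epi G H" "group G"
  shows "restrict f (carrier G) \<in> surjections G H"
proof -
  interpret group G by fact
  show ?thesis using assms(1) by (auto simp: surjections_def epi_def hom_def)
qed

lemma compose_surjections:
  assumes "group G" "f \<in> surjections G H" "g \<in> surjections H L"
  shows "compose (carrier G) g f \<in> surjections G L"
proof -
  have "(g \<circ> f) ` carrier G = carrier L"
    unfolding image_comp[symmetric] surjectionsD(2)[OF assms(2)] by (rule surjectionsD(2)[OF assms(3)])
  then have "(\<lambda>x. g (f x)) \<in> epi G L"
    using hom_compose[OF surjectionsD(1)[OF assms(2)] surjectionsD(1)[OF assms(3)]]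
    by (simp add: epi_def o_def)
  from restrict_epi[OF this assms(1)] show ?thesis by (simp add: compose_def)
qed

text \<open>Commutativity makes each conjugacy class of surjections a single map, so Hom sets are
  just sets of surjections. \<open>image\<close> admits the joint image of two surjections to the
  family, and \<open>lift_epi\<close> is the property with a genuinely different proof for each
  family.\<close>

locale abelian_p_family =
  fixes U :: "nat monoid set" and p :: nat
  assumes p: "Factorial_Ring.prime p"
    and comm: "G \<in> U \<Longrightarrow> comm_group G" and finite: "G \<in> U \<Longrightarrow> finite (carrier G)"
    and order: "G \<in> U \<Longrightarrow> \<exists>n. order G = p ^ n"
    and member: "\<exists>G\<in>U. order G = p ^ n"
    and image: "W \<in> U \<Longrightarrow> group G \<Longrightarrow> finite (carrier G) \<Longrightarrow> f \<in> epi W G \<Longrightarrow> G \<in> U"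
    and lift_epi: "G \<in> U \<Longrightarrow> G' \<in> U \<Longrightarrow> H \<in> U \<Longrightarrow> f \<in> epi G H \<Longrightarrow> g \<in> epi G' H \<Longrightarrow>
      order G' \<le> order G \<Longrightarrow> \<exists>h\<in>epi G G'. \<forall>x\<in>carrier G. g (h x) = f x"
begin

definition level :: "nat monoid \<Rightarrow> nat" where
  "level G = multiplicity p (order G)"

definition rep :: "nat \<Rightarrow> nat monoid" where
  "rep n = (SOME G. G \<in> U \<and> order G = p ^ n)"

lemma rep: "rep n \<in> U" "order (rep n) = p ^ n"
proof -
  have "\<exists>G. G \<in> U \<and> order G = p ^ n" using member by blast
  from someI_ex[OF this] show "rep n \<in> U" "order (rep n) = p ^ n" by (auto simp: rep_def)
qed

lemma group: "G \<in> U \<Longrightarrow> group G"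
  using comm by (simp add: comm_group_def)

lemma order_level: "G \<in> U \<Longrightarrow> order G = p ^ level G"
  using order[of G] p by (auto simp: level_def)

lemma level_rep: "level (rep n) = n"
  using p by (simp add: level_def rep)

lemma level_le_iff: "G \<in> U \<Longrightarrow> H \<in> U \<Longrightarrow> level G \<le> level H \<longleftrightarrow> order G \<le> order H"
  using prime_gt_1_nat[OF p] by (simp add: order_level power_increasing_iff)

text \<open>Such a map is a lift of the map from \<open>G\<close> to the trivial group.\<close>

lemma exists_epi:
  assumes "G \<in> U" "H \<in> U" "level H \<le> level G"
  obtains h where "h \<in> epi G H"
proof -
  have "card (carrier (rep 0)) = 1" using rep(2)[of 0] by (simp add: order_def)
  then obtain c where c: "carrier (rep 0) = {c}" using card_1_singletonE by blast
  interpret R: group "rep 0" by (rule group[OF rep(1)])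
  have cc: "c \<otimes>\<^bsub>rep 0\<^esub> c = c" using R.m_closed[of c c] c by simp
  have "(\<lambda>_. c) \<in> epi L (rep 0)" if L: "L \<in> U" for L
  proof -
    interpret L: group L by (rule group[OF L])
    show ?thesis using L.one_closed cc by (auto simp: epi_def hom_def c)
  qed
  then show thesis using lift_epi[OF assms(1,2) rep(1)] assms level_le_iff that by meson
qed

lemma conj_class_eq:
  assumes H: "H \<in> U" and f: "f \<in> surjections G H"
  shows "conj_class G H f = {f}"
proof -
  interpret comm_group H by (rule comm[OF H])
  have "(\<lambda>x\<in>carrier G. h \<otimes>\<^bsub>H\<^esub> f x \<otimes>\<^bsub>H\<^esub> inv\<^bsub>H\<^esub> h) = f" if h: "h \<in> carrier H" for h
  proof (rule extensionalityI[of _ "carrier G"])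
    show "f \<in> extensional (carrier G)" by (rule surjectionsD(3)[OF f])
    fix x assume x: "x \<in> carrier G"
    have "h \<otimes>\<^bsub>H\<^esub> f x \<otimes>\<^bsub>H\<^esub> inv\<^bsub>H\<^esub> h = f x"
      using h surjections_closed[OF f x] by (simp add: m_comm[of h] m_assoc)
    then show "(\<lambda>x\<in>carrier G. h \<otimes>\<^bsub>H\<^esub> f x \<otimes>\<^bsub>H\<^esub> inv\<^bsub>H\<^esub> h) x = f x" using x by simp
  qed simp
  then have "conj_class G H f = (\<lambda>_. f) ` carrier H"
    unfolding conj_class_def Setcompr_eq_image by (rule image_cong[OF refl])
  then show ?thesis using one_closed by blast
qed

lemma Hom_eq: "H \<in> U \<Longrightarrow> Hom G H = (\<lambda>f. {f}) ` surjections G H"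
  unfolding Hom_def by (rule image_cong[OF refl]) (rule conj_class_eq)

lemma HomE:
  assumes "H \<in> U" "\<alpha> \<in> Hom G H"
  obtains f where "f \<in> surjections G H" "\<alpha> = {f}"
  using assms Hom_eq by blast

lemma comp_class_singleton: "comp_class G {g} {f} = {compose (carrier G) g f}"
  by (auto simp: comp_class_def)

lemma id_surjections: "G \<in> U \<Longrightarrow> (\<lambda>x\<in>carrier G. x) \<in> surjections G G"
  by (rule restrict_epi[OF _ group]) (auto simp: epi_def hom_def)

lemma id_class_eq: "G \<in> U \<Longrightarrow> id_class G = {\<lambda>x\<in>carrier G. x}"
  unfolding id_class_def by (rule conj_class_eq[OF _ id_surjections])

lemma lift_Hom:
  assumes "G \<in> U" "G' \<in> U" "H \<in> U" "\<alpha> \<in> Hom G H" "\<beta> \<in> Hom G' H" "level G' \<le> level G"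
  shows "\<exists>\<gamma>\<in>Hom G G'. comp_class G \<beta> \<gamma> = \<alpha>"
proof -
  obtain f where f: "f \<in> surjections G H" "\<alpha> = {f}" using HomE[OF assms(3,4)] .
  obtain g where g: "g \<in> surjections G' H" "\<beta> = {g}" using HomE[OF assms(3,5)] .
  obtain h where h: "h \<in> epi G G'" "\<forall>x\<in>carrier G. g (h x) = f x"
    using lift_epi[OF assms(1-3) surjectionsD(4)[OF f(1)] surjectionsD(4)[OF g(1)]] assms(6)
      level_le_iff[OF assms(2,1)] by blast
  have "compose (carrier G) g (restrict h (carrier G)) = f"
    by (rule extensionalityI[of _ "carrier G"])
      (use h(2) surjectionsD(3)[OF f(1)] in \<open>simp_all add: compose_def\<close>)
  then have "comp_class G \<beta> {restrict h (carrier G)} = \<alpha>" by (simp add: g f comp_class_singleton)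
  moreover have "{restrict h (carrier G)} \<in> Hom G G'"
    using restrict_epi[OF h(1) group[OF assms(1)]] Hom_eq[OF assms(2)] by blast
  ultimately show ?thesis by blast
qed

lemma comp_Hom_closed:
  assumes "G \<in> U" "H \<in> U" "L \<in> U" "\<alpha> \<in> Hom G H" "\<beta> \<in> Hom H L"
  shows "comp_class G \<beta> \<alpha> \<in> Hom G L"
proof -
  obtain f where f: "f \<in> surjections G H" "\<alpha> = {f}" using HomE[OF assms(2,4)] .
  obtain g where g: "g \<in> surjections H L" "\<beta> = {g}" using HomE[OF assms(3,5)] .
  show ?thesis
    using compose_surjections[OF group[OF assms(1)] f(1) g(1)] Hom_eq[OF assms(3)]
    by (simp add: f g comp_class_singleton)
qed

lemma comp_Hom_assoc:
  assumes "G \<in> U" "H \<in> U" "L \<in> U" "T \<in> U" "\<alpha> \<in> Hom G H" "\<beta> \<in> Hom H L" "\<delta> \<in> Hom L T"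
  shows "comp_class G (comp_class H \<delta> \<beta>) \<alpha> = comp_class G \<delta> (comp_class G \<beta> \<alpha>)"
proof -
  obtain f where f: "f \<in> surjections G H" "\<alpha> = {f}" using HomE[OF assms(2,5)] .
  obtain g where g: "g \<in> surjections H L" "\<beta> = {g}" using HomE[OF assms(3,6)] .
  obtain h where h: "\<delta> = {h}" using HomE[OF assms(4,7)] .
  have "f \<in> carrier G \<rightarrow> carrier H" using surjections_closed[OF f(1)] by blast
  then have "compose (carrier G) (compose (carrier H) h g) f = compose (carrier G) h (compose (carrier G) g f)"
    by (rule compose_assoc[symmetric])
  then show ?thesis by (simp add: f g h comp_class_singleton)
qed

text \<open>The image of \<open>W\<close> in \<open>G \<times> H\<close> is a quotient of \<open>W\<close>, hence in the family, and
  its order is at most that of \<open>G \<times> H\<close>.\<close>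

lemma factor_Hom:
  assumes W: "W \<in> U" and G: "G \<in> U" and H: "H \<in> U" and \<alpha>: "\<alpha> \<in> Hom W G" and \<beta>: "\<beta> \<in> Hom W H"
  shows "\<exists>j\<le>level G + level H. \<exists>\<gamma>\<in>Hom W (rep j). \<exists>\<alpha>'\<in>Hom (rep j) G. \<exists>\<beta>'\<in>Hom (rep j) H.
    comp_class W \<alpha>' \<gamma> = \<alpha> \<and> comp_class W \<beta>' \<gamma> = \<beta>"
proof -
  obtain f where f: "f \<in> surjections W G" "\<alpha> = {f}" using HomE[OF G \<alpha>] .
  obtain g where g: "g \<in> surjections W H" "\<beta> = {g}" using HomE[OF H \<beta>] .
  interpret W: group W by (rule group[OF W])
  interpret G: group G by (rule group[OF G])
  interpret H: group H by (rule group[OF H])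
  interpret GH: group "G \<times>\<times> H" by (rule DirProd_group[OF G.is_group H.is_group])
  define q where "q x = (f x, g x)" for x
  have q: "q \<in> hom W (G \<times>\<times> H)"
    using surjectionsD(1)[OF f(1)] surjectionsD(1)[OF g(1)] by (auto simp: hom_def q_def Pi_iff)
  interpret q: group_hom W "G \<times>\<times> H" q
    using q by (simp add: group_hom_def group_hom_axioms_def W.is_group GH.is_group)
  define Q where "Q = (G \<times>\<times> H)\<lparr>carrier := q ` carrier W\<rparr>"
  have Q: "group Q" unfolding Q_def
    by (rule subgroup.subgroup_is_group[OF q.img_is_subgroup GH.is_group])
  have Qsub: "carrier Q \<subseteq> carrier G \<times> carrier H"
    using surjections_closed[OF f(1)] surjections_closed[OF g(1)] by (auto simp: Q_def q_def)
  have finQ: "finite (carrier Q)" using finite[OF W] by (simp add: Q_def)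
  \<comment> \<open>A copy of the joint image on natural numbers; as a quotient of W it belongs to
    the family.\<close>
  obtain N :: "nat monoid" and e where N: "group N" "finite (carrier N)" and e: "e \<in> iso Q N"
    using finite_group_transport[OF Q finQ] .
  interpret Q: group Q by (rule Q)
  have e_hom: "e \<in> hom Q N" and e_bij: "bij_betw e (carrier Q) (carrier N)" using e by (auto simp: iso_def)
  define d where "d = inv_into (carrier Q) e"
  have d: "d \<in> iso N Q" unfolding d_def by (rule Q.iso_set_sym[OF e])
  have d_hom: "d \<in> hom N Q" and ds: "d ` carrier N = carrier Q" using d by (auto simp: iso_def bij_betw_def)
  have de: "d (e x) = x" if "x \<in> carrier Q" for x
    unfolding d_def using that e_bij by (intro inv_into_f_f) (auto simp: bij_betw_def)
  have "q \<in> hom W Q" using q by (auto simp: hom_def Q_def)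
  then have "(\<lambda>x. e (q x)) \<in> hom W N" using hom_compose[OF _ e_hom] by (force simp: o_def)
  moreover have "(\<lambda>x. e (q x)) ` carrier W = carrier N"
    using e_bij by (simp add: bij_betw_def Q_def image_image)
  ultimately have eq_epi: "(\<lambda>x. e (q x)) \<in> epi W N" by (simp add: epi_def)
  have NU: "N \<in> U" by (rule image[OF W N eq_epi])
  define \<gamma>0 where "\<gamma>0 = {restrict (\<lambda>x. e (q x)) (carrier W)}"
  have \<gamma>0: "\<gamma>0 \<in> Hom W N"
    using restrict_epi[OF eq_epi W.is_group] Hom_eq[OF NU] by (simp add: \<gamma>0_def)
  have dQ: "fst (d y) \<in> carrier G" "snd (d y) \<in> carrier H" if "y \<in> carrier N" for y
    using subsetD[OF Qsub, of "d y"] imageI[OF that, of d] unfolding ds mem_Times_iff by blast+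
  have d_mult: "d (y \<otimes>\<^bsub>N\<^esub> z) = (fst (d y) \<otimes>\<^bsub>G\<^esub> fst (d z), snd (d y) \<otimes>\<^bsub>H\<^esub> snd (d z))"
    if "y \<in> carrier N" "z \<in> carrier N" for y z
    unfolding hom_mult[OF d_hom that] by (simp add: Q_def DirProd_def split_beta)
  have fst_epi: "(\<lambda>y. fst (d y)) \<in> epi N G"
  proof -
    have "(\<lambda>y. fst (d y)) \<in> hom N G"
      by (rule homI) (simp_all add: dQ d_mult)
    moreover have "(\<lambda>y. fst (d y)) ` carrier N = carrier G"
    proof -
      have "(\<lambda>y. fst (d y)) ` carrier N = fst ` carrier Q" by (simp add: ds[symmetric] image_image)
      also have "\<dots> = carrier G" using surjectionsD(2)[OF f(1)] by (simp add: Q_def q_def image_image)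
      finally show ?thesis .
    qed
    ultimately show ?thesis by (simp add: epi_def)
  qed
  have snd_epi: "(\<lambda>y. snd (d y)) \<in> epi N H"
  proof -
    have "(\<lambda>y. snd (d y)) \<in> hom N H"
      by (rule homI) (simp_all add: dQ d_mult)
    moreover have "(\<lambda>y. snd (d y)) ` carrier N = carrier H"
    proof -
      have "(\<lambda>y. snd (d y)) ` carrier N = snd ` carrier Q" by (simp add: ds[symmetric] image_image)
      also have "\<dots> = carrier H" using surjectionsD(2)[OF g(1)] by (simp add: Q_def q_def image_image)
      finally show ?thesis .
    qed
    ultimately show ?thesis by (simp add: epi_def)
  qed
  define \<alpha>0 where "\<alpha>0 = {restrict (\<lambda>y. fst (d y)) (carrier N)}"
  define \<beta>0 where "\<beta>0 = {restrict (\<lambda>y. snd (d y)) (carrier N)}"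
  have \<alpha>0: "\<alpha>0 \<in> Hom N G" using restrict_epi[OF fst_epi N(1)] Hom_eq[OF G] by (simp add: \<alpha>0_def)
  have \<beta>0: "\<beta>0 \<in> Hom N H" using restrict_epi[OF snd_epi N(1)] Hom_eq[OF H] by (simp add: \<beta>0_def)
  have eqN: "e (q x) \<in> carrier N" "d (e (q x)) = q x" if "x \<in> carrier W" for x
    using that de e_bij by (auto simp: bij_betw_def Q_def)
  have "comp_class W \<alpha>0 \<gamma>0 = \<alpha>"
    unfolding \<alpha>0_def \<gamma>0_def comp_class_singleton f(2)
    by (rule arg_cong[of _ _ "\<lambda>h. {h}"], rule extensionalityI[of _ "carrier W"])
      (use surjectionsD(3)[OF f(1)] eqN in \<open>simp_all add: compose_def q_def\<close>)
  moreover have "comp_class W \<beta>0 \<gamma>0 = \<beta>"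
    unfolding \<beta>0_def \<gamma>0_def comp_class_singleton g(2)
    by (rule arg_cong[of _ _ "\<lambda>h. {h}"], rule extensionalityI[of _ "carrier W"])
      (use surjectionsD(3)[OF g(1)] eqN in \<open>simp_all add: compose_def q_def\<close>)
  moreover have "level N \<le> level G + level H"
  proof -
    have "order N = card (carrier Q)" using bij_betw_same_card[OF e_bij] by (simp add: order_def)
    also have "\<dots> \<le> card (carrier G \<times> carrier H)"
      using Qsub finite[OF G] finite[OF H] by (intro card_mono) auto
    also have "\<dots> = p ^ (level G + level H)"
      using order_level[OF G] order_level[OF H] by (simp add: card_cartesian_product order_def power_add)
    finally have "p ^ level N \<le> p ^ (level G + level H)" by (simp add: order_level[OF NU])
    then show ?thesis using prime_gt_1_nat[OF p] power_le_imp_le_exp by blast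
  qed
  moreover
  define j where "j = level N"
  have lev: "level (rep j) = level N" by (simp add: j_def level_rep)
  have rU: "rep j \<in> U" by (rule rep(1))
  have idN: "id_class N \<in> Hom N N" unfolding id_class_eq[OF NU] Hom_eq[OF NU] using id_surjections[OF NU] by blast
  obtain t where t: "t \<in> surjections N N" "id_class N = {t}" using HomE[OF NU idN] .
  \<comment> \<open>N is to be replaced by the representative of its level. A morphism \<delta>'
    from \<open>rep j\<close> to N has a right inverse \<delta>, so going from N through \<delta>
    and back through \<delta>' changes nothing.\<close>
  obtain h where "h \<in> epi (rep j) N" using exists_epi[OF rU NU] lev by auto
  then obtain \<delta>' where d': "\<delta>' \<in> Hom (rep j) N"
    using restrict_epi[OF _ group[OF rU]] Hom_eq[OF NU] by blast
  obtain \<delta> where \<delta>: "\<delta> \<in> Hom N (rep j)" "comp_class N \<delta>' \<delta> = id_class N"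
    using lift_Hom[OF NU rU NU idN d'] lev by auto
  define \<gamma> where "\<gamma> = comp_class W \<delta> \<gamma>0"
  have \<gamma>: "\<gamma> \<in> Hom W (rep j)" unfolding \<gamma>_def by (rule comp_Hom_closed[OF W NU rU \<gamma>0 \<delta>(1)])
  have "comp_class W (id_class N) \<gamma>0 = \<gamma>0"
  proof -
    have "compose (carrier W) (\<lambda>x\<in>carrier N. x) (\<lambda>x\<in>carrier W. e (q x)) = (\<lambda>x\<in>carrier W. e (q x))"
      by (rule extensionalityI[of _ "carrier W"]) (simp_all add: compose_def eqN)
    then show ?thesis by (simp add: id_class_eq[OF NU] \<gamma>0_def comp_class_singleton)
  qed
  then have \<delta>'\<gamma>: "comp_class W \<delta>' \<gamma> = \<gamma>0"
    unfolding \<gamma>_def using comp_Hom_assoc[OF W NU rU NU \<gamma>0 \<delta>(1) d'] \<delta>(2) by simp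
  have "comp_class W (comp_class (rep j) \<alpha>0 \<delta>') \<gamma> = comp_class W \<alpha>0 \<gamma>0"
    using comp_Hom_assoc[OF W rU NU G \<gamma> d' \<alpha>0] \<delta>'\<gamma> by simp
  moreover have "comp_class W (comp_class (rep j) \<beta>0 \<delta>') \<gamma> = comp_class W \<beta>0 \<gamma>0"
    using comp_Hom_assoc[OF W rU NU H \<gamma> d' \<beta>0] \<delta>'\<gamma> by simp
  moreover have "comp_class (rep j) \<alpha>0 \<delta>' \<in> Hom (rep j) G" "comp_class (rep j) \<beta>0 \<delta>' \<in> Hom (rep j) H"
    by (rule comp_Hom_closed[OF rU NU G d' \<alpha>0], rule comp_Hom_closed[OF rU NU H d' \<beta>0])
  ultimately show ?thesis using \<gamma> j_def by metis
qed

lemma level_category: "level_category U level rep"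
proof
  fix G H assume G: "G \<in> U" and H: "H \<in> U"
  interpret G: group G by (rule group[OF G])
  have fs: "surjections G H \<subseteq> (\<Pi>\<^sub>E x\<in>carrier G. carrier H)"
    using surjections_closed[of _ G H] surjectionsD(3)[of _ G H] by (auto simp: PiE_def Pi_iff)
  then show "Finite_Set.finite (Hom G H)"
    unfolding Hom_eq[OF H] using finite[OF G] finite[OF H] by (intro finite_imageI finite_subset[OF fs] finite_PiE)
  show "(Hom G H = {}) = (level G < level H)"
  proof
    assume e: "Hom G H = {}"
    show "level G < level H"
    proof (rule ccontr)
      assume "\<not> level G < level H"
      then obtain h where "h \<in> epi G H" using exists_epi[OF G H] by auto
      then have "restrict h (carrier G) \<in> surjections G H" by (rule restrict_epi[OF _ G.is_group])
      then show False using e Hom_eq[OF H] by blast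
    qed
  next
    assume l: "level G < level H"
    show "Hom G H = {}"
    proof (rule ccontr)
      assume "Hom G H \<noteq> {}"
      then obtain f where "f \<in> surjections G H" using Hom_eq[OF H] by blast
      then have "order H \<le> order G"
        using surjectionsD(2) card_image_le[OF finite[OF G]] by (metis order_def)
      then show False using level_le_iff[OF H G] l by simp
    qed
  qed
next
  fix G H L \<alpha> \<beta> \<beta>' assume G: "G \<in> U" and H: "H \<in> U" and L: "L \<in> U" and a: "\<alpha> \<in> Hom G H"
    and b: "\<beta> \<in> Hom H L" "\<beta>' \<in> Hom H L" and eq: "comp_class G \<beta> \<alpha> = comp_class G \<beta>' \<alpha>"
  obtain f where f: "f \<in> surjections G H" "\<alpha> = {f}" using HomE[OF H a] .
  obtain g where g: "g \<in> surjections H L" "\<beta> = {g}" using HomE[OF L b(1)] .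
  obtain g' where g': "g' \<in> surjections H L" "\<beta>' = {g'}" using HomE[OF L b(2)] .
  have c: "compose (carrier G) g f = compose (carrier G) g' f"
    using eq by (simp add: f g g' comp_class_singleton)
  have "g = g'"
  proof (rule extensionalityI[of _ "carrier H"])
    fix y assume "y \<in> carrier H"
    then obtain x where x: "x \<in> carrier G" "y = f x" using surjectionsD(2)[OF f(1)] by blast
    then show "g y = g' y" using fun_cong[OF c, of x] by (simp add: compose_def)
  qed (rule surjectionsD(3)[OF g(1)], rule surjectionsD(3)[OF g'(1)])
  then show "\<beta> = \<beta>'" by (simp add: g g')
next
  show "id_class G \<in> Hom G G" if "G \<in> U" for G
    unfolding id_class_eq[OF that] Hom_eq[OF that] using id_surjections[OF that] by blast
  fix G H \<alpha> assume G: "G \<in> U" and H: "H \<in> U" and a: "\<alpha> \<in> Hom G H"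
  obtain f where f: "f \<in> surjections G H" "\<alpha> = {f}" using HomE[OF H a] .
  have "compose (carrier G) (\<lambda>x\<in>carrier H. x) f = f"
    by (rule extensionalityI[of _ "carrier G"])
      (use surjectionsD(3)[OF f(1)] surjections_closed[OF f(1)] in \<open>simp_all add: compose_def\<close>)
  then show "comp_class G (id_class H) \<alpha> = \<alpha>"
    by (simp add: id_class_eq[OF H] f(2) comp_class_singleton)
  have "compose (carrier G) f (\<lambda>x\<in>carrier G. x) = f"
    by (rule extensionalityI[of _ "carrier G"])
      (use surjectionsD(3)[OF f(1)] in \<open>simp_all add: compose_def\<close>)
  then show "comp_class G \<alpha> (id_class G) = \<alpha>"
    by (simp add: id_class_eq[OF G] f(2) comp_class_singleton)
qed (fact comp_Hom_closed comp_Hom_assoc lift_Hom factor_Hom rep(1) level_rep)+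

end

section \<open>The two families\<close>

lemma elementary_epi_image:
  assumes p: "Factorial_Ring.prime p" and G: "elementary p G" and H: "group H" and f: "f \<in> epi G H"
  shows "elementary p H"
proof -
  interpret G: comm_group G using G by (simp add: elementary_def)
  interpret H: group H by (rule H)
  have fh: "f \<in> hom G H" and fs: "carrier H = f ` carrier G" using f by (auto simp: epi_def)
  have "comm_group H"
  proof (rule H.group_comm_groupI)
    fix x y assume "x \<in> carrier H" "y \<in> carrier H"
    then obtain a b where "a \<in> carrier G" "x = f a" "b \<in> carrier G" "y = f b" using fs by auto
    then show "x \<otimes>\<^bsub>H\<^esub> y = y \<otimes>\<^bsub>H\<^esub> x" using hom_mult[OF fh] G.m_comm by metis
  qed
  moreover have "y [^]\<^bsub>H\<^esub> p = \<one>\<^bsub>H\<^esub>" if y: "y \<in> carrier H" for y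
  proof -
    obtain a where a: "a \<in> carrier G" "y = f a" using y fs by auto
    have "y [^]\<^bsub>H\<^esub> p = f (a [^]\<^bsub>G\<^esub> p)" using hom_pow_nat[OF G.is_group H fh a(1)] a(2) by simp
    also have "\<dots> = \<one>\<^bsub>H\<^esub>" using G a(1) hom_one[OF fh G.is_group H] by (simp add: elementary_def)
    finally show ?thesis .
  qed
  ultimately show ?thesis using G fs by (simp add: elementary_def)
qed

lemma elementary_abelian_groups_iff:
  "Factorial_Ring.prime p \<Longrightarrow> G \<in> elementary_abelian_groups p \<longleftrightarrow> elementary p G"
  by (auto simp: elementary_abelian_groups_def elementary_def finite_groups_def comm_group_def)

text \<open>Direct powers of the integers modulo p, built one factor at a time and copied to the
  natural numbers at each stage.\<close>

lemma exists_elementary: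
  assumes p: "Factorial_Ring.prime p"
  shows "\<exists>Q :: nat monoid. elementary p Q \<and> order Q = p ^ n"
proof (induction n)
  case 0
  interpret S: group "singleton_group (0::nat)" by simp
  have "comm_group (singleton_group (0::nat))" by (rule S.group_comm_groupI) simp
  moreover have "0 [^]\<^bsub>singleton_group (0::nat)\<^esub> p = \<one>\<^bsub>singleton_group (0::nat)\<^esub>"
    using S.nat_pow_closed[of 0 p] S.one_closed by simp
  ultimately have "elementary p (singleton_group (0::nat))" by (simp add: elementary_def)
  then show ?case by (intro exI[of _ "singleton_group 0"]) (simp add: order_def)
next
  case (Suc n)
  then obtain Q :: "nat monoid" where Q: "elementary p Q" "order Q = p ^ n" by blast
  let ?Z = "integer_mod_group p"
  have Qf: "finite (carrier Q)" using Q(1) by (simp add: elementary_def)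
  interpret Q: comm_group Q using Q(1) by (simp add: elementary_def)
  interpret P: group "Q \<times>\<times> ?Z" by (rule DirProd_group) (simp_all add: Q.is_group)
  have Zc: "carrier ?Z = {0..<int p}"
    using prime_gt_0_nat[OF p] by (simp add: carrier_integer_mod_group)
  have fin: "finite (carrier (Q \<times>\<times> ?Z))" using Qf by (simp add: DirProd_def Zc)
  have pow: "x [^]\<^bsub>Q \<times>\<times> ?Z\<^esub> k = (fst x [^]\<^bsub>Q\<^esub> k, snd x [^]\<^bsub>?Z\<^esub> k)" for x and k :: nat
    by (induction k) (simp_all add: DirProd_def split_beta mod_simps algebra_simps)
  have "x [^]\<^bsub>Q \<times>\<times> ?Z\<^esub> p = \<one>\<^bsub>Q \<times>\<times> ?Z\<^esub>" if "x \<in> carrier (Q \<times>\<times> ?Z)" for x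
    unfolding pow using that Q(1) by (auto simp: elementary_def DirProd_def)
  moreover have "comm_group (Q \<times>\<times> ?Z)"
    by (rule P.group_comm_groupI) (auto simp: DirProd_def Q.m_comm add.commute)
  ultimately have eP: "elementary p (Q \<times>\<times> ?Z)" using fin by (simp add: elementary_def)
  obtain N :: "nat monoid" and e where N: "group N" "finite (carrier N)" "e \<in> iso (Q \<times>\<times> ?Z) N"
    using finite_group_transport[OF P.is_group fin] .
  have "order N = order (Q \<times>\<times> ?Z)"
    using N(3) bij_betw_same_card[of e] by (auto simp: iso_def order_def)
  also have "\<dots> = p ^ Suc n"
    using Q(2) by (simp add: order_def DirProd_def card_cartesian_product Zc)
  finally show ?case
    using elementary_epi_image[OF p eP N(1)] N(3) by (auto simp: iso_iff_mon_epi)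
qed

lemma abelian_p_family_elementary:
  assumes p: "Factorial_Ring.prime p"
  shows "abelian_p_family (elementary_abelian_groups p) p"
proof (rule abelian_p_family.intro)
  note iff = elementary_abelian_groups_iff[OF p]
  show "comm_group G" "finite (carrier G)" "\<exists>n. order G = p ^ n" if "G \<in> elementary_abelian_groups p" for G
    using that elementary_order[OF p, of G] by (simp_all add: iff elementary_def)
  show "\<exists>G\<in>elementary_abelian_groups p. order G = p ^ n" for n
    using exists_elementary[OF p] iff by blast
  show "G \<in> elementary_abelian_groups p"
    if "W \<in> elementary_abelian_groups p" "group G" "finite (carrier G)" "f \<in> epi W G" for W G f
    using elementary_epi_image[OF p _ that(2,4)] that(1) by (simp add: iff)
  fix G G' H :: "nat monoid" and f g
  assume U: "G \<in> elementary_abelian_groups p" "G' \<in> elementary_abelian_groups p"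
      "H \<in> elementary_abelian_groups p"
    and fg: "f \<in> epi G H" "g \<in> epi G' H" "order G' \<le> order G"
  have "group H" using U(3) by (simp add: iff elementary_def comm_group_def)
  from elementary_lift[OF p _ this fg(1) _ fg(2,3)] U
  show "\<exists>h\<in>epi G G'. \<forall>x\<in>carrier G. g (h x) = f x" by (simp add: iff)
qed (rule p)

lemma exists_cyclic:
  assumes "m > 0"
  shows "\<exists>Q :: nat monoid. group Q \<and> finite (carrier Q) \<and> cyclic_group Q \<and> order Q = m"
proof -
  let ?Z = "integer_mod_group m"
  have Zc: "carrier ?Z = {0..<int m}" using assms by (simp add: carrier_integer_mod_group)
  have "cyclic_group ?Z"
  proof -
    \<comment> \<open>Writing the generator as \<open>1 mod int m\<close> covers m = 1, where it is
      0.\<close>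
    have "carrier ?Z = range (\<lambda>n::int. (1 mod int m) [^]\<^bsub>?Z\<^esub> n)"
    proof -
      have "(1 mod int m) [^]\<^bsub>?Z\<^esub> n = n mod int m" for n :: int
        by (simp add: int_pow_integer_mod_group mod_simps)
      moreover have "n \<in> range (\<lambda>n. n mod int m)" if "n \<in> {0..<int m}" for n
        using that by (intro range_eqI[of _ _ n]) simp
      ultimately show ?thesis using assms by (auto simp: Zc)
    qed
    moreover have "1 mod int m \<in> carrier ?Z" using assms by (simp add: Zc)
    ultimately show ?thesis using group.cyclic_group[OF group_integer_mod_group] by blast
  qed
  moreover have fin: "finite (carrier ?Z)" by (simp add: Zc)
  moreover obtain N :: "nat monoid" and e where N: "group N" "finite (carrier N)" "e \<in> iso ?Z N"
    using finite_group_transport[OF group_integer_mod_group fin] .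
  moreover have "order N = m"
    using N(3) bij_betw_same_card[of e "carrier ?Z" "carrier N"] by (simp add: iso_def order_def Zc)
  ultimately show ?thesis
    using group.cyclic_group_epimorphic_image[OF group_integer_mod_group, of e m N]
    by (auto simp: iso_iff_mon_epi)
qed

lemma cyclic_p_groups_iff:
  "G \<in> cyclic_p_groups p \<longleftrightarrow>
    group G \<and> finite (carrier G) \<and> cyclic_group G \<and> (\<exists>n. order G = p ^ n)"
  by (auto simp: cyclic_p_groups_def finite_groups_def)

text \<open>The image of a generator generates H, and its order divides that of G. So quotients of
  cyclic p-groups again have p-power order.\<close>

lemma order_cyclic_epi_image:
  assumes G: "group G" "finite (carrier G)" "cyclic_group G" and H: "group H" and f: "f \<in> epi G H"
  shows "order H dvd order G"
proof -
  interpret G: group G by fact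
  interpret H: group H by fact
  have fh: "f \<in> hom G H" and fs: "carrier H = f ` carrier G" using f by (auto simp: epi_def)
  obtain u where u: "u \<in> carrier G" "carrier G = range (\<lambda>i::nat. u [^]\<^bsub>G\<^esub> i)"
    using G.carrier_eq_powers[OF G(2,3)] .
  note pow = hom_pow_nat[OF G(1) H fh u(1)]
  have fu: "f u \<in> carrier H" using u(1) fs by blast
  have "carrier H = range (\<lambda>i::nat. f u [^]\<^bsub>H\<^esub> i)" unfolding fs u(2) by (simp add: image_image pow)
  moreover have "finite (carrier H)" unfolding fs using G(2) by (rule finite_imageI)
  ultimately have "H.ord (f u) = order H" using H.ord_generator fu by blast
  moreover have "f u [^]\<^bsub>H\<^esub> order G = \<one>\<^bsub>H\<^esub>"
    unfolding pow[symmetric] using G.pow_order_eq_1[OF u(1)] hom_one[OF fh G(1) H] by simp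
  ultimately show ?thesis using H.pow_eq_id[OF fu] by simp
qed

lemma abelian_p_family_cyclic:
  assumes p: "Factorial_Ring.prime p"
  shows "abelian_p_family (cyclic_p_groups p) p"
proof (rule abelian_p_family.intro)
  note iff = cyclic_p_groups_iff
  show "comm_group G" "finite (carrier G)" "\<exists>n. order G = p ^ n" if "G \<in> cyclic_p_groups p" for G
    using that group.cyclic_imp_abelian_group[of G] by (simp_all add: iff)
  show "\<exists>G\<in>cyclic_p_groups p. order G = p ^ n" for n
    using exists_cyclic[of "p ^ n"] prime_gt_0_nat[OF p] iff by (metis zero_less_power)
  show "G \<in> cyclic_p_groups p"
    if W: "W \<in> cyclic_p_groups p" and G: "group G" "finite (carrier G)" and f: "f \<in> epi W G" for W G f
  proof -
    obtain n where n: "order W = p ^ n" using W iff by blast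
    have "order G dvd p ^ n" unfolding n[symmetric]
      using order_cyclic_epi_image[OF _ _ _ G(1) f] W by (simp add: iff)
    then have "\<exists>n. order G = p ^ n" using divides_primepow_nat[OF p] by blast
    moreover have "cyclic_group G"
      using group.cyclic_group_epimorphic_image[OF _ f _ G(1)] W by (simp add: iff)
    ultimately show ?thesis using G by (simp add: iff)
  qed
  fix G G' H :: "nat monoid" and f g
  assume U: "G \<in> cyclic_p_groups p" "G' \<in> cyclic_p_groups p" "H \<in> cyclic_p_groups p"
    and fg: "f \<in> epi G H" "g \<in> epi G' H" "order G' \<le> order G"
  obtain a b c where "order G = p ^ a" "order G' = p ^ b" "order H = p ^ c" using U iff by blast
  from cyclic_lift[OF p _ _ _ this(1) _ _ _ this(2) _ _ this(3) fg] U
  show "\<exists>h\<in>epi G G'. \<forall>x\<in>carrier G. g (h x) = f x" by (simp add: iff)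
qed (rule p)

theorem corollary5p8:
  fixes K :: "'k ring" and p :: nat and U :: "nat monoid set"
  assumes "field K"
    and "\<And>n::nat. n > 0 \<Longrightarrow> add_pow K n \<one>\<^bsub>K\<^esub> \<noteq> \<zero>\<^bsub>K\<^esub>"
    and "Factorial_Ring.prime p"
    and "U = elementary_abelian_groups p \<or> U = cyclic_p_groups p"
  shows "Spc K U homeomorphic_space Alexandroff_compactification (discrete_topology (UNIV :: nat set))"
proof -
  have "abelian_p_family U p"
    using assms(3,4) abelian_p_family_elementary abelian_p_family_cyclic by blast
  then interpret abelian_p_family U p .
  have "field_level_category U level rep K"
    using level_category assms(1) by (rule field_level_category.intro)
  then show ?thesis by (rule field_level_category.Spc_homeomorphic)
qed

end
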